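(* Let $G$ be a group and let $(A,\Delta)$ be a regular $G$-cograded multiplier Hopf algebra with decomposition $A=\bigoplus_{p\in G}A_p$, where every $A_p$ is a finite-dimensional algebra with identity. Then: i) $(A,\Delta)$ has integrals, i.e. there exist a left integral and a right integral on $A$. ii) The dual $\hat A$ of $A$ is a (usual) Hopf algebra. As a space of functionals, $\hat A=A^*$ where $A^*=\bigoplus_{p\in G}A_p'$, and the Hopf algebra structure on $A^*$ is the following: for $f\in A_p'$, $g\in A_q'$ the product $fg\in A_{pq}'$ is $(fg)(x)=(f\otimes g)(\Delta_{p,q}(x))$ for $x\in A_{pq}$; the identity is $\varepsilon|_{A_e}\in A_e'$; the coproduct maps $A_p'$ to $A_p'\otimes A_p'$ by $(\Delta(f))(x\otimes y)=f(xy)$ for $x,y\in A_p$; the counit is $f\mapsto f(1_p)$ for $f\in A_p'$, where $1_p$ is the identity of $A_p$; and the antipode maps $f\in A_p'$ to $S(f)\in A_{p^{-1}}'$ with $(S(f))(x)=f(S(x))$ for $x\in A_{p^{-1}}$.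
   Context: All algebras are over $\mathbb{C}$ with non-degenerate product. $M(A)$ is the multiplier algebra of $A$; $\iota$ denotes identity maps; $e$ is the identity of $G$. A multiplier Hopf algebra is a pair $(A,\Delta)$, where $\Delta:A\to M(A\otimes A)$ is a homomorphism such that $\Delta(a)(1\otimes b)\in A\otimes A$ and $(a\otimes 1)\Delta(b)\in A\otimes A$ for all $a,b\in A$, such that $(a\otimes1\otimes1)(\Delta\otimes\iota)(\Delta(b)(1\otimes c))=((\iota\otimes\Delta)((a\otimes1)\Delta(b)))(1\otimes1\otimes c)$ for all $a,b,c$, and such that the linear maps $a\otimes b\mapsto\Delta(a)(1\otimes b)$ and $a\otimes b\mapsto(a\otimes1)\Delta(b)$ are bijections of $A\otimes A$ onto itself. It has a unique counit $\varepsilon:A\to\mathbb{C}$ (a homomorphism with $(\varepsilon\otimes\iota)(\Delta(a)(1\otimes b))=ab$, $(\iota\otimes\varepsilon)((a\otimes1)\Delta(b))=ab$) and a unique antipode $S:A\to M(A)$ (an anti-homomorphism with $m((S\otimes\iota)(\Delta(a)(1\otimes b)))=\varepsilon(a)b$, $m((\iota\otimes S)((b\otimes1)\Delta(a)))=\varepsilon(a)b$, $m$ being multiplication). It is regular if $(A,\Delta^{\mathrm{op}})$ is also a multiplier Hopf algebra; equivalently $S$ is a bijection of $A$ onto $A$. $(A,\Delta)$ is $G$-cograded if there are non-trivial subalgebras $(A_p)_{p\in G}$ with $A=\bigoplus_{p\in G}A_p$, $A_pA_q=0$ for $p\ne q$, and $\Delta(A_{pq})(1\otimes A_q)=A_p\otimes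 A_q=(A_p\otimes1)\Delta(A_{pq})$ (linear spans) for all $p,q$. Then $M(A\otimes A)=\prod_{p,q}M(A_p\otimes A_q)$, and $\Delta_{p,q}:A_{pq}\to A_p\otimes A_q$ denotes the $(p,q)$-component of $\Delta$ restricted to $A_{pq}$. In the regular case $S(A_p)=A_{p^{-1}}$. Functionals on $A_p$ are extended by $0$ to the other components, so $A^*$ is a subspace of the full dual $A'=\prod_pA_p'$. A left integral on $A$ is a non-zero linear functional $\varphi$ with $(\iota\otimes\varphi)\Delta(a)=\varphi(a)1$ in $M(A)$ for all $a\in A$; a right integral is a non-zero functional $\psi$ with $(\psi\otimes\iota)\Delta(a)=\psi(a)1$. Here $(\iota\otimes\varphi)\Delta(a)\in M(A)$ is defined by $((\iota\otimes\varphi)\Delta(a))b=(\iota\otimes\varphi)(\Delta(a)(b\otimes1))$ and $b((\iota\otimes\varphi)\Delta(a))=(\iota\otimes\varphi)((b\otimes1)\Delta(a))$, and similarly on the other side. If $\varphi$ is a left integral, the dual $\hat A$ of $A$ is the space of functionals on $A$ of the form $x\mapsto\varphi(xa)$, $a\in A$, which is a regular multiplier Hopf algebra with product and coproduct dual to the coproduct and product of $A$, respectively. *)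

theory Defs
  imports
    Complex_Main
    "HOL-Library.Poly_Mapping"
    "HOL-Library.Function_Algebras"
    "HOL-Algebra.Group"
begin

section \<open>Complex vector spaces and algebras\<close>

class complex_vector = ab_group_add +
  fixes scaleC :: "complex \<Rightarrow> 'a \<Rightarrow> 'a"  (infixr \<open>*\<^sub>C\<close> 75)
  assumes scaleC_add_right: "c *\<^sub>C (x + y) = c *\<^sub>C x + c *\<^sub>C y"
    and scaleC_add_left: "(c + d) *\<^sub>C x = c *\<^sub>C x + d *\<^sub>C x"
    and scaleC_scaleC: "c *\<^sub>C d *\<^sub>C x = (c * d) *\<^sub>C x"
    and scaleC_one: "1 *\<^sub>C x = x"

global_interpretation complex_vector: vector_space "scaleC :: complex \<Rightarrow> 'a \<Rightarrow> 'a::complex_vector"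
  defines csubspace = complex_vector.subspace
    and cspan = complex_vector.span
  by unfold_locales
    (simp_all add: scaleC_add_right scaleC_add_left scaleC_scaleC scaleC_one)

global_interpretation complex_vector: vector_space_pair
    "scaleC :: complex \<Rightarrow> 'a \<Rightarrow> 'a::complex_vector"
    "scaleC :: complex \<Rightarrow> 'b \<Rightarrow> 'b::complex_vector"
  by unfold_locales

text \<open>Associative algebras, not necessarily unital or commutative.\<close>

class complex_algebra = complex_vector + ring +
  assumes scaleC_mult_left: "(c *\<^sub>C x) * y = c *\<^sub>C (x * y)"
    and scaleC_mult_right: "x * (c *\<^sub>C y) = c *\<^sub>C (x * y)"

abbreviation clinear :: "('a::complex_vector \<Rightarrow> 'b::complex_vector) \<Rightarrow> bool"
  where "clinear \<equiv> Vector_Spaces.linear scaleC scaleC"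

lemma clinear_iff:
  "clinear f \<longleftrightarrow> (\<forall>x y. f (x + y) = f x + f y) \<and> (\<forall>c x. f (c *\<^sub>C x) = c *\<^sub>C f x)"
  by (simp add: Vector_Spaces.linear_iff complex_vector.vector_space_axioms)

lemma clinear_0: "clinear f \<Longrightarrow> f 0 = 0"
  by (rule complex_vector.linear_0)

lemma clinear_sum: "clinear f \<Longrightarrow> f (sum g I) = (\<Sum>i\<in>I. f (g i))"
  by (rule complex_vector.linear_sum)

definition linear_on :: "'a::complex_vector set \<Rightarrow> ('a \<Rightarrow> 'b::complex_vector) \<Rightarrow> bool"
  where "linear_on V f \<longleftrightarrow>
    (\<forall>x\<in>V. \<forall>y\<in>V. f (x + y) = f x + f y) \<and> (\<forall>c. \<forall>x\<in>V. f (c *\<^sub>C x) = c *\<^sub>C f x)"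

definition bilinear_on ::
  "'a::complex_vector set \<Rightarrow> 'b::complex_vector set \<Rightarrow> ('a \<Rightarrow> 'b \<Rightarrow> 'c::complex_vector) \<Rightarrow> bool"
  where "bilinear_on V W f \<longleftrightarrow>
    (\<forall>x\<in>V. linear_on W (f x)) \<and> (\<forall>y\<in>W. linear_on V (\<lambda>x. f x y))"

lemma linear_on_UNIV: "linear_on UNIV f \<longleftrightarrow> clinear f"
  by (simp add: linear_on_def clinear_iff)

instantiation complex :: complex_algebra
begin
definition scaleC_complex :: "complex \<Rightarrow> complex \<Rightarrow> complex" where "scaleC_complex c x = c * x"
instance by standard (simp_all add: scaleC_complex_def algebra_simps)
end

instantiation "fun" :: (type, complex_vector) complex_vector
begin
definition scaleC_fun :: "complex \<Rightarrow> ('a \<Rightarrow> 'b) \<Rightarrow> 'a \<Rightarrow> 'b" where "scaleC_fun c f = (\<lambda>x. c *\<^sub>C f x)"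
instance
  by standard
    (simp_all add: scaleC_fun_def fun_eq_iff scaleC_add_right scaleC_add_left scaleC_scaleC scaleC_one)
end

instantiation poly_mapping :: (type, complex_vector) complex_vector
begin
lift_definition scaleC_poly_mapping :: "complex \<Rightarrow> ('a \<Rightarrow>\<^sub>0 'b) \<Rightarrow> 'a \<Rightarrow>\<^sub>0 'b"
  is "\<lambda>c f k. c *\<^sub>C f k"
proof -
  fix c and f :: "'a \<Rightarrow> 'b" assume "finite {x. f x \<noteq> 0}"
  moreover have "{x. c *\<^sub>C f x \<noteq> 0} \<subseteq> {x. f x \<noteq> 0}" by auto
  ultimately show "finite {x. c *\<^sub>C f x \<noteq> 0}" by (rule rev_finite_subset)
qed
instance
  by standard
    (transfer, simp add: fun_eq_iff scaleC_add_right scaleC_add_left scaleC_scaleC scaleC_one)+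
end


section \<open>Tensor products of complex vector spaces\<close>

text \<open>The free complex vector space on pairs, modulo the span of the bilinearity relations.\<close>

definition tensor_relations :: "('a::complex_vector \<times> 'b::complex_vector \<Rightarrow>\<^sub>0 complex) set"
  where "tensor_relations =
      {Poly_Mapping.single (x + x', y) 1 - Poly_Mapping.single (x, y) 1 - Poly_Mapping.single (x', y) 1 | x x' y. True}
    \<union> {Poly_Mapping.single (x, y + y') 1 - Poly_Mapping.single (x, y) 1 - Poly_Mapping.single (x, y') 1 | x y y'. True}
    \<union> {Poly_Mapping.single (c *\<^sub>C x, y) 1 - c *\<^sub>C Poly_Mapping.single (x, y) 1 | c x y. True}
    \<union> {Poly_Mapping.single (x, c *\<^sub>C y) 1 - c *\<^sub>C Poly_Mapping.single (x, y) 1 | c x y. True}"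

definition tensor_rel ::
  "('a::complex_vector \<times> 'b::complex_vector \<Rightarrow>\<^sub>0 complex) \<Rightarrow> ('a \<times> 'b \<Rightarrow>\<^sub>0 complex) \<Rightarrow> bool"
  where "tensor_rel u v \<longleftrightarrow> u - v \<in> cspan tensor_relations"

quotient_type (overloaded) ('a, 'b) tensor =
  "'a::complex_vector \<times> 'b::complex_vector \<Rightarrow>\<^sub>0 complex" / tensor_rel
proof (rule equivpI)
  show "reflp (tensor_rel :: ('a \<times> 'b \<Rightarrow>\<^sub>0 complex) \<Rightarrow> _)"
    by (simp add: reflp_def tensor_rel_def complex_vector.span_zero)
  show "symp (tensor_rel :: ('a \<times> 'b \<Rightarrow>\<^sub>0 complex) \<Rightarrow> _)"
    by (auto simp: symp_def tensor_rel_def dest: complex_vector.span_neg)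
  show "transp (tensor_rel :: ('a \<times> 'b \<Rightarrow>\<^sub>0 complex) \<Rightarrow> _)"
    unfolding transp_def tensor_rel_def
  proof (intro allI impI)
    fix u v w :: "'a \<times> 'b \<Rightarrow>\<^sub>0 complex"
    assume "u - v \<in> cspan tensor_relations" "v - w \<in> cspan tensor_relations"
    then have "(u - v) + (v - w) \<in> cspan tensor_relations" by (rule complex_vector.span_add)
    then show "u - w \<in> cspan tensor_relations" by simp
  qed
qed

instantiation tensor :: (complex_vector, complex_vector) complex_vector
begin

lift_definition zero_tensor :: "('a, 'b) tensor" is 0 .

lift_definition plus_tensor :: "('a, 'b) tensor \<Rightarrow> ('a, 'b) tensor \<Rightarrow> ('a, 'b) tensor" is "(+)"
  unfolding tensor_rel_def
proof -
  fix u u' v v' :: "'a \<times> 'b \<Rightarrow>\<^sub>0 complex"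
  assume "u - u' \<in> cspan tensor_relations" "v - v' \<in> cspan tensor_relations"
  then have "(u - u') + (v - v') \<in> cspan tensor_relations" by (rule complex_vector.span_add)
  then show "u + v - (u' + v') \<in> cspan tensor_relations" by (simp add: algebra_simps)
qed

lift_definition minus_tensor :: "('a, 'b) tensor \<Rightarrow> ('a, 'b) tensor \<Rightarrow> ('a, 'b) tensor" is "(-)"
  unfolding tensor_rel_def
proof -
  fix u u' v v' :: "'a \<times> 'b \<Rightarrow>\<^sub>0 complex"
  assume "u - u' \<in> cspan tensor_relations" "v - v' \<in> cspan tensor_relations"
  then have "(u - u') - (v - v') \<in> cspan tensor_relations" by (rule complex_vector.span_diff)
  then show "u - v - (u' - v') \<in> cspan tensor_relations" by (simp add: algebra_simps)
qed

lift_definition uminus_tensor :: "('a, 'b) tensor \<Rightarrow> ('a, 'b) tensor" is "uminus"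
  unfolding tensor_rel_def
proof -
  fix u u' :: "'a \<times> 'b \<Rightarrow>\<^sub>0 complex"
  assume "u - u' \<in> cspan tensor_relations"
  then have "- (u - u') \<in> cspan tensor_relations" by (rule complex_vector.span_neg)
  then show "- u - - u' \<in> cspan tensor_relations" by (simp add: algebra_simps)
qed

lift_definition scaleC_tensor :: "complex \<Rightarrow> ('a, 'b) tensor \<Rightarrow> ('a, 'b) tensor" is "scaleC"
  unfolding tensor_rel_def
proof -
  fix c and u u' :: "'a \<times> 'b \<Rightarrow>\<^sub>0 complex"
  assume "u - u' \<in> cspan tensor_relations"
  then have "c *\<^sub>C (u - u') \<in> cspan tensor_relations" by (rule complex_vector.span_scale)
  then show "c *\<^sub>C u - c *\<^sub>C u' \<in> cspan tensor_relations"
    by (simp add: complex_vector.scale_right_diff_distrib)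
qed

instance
proof
  fix a b c :: "('a, 'b) tensor" and k l :: complex
  have refl: "u = v \<Longrightarrow> tensor_rel u v" for u v :: "'a \<times> 'b \<Rightarrow>\<^sub>0 complex"
    by (simp add: tensor_rel_def complex_vector.span_zero)
  show "a + b + c = a + (b + c)" by transfer (rule refl, simp add: algebra_simps)
  show "a + b = b + a" by transfer (rule refl, simp add: algebra_simps)
  show "0 + a = a" by transfer (rule refl, simp)
  show "- a + a = 0" by transfer (rule refl, simp)
  show "a - b = a + - b" by transfer (rule refl, simp)
  show "k *\<^sub>C (a + b) = k *\<^sub>C a + k *\<^sub>C b" by transfer (rule refl, simp add: scaleC_add_right)
  show "(k + l) *\<^sub>C a = k *\<^sub>C a + l *\<^sub>C a" by transfer (rule refl, simp add: scaleC_add_left)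
  show "k *\<^sub>C l *\<^sub>C a = (k * l) *\<^sub>C a" by transfer (rule refl, simp add: scaleC_scaleC)
  show "1 *\<^sub>C a = a" by transfer (rule refl, simp add: scaleC_one)
qed

end

lift_definition tens :: "'a::complex_vector \<Rightarrow> 'b::complex_vector \<Rightarrow> ('a, 'b) tensor"
    (infixr \<open>\<otimes>\<^sub>T\<close> 72)
  is "\<lambda>x y. Poly_Mapping.single (x, y) 1" .

text \<open>The subspace spanned by the elementary tensors with factors in two given subspaces.\<close>

definition tensor_span ::
  "'a::complex_vector set \<Rightarrow> 'b::complex_vector set \<Rightarrow> ('a, 'b) tensor set"  (infixr \<open>\<otimes>\<^sub>S\<close> 72)
  where "V \<otimes>\<^sub>S W = cspan {x \<otimes>\<^sub>T y | x y. x \<in> V \<and> y \<in> W}"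

text \<open>The linear map on \<^term>\<open>V \<otimes>\<^sub>S W\<close> induced by a map that is bilinear on \<^term>\<open>V\<close> and \<^term>\<open>W\<close>.
  Off \<^term>\<open>V \<otimes>\<^sub>S W\<close> its values are arbitrary (a linear extension is chosen); on \<^term>\<open>V \<otimes>\<^sub>S W\<close> they
  are determined, see \<open>tensor_lift_on\<close> and \<open>tensor_lift_on_unique\<close> below.\<close>

definition tensor_lift_on ::
  "'a::complex_vector set \<Rightarrow> 'b::complex_vector set \<Rightarrow> ('a \<Rightarrow> 'b \<Rightarrow> 'c::complex_vector)
    \<Rightarrow> ('a, 'b) tensor \<Rightarrow> 'c"
  where "tensor_lift_on V W f =
    (SOME h. clinear h \<and> (\<forall>x\<in>V. \<forall>y\<in>W. h (x \<otimes>\<^sub>T y) = f x y))"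

abbreviation tensor_lift ::
  "('a::complex_vector \<Rightarrow> 'b::complex_vector \<Rightarrow> 'c::complex_vector) \<Rightarrow> ('a, 'b) tensor \<Rightarrow> 'c"
  where "tensor_lift \<equiv> tensor_lift_on UNIV UNIV"

lemma
  shows tens_add_left: "(x + x') \<otimes>\<^sub>T y = x \<otimes>\<^sub>T y + x' \<otimes>\<^sub>T y"
    and tens_add_right: "x \<otimes>\<^sub>T (y + y') = x \<otimes>\<^sub>T y + x \<otimes>\<^sub>T y'"
    and tens_scale_left: "(c *\<^sub>C x) \<otimes>\<^sub>T y = c *\<^sub>C (x \<otimes>\<^sub>T y)"
    and tens_scale_right: "x \<otimes>\<^sub>T (c *\<^sub>C y) = c *\<^sub>C (x \<otimes>\<^sub>T y)"
proof -
  have rel: "u - v \<in> tensor_relations \<Longrightarrow> tensor_rel u v"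
    for u v :: "'a \<times> 'b \<Rightarrow>\<^sub>0 complex"
    by (simp add: tensor_rel_def complex_vector.span_base)
  have "Poly_Mapping.single (x + x', y) 1 - Poly_Mapping.single (x, y) 1 - Poly_Mapping.single (x', y) 1
      \<in> tensor_relations"
    unfolding tensor_relations_def by (rule UnI1, rule UnI1, rule UnI1) blast
  then show "(x + x') \<otimes>\<^sub>T y = x \<otimes>\<^sub>T y + x' \<otimes>\<^sub>T y"
    by (transfer fixing: x x' y) (rule rel, simp only: diff_diff_eq)
  have "Poly_Mapping.single (x, y + y') 1 - Poly_Mapping.single (x, y) 1 - Poly_Mapping.single (x, y') 1
      \<in> tensor_relations"
    unfolding tensor_relations_def by (rule UnI1, rule UnI1, rule UnI2) blast
  then show "x \<otimes>\<^sub>T (y + y') = x \<otimes>\<^sub>T y + x \<otimes>\<^sub>T y'"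
    by (transfer fixing: x y y') (rule rel, simp only: diff_diff_eq)
  have "Poly_Mapping.single (c *\<^sub>C x, y) 1 - c *\<^sub>C Poly_Mapping.single (x, y) 1 \<in> tensor_relations"
    unfolding tensor_relations_def by (rule UnI1, rule UnI2) blast
  then show "(c *\<^sub>C x) \<otimes>\<^sub>T y = c *\<^sub>C (x \<otimes>\<^sub>T y)"
    by (transfer fixing: c x y) (rule rel)
  have "Poly_Mapping.single (x, c *\<^sub>C y) 1 - c *\<^sub>C Poly_Mapping.single (x, y) 1 \<in> tensor_relations"
    unfolding tensor_relations_def by (rule UnI2) blast
  then show "x \<otimes>\<^sub>T (c *\<^sub>C y) = c *\<^sub>C (x \<otimes>\<^sub>T y)"
    by (transfer fixing: c x y) (rule rel)
qed

lemma bilinear_on_tens: "bilinear_on UNIV UNIV (\<otimes>\<^sub>T)"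
  by (simp add: bilinear_on_def linear_on_def tens_add_left tens_add_right
      tens_scale_left tens_scale_right)

lemma abs_tensor_linear: "clinear abs_tensor"
  by (simp add: clinear_iff plus_tensor.abs_eq scaleC_tensor.abs_eq)

lemma poly_mapping_decomp:
  fixes u :: "'a \<Rightarrow>\<^sub>0 complex"
  shows "u = (\<Sum>k\<in>Poly_Mapping.keys u. Poly_Mapping.lookup u k *\<^sub>C Poly_Mapping.single k 1)"
proof (rule poly_mapping_eqI)
  fix i :: 'a
  have *: "Poly_Mapping.lookup (c *\<^sub>C Poly_Mapping.single k 1) i = (if k = i then c else 0)"
    for c :: complex and k :: 'a
    by transfer (simp add: scaleC_complex_def when_def)
  show "Poly_Mapping.lookup u i = Poly_Mapping.lookup
     (\<Sum>k\<in>Poly_Mapping.keys u. Poly_Mapping.lookup u k *\<^sub>C Poly_Mapping.single k 1) i"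
    by (auto simp: lookup_sum * in_keys_iff)
qed

lemma tensor_span_UNIV: "UNIV \<otimes>\<^sub>S UNIV = UNIV"
proof -
  have "abs_tensor u \<in> UNIV \<otimes>\<^sub>S UNIV" for u :: "'a \<times> 'b \<Rightarrow>\<^sub>0 complex"
  proof -
    have "abs_tensor u = (\<Sum>k\<in>Poly_Mapping.keys u. Poly_Mapping.lookup u k *\<^sub>C (fst k \<otimes>\<^sub>T snd k))"
      by (subst poly_mapping_decomp)
        (simp add: clinear_sum[OF abs_tensor_linear] tens.abs_eq scaleC_tensor.abs_eq)
    also have "\<dots> \<in> UNIV \<otimes>\<^sub>S UNIV"
      unfolding tensor_span_def
      by (intro complex_vector.span_sum complex_vector.span_scale complex_vector.span_base) blast
    finally show ?thesis .
  qed
  then have "t \<in> UNIV \<otimes>\<^sub>S UNIV" for t :: "('a, 'b) tensor"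
    by (rule tensor.abs_induct)
  then show ?thesis by blast
qed

lemma tensor_induct [case_names tens add, induct type: tensor]:
  assumes "\<And>x y. P (x \<otimes>\<^sub>T y)" and "\<And>s t. P s \<Longrightarrow> P t \<Longrightarrow> P (s + t)"
  shows "P t"
proof -
  have "t \<in> cspan {x \<otimes>\<^sub>T y | x y. x \<in> UNIV \<and> y \<in> UNIV}"
    using tensor_span_UNIV unfolding tensor_span_def by blast
  then show ?thesis
  proof (induct rule: complex_vector.span_induct_alt)
    case base
    have "(0::'a) \<otimes>\<^sub>T (0::'b) = 0"
      using tens_scale_left[of 0 "0::'a" "0::'b"] by simp
    then show ?case using assms(1)[of 0 0] by simp
  next
    case (step c x y)
    then show ?case using assms by (auto simp: tens_scale_left[symmetric])
  qed
qed

lemma clinear_tensor_eqI: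
  assumes "clinear f" "clinear g" "\<And>x y. f (x \<otimes>\<^sub>T y) = g (x \<otimes>\<^sub>T y)"
  shows "f = g"
proof
  fix t show "f t = g t"
    by (induct t) (use assms in \<open>auto simp: clinear_iff\<close>)
qed

lemma tensor_lift_exists:
  fixes f :: "'a::complex_vector \<Rightarrow> 'b::complex_vector \<Rightarrow> 'c::complex_vector"
  assumes "bilinear_on UNIV UNIV f"
  shows "\<exists>h. clinear h \<and> (\<forall>x y. h (x \<otimes>\<^sub>T y) = f x y)"
proof -
  define F where "F u = (\<Sum>k\<in>Poly_Mapping.keys u. Poly_Mapping.lookup u k *\<^sub>C f (fst k) (snd k))"
    for u :: "'a \<times> 'b \<Rightarrow>\<^sub>0 complex"
  have F_eq: "F u = (\<Sum>k\<in>K. Poly_Mapping.lookup u k *\<^sub>C f (fst k) (snd k))"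
    if "finite K" "Poly_Mapping.keys u \<subseteq> K" for u K
    unfolding F_def by (rule sum.mono_neutral_left) (use that in \<open>auto simp: in_keys_iff\<close>)
  have F_add: "F (u + v) = F u + F v" for u v
  proof -
    let ?K = "Poly_Mapping.keys u \<union> Poly_Mapping.keys v"
    have "Poly_Mapping.keys (u + v) \<subseteq> ?K" by (rule Poly_Mapping.keys_add)
    then show ?thesis
      by (simp add: F_eq[of ?K] lookup_add scaleC_add_left sum.distrib)
  qed
  have F_scale: "F (c *\<^sub>C u) = c *\<^sub>C F u" for c u
  proof -
    have l: "Poly_Mapping.lookup (c *\<^sub>C u) k = c * Poly_Mapping.lookup u k" for k
      by transfer (simp add: scaleC_complex_def)
    have "Poly_Mapping.keys (c *\<^sub>C u) \<subseteq> Poly_Mapping.keys u" by (auto simp: in_keys_iff l)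
    then show ?thesis
      by (simp add: F_eq[of "Poly_Mapping.keys u"] l complex_vector.scale_sum_right)
  qed
  have F: "clinear F" by (simp add: clinear_iff F_add F_scale)
  have F_single: "F (Poly_Mapping.single (x, y) 1) = f x y" for x y
    by (simp add: F_def scaleC_one)
  have "F r = 0" if "r \<in> tensor_relations" for r
    using that assms unfolding tensor_relations_def bilinear_on_def linear_on_def
    by (auto simp: complex_vector.linear_diff[OF F] F_scale F_single)
  then have F0: "F u = 0" if "u \<in> cspan tensor_relations" for u
    using complex_vector.linear_eq_0_on_span[OF F] that by blast
  have F_resp: "F u = F v" if "tensor_rel u v" for u v
    using F0[of "u - v"] that by (simp add: tensor_rel_def complex_vector.linear_diff[OF F])
  have abs: "F (rep_tensor (abs_tensor u)) = F u" for u
    by (rule F_resp, rule rep_abs_rsp_left[OF Quotient3_tensor])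
      (simp add: tensor_rel_def complex_vector.span_zero)
  define h where "h t = F (rep_tensor t)" for t
  have "h (s + t) = h s + h t" for s t
    by (induct s rule: tensor.abs_induct, induct t rule: tensor.abs_induct)
      (simp add: h_def plus_tensor.abs_eq abs F_add)
  moreover have "h (c *\<^sub>C t) = c *\<^sub>C h t" for c t
    by (induct t rule: tensor.abs_induct) (simp add: h_def scaleC_tensor.abs_eq abs F_scale)
  moreover have "h (x \<otimes>\<^sub>T y) = f x y" for x y
    by (simp add: h_def tens.abs_eq abs F_single)
  ultimately show ?thesis by (auto simp: clinear_iff)
qed

lemma csubspace_projection:
  assumes "csubspace V"
  obtains p where "clinear p" "\<And>x. p x \<in> V" "\<And>x. x \<in> V \<Longrightarrow> p x = x"
proof -
  have "\<exists>p. p ` UNIV \<subseteq> V \<and> clinear p \<and> (\<forall>v\<in>V. p (id v) = v)"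
    by (rule complex_vector.linear_exists_left_inverse_on[OF complex_vector.linear_id assms]) simp
  then obtain p where p: "range p \<subseteq> V" "clinear p" "\<forall>v\<in>V. p v = v" by auto
  show ?thesis by (rule that[OF p(2)]) (use p in auto)
qed

lemma tensor_lift_on_exists:
  assumes "csubspace V" "csubspace W" "bilinear_on V W f"
  shows "\<exists>h. clinear h \<and> (\<forall>x\<in>V. \<forall>y\<in>W. h (x \<otimes>\<^sub>T y) = f x y)"
proof -
  obtain p where p: "clinear p" "\<And>x. p x \<in> V" "\<And>x. x \<in> V \<Longrightarrow> p x = x"
    by (rule csubspace_projection[OF assms(1)]) blast
  obtain q where q: "clinear q" "\<And>x. q x \<in> W" "\<And>x. x \<in> W \<Longrightarrow> q x = x"
    by (rule csubspace_projection[OF assms(2)]) blast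
  have "bilinear_on UNIV UNIV (\<lambda>x y. f (p x) (q y))"
    using assms(3) p(1,2) q(1,2) by (simp add: bilinear_on_def linear_on_def clinear_iff)
  from tensor_lift_exists[OF this] show ?thesis using p(3) q(3) by force
qed

lemma
  assumes "csubspace V" "csubspace W" "bilinear_on V W f"
  shows clinear_tensor_lift_on: "clinear (tensor_lift_on V W f)"
    and tensor_lift_on: "x \<in> V \<Longrightarrow> y \<in> W \<Longrightarrow> tensor_lift_on V W f (x \<otimes>\<^sub>T y) = f x y"
  using someI_ex[OF tensor_lift_on_exists[OF assms]] by (auto simp: tensor_lift_on_def)

lemma tensor_lift_on_unique:
  assumes "csubspace V" "csubspace W" "bilinear_on V W f"
    and "clinear h" "\<And>x y. x \<in> V \<Longrightarrow> y \<in> W \<Longrightarrow> h (x \<otimes>\<^sub>T y) = f x y" "t \<in> V \<otimes>\<^sub>S W"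
  shows "h t = tensor_lift_on V W f t"
  using complex_vector.linear_eq_on[OF assms(4) clinear_tensor_lift_on[OF assms(1-3)]
      assms(6)[unfolded tensor_span_def]] assms(5) tensor_lift_on[OF assms(1-3)]
  by fastforce

lemma
  assumes "bilinear_on UNIV UNIV f"
  shows clinear_tensor_lift: "clinear (tensor_lift f)"
    and tensor_lift: "tensor_lift f (x \<otimes>\<^sub>T y) = f x y"
  using clinear_tensor_lift_on[OF _ _ assms] tensor_lift_on[OF _ _ assms] by simp_all

definition tensor_flip :: "('a::complex_vector, 'b::complex_vector) tensor \<Rightarrow> ('b, 'a) tensor"
  where "tensor_flip = tensor_lift (\<lambda>x y. y \<otimes>\<^sub>T x)"

definition tensor_assoc ::
  "(('a::complex_vector, 'b::complex_vector) tensor, 'c::complex_vector) tensor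
    \<Rightarrow> ('a, ('b, 'c) tensor) tensor"
  where "tensor_assoc = tensor_lift (\<lambda>t z. tensor_lift (\<lambda>x y. x \<otimes>\<^sub>T y \<otimes>\<^sub>T z) t)"

lemma bilinear_onI:
  assumes "\<And>x x' y. f (x + x') y = f x y + f x' y" "\<And>c x y. f (c *\<^sub>C x) y = c *\<^sub>C f x y"
    and "\<And>x y y'. f x (y + y') = f x y + f x y'" "\<And>c x y. f x (c *\<^sub>C y) = c *\<^sub>C f x y"
  shows "bilinear_on UNIV UNIV f"
  using assms by (simp add: bilinear_on_def linear_on_def)

lemma tensor_lift_add:
  assumes "bilinear_on UNIV UNIV f" "bilinear_on UNIV UNIV g"
  shows "tensor_lift (\<lambda>x y. f x y + g x y) t = tensor_lift f t + tensor_lift g t"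
proof -
  have b: "bilinear_on UNIV UNIV (\<lambda>x y. f x y + g x y)"
    using assms by (auto simp: bilinear_on_def linear_on_def scaleC_add_right algebra_simps)
  have "tensor_lift (\<lambda>x y. f x y + g x y) = (\<lambda>t. tensor_lift f t + tensor_lift g t)"
    using clinear_tensor_lift[OF assms(1)] clinear_tensor_lift[OF assms(2)]
    by (intro clinear_tensor_eqI clinear_tensor_lift[OF b])
      (auto simp: tensor_lift[OF assms(1)] tensor_lift[OF assms(2)] tensor_lift[OF b]
        clinear_iff scaleC_add_right algebra_simps)
  then show ?thesis by simp
qed

lemma tensor_lift_scale:
  assumes "bilinear_on UNIV UNIV f"
  shows "tensor_lift (\<lambda>x y. c *\<^sub>C f x y) t = c *\<^sub>C tensor_lift f t"
proof -
  have b: "bilinear_on UNIV UNIV (\<lambda>x y. c *\<^sub>C f x y)"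
    using assms by (auto simp: bilinear_on_def linear_on_def scaleC_add_right scaleC_scaleC mult.commute)
  have "tensor_lift (\<lambda>x y. c *\<^sub>C f x y) = (\<lambda>t. c *\<^sub>C tensor_lift f t)"
    using clinear_tensor_lift[OF assms]
    by (intro clinear_tensor_eqI clinear_tensor_lift[OF b])
      (auto simp: tensor_lift[OF assms] tensor_lift[OF b]
        clinear_iff scaleC_add_right scaleC_scaleC mult.commute)
  then show ?thesis by simp
qed

lemma bilinear_on_tensor_lift:
  assumes "\<And>x y. bilinear_on UNIV UNIV (f x y)" "\<And>z w. bilinear_on UNIV UNIV (\<lambda>x y. f x y z w)"
  shows "bilinear_on UNIV UNIV (\<lambda>s t. tensor_lift (\<lambda>x y. tensor_lift (f x y) t) s)"
    and "bilinear_on UNIV UNIV (\<lambda>x y. tensor_lift (f x y) t)"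
proof -
  have f: "f (x + x') y = (\<lambda>z w. f x y z w + f x' y z w)"
    "f (c *\<^sub>C x) y = (\<lambda>z w. c *\<^sub>C f x y z w)"
    "f x (y + y') = (\<lambda>z w. f x y z w + f x y' z w)"
    "f x (c *\<^sub>C y) = (\<lambda>z w. c *\<^sub>C f x y z w)" for x x' y y' c
    using assms(2) by (auto simp: fun_eq_iff bilinear_on_def linear_on_def)
  show b: "bilinear_on UNIV UNIV (\<lambda>x y. tensor_lift (f x y) t)" for t
    by (rule bilinear_onI) (simp_all add: f tensor_lift_add tensor_lift_scale assms(1))
  note lin = clinear_tensor_lift[OF assms(1), unfolded clinear_iff]
  show "bilinear_on UNIV UNIV (\<lambda>s t. tensor_lift (\<lambda>x y. tensor_lift (f x y) t) s)"
    by (rule bilinear_onI)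
      (simp_all add: lin clinear_tensor_lift[OF b, unfolded clinear_iff] tensor_lift_add tensor_lift_scale b)
qed

lemma bilinear_on_flip: "bilinear_on UNIV UNIV (\<lambda>x y. y \<otimes>\<^sub>T x)"
  by (rule bilinear_onI) (simp_all add: tens_add_left tens_add_right tens_scale_left tens_scale_right)

lemma clinear_tensor_flip: "clinear tensor_flip"
  and tensor_flip_tens: "tensor_flip (x \<otimes>\<^sub>T y) = y \<otimes>\<^sub>T x"
  by (simp_all add: tensor_flip_def clinear_tensor_lift tensor_lift bilinear_on_flip)

lemma bilinear_on_assoc:
  "bilinear_on UNIV UNIV (\<lambda>x y. x \<otimes>\<^sub>T y \<otimes>\<^sub>T z)"
  "bilinear_on UNIV UNIV (\<lambda>t z. tensor_lift (\<lambda>x y. x \<otimes>\<^sub>T y \<otimes>\<^sub>T z) t)"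
proof -
  show b: "bilinear_on UNIV UNIV (\<lambda>x y. x \<otimes>\<^sub>T y \<otimes>\<^sub>T z)" for z
    by (rule bilinear_onI) (simp_all add: tens_add_left tens_add_right tens_scale_left tens_scale_right)
  show "bilinear_on UNIV UNIV (\<lambda>t z. tensor_lift (\<lambda>x y. x \<otimes>\<^sub>T y \<otimes>\<^sub>T z) t)"
    by (rule bilinear_onI)
      (simp_all add: tens_add_right tens_scale_right tensor_lift_add tensor_lift_scale b
        clinear_tensor_lift[OF b, unfolded clinear_iff])
qed

lemma clinear_tensor_assoc: "clinear tensor_assoc"
  and tensor_assoc_tens: "tensor_assoc ((x \<otimes>\<^sub>T y) \<otimes>\<^sub>T z) = x \<otimes>\<^sub>T (y \<otimes>\<^sub>T z)"
  by (simp_all add: tensor_assoc_def clinear_tensor_lift tensor_lift bilinear_on_assoc)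

instantiation tensor :: (complex_algebra, complex_algebra) complex_algebra
begin

definition times_tensor :: "('a, 'b) tensor \<Rightarrow> ('a, 'b) tensor \<Rightarrow> ('a, 'b) tensor"
  where "s * t = tensor_lift (\<lambda>x y. tensor_lift (\<lambda>z w. (x * z) \<otimes>\<^sub>T (y * w)) t) s"

lemma bilinear_times_tensor:
  "bilinear_on UNIV UNIV (\<lambda>z w. ((x::'a) * z) \<otimes>\<^sub>T ((y::'b) * w))"
  "bilinear_on UNIV UNIV (\<lambda>x y. ((x::'a) * z) \<otimes>\<^sub>T ((y::'b) * w))"
  by (rule bilinear_onI; simp add: algebra_simps scaleC_mult_left scaleC_mult_right
      tens_add_left tens_add_right tens_scale_left tens_scale_right)+

lemma times_tensor_tens: "((x::'a) \<otimes>\<^sub>T (y::'b)) * (z \<otimes>\<^sub>T w) = (x * z) \<otimes>\<^sub>T (y * w)"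
  unfolding times_tensor_def
  by (simp add: tensor_lift[OF bilinear_on_tensor_lift(2)] tensor_lift bilinear_times_tensor)

lemma bilinear_times: "bilinear_on UNIV UNIV ((*) :: ('a, 'b) tensor \<Rightarrow> _)"
  unfolding times_tensor_def by (rule bilinear_on_tensor_lift(1)[OF bilinear_times_tensor])

instance
proof
  fix a b c :: "('a, 'b) tensor" and k :: complex
  show *: "(a + b) * c = a * c + b * c" "a * (b + c) = a * b + a * c"
    "(k *\<^sub>C a) * b = k *\<^sub>C (a * b)" "a * (k *\<^sub>C b) = k *\<^sub>C (a * b)" for a b c :: "('a, 'b) tensor" and k
    using bilinear_times by (auto simp: bilinear_on_def linear_on_def)
  show "a * b * c = a * (b * c)"
  proof (induct a)
    case (tens x y)
    show ?case
    proof (induct b)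
      case (tens z w)
      show ?case by (induct c) (simp_all add: times_tensor_tens * mult.assoc)
    qed (simp add: *)
  qed (simp add: *)
qed

end


section \<open>Multiplier algebras\<close>

definition nondegenerate :: "'a::complex_algebra itself \<Rightarrow> bool"
  where "nondegenerate _ \<longleftrightarrow>
    (\<forall>a::'a. (\<forall>b. a * b = 0) \<longrightarrow> a = 0) \<and> (\<forall>b::'a. (\<forall>a. a * b = 0) \<longrightarrow> b = 0)"

text \<open>A multiplier \<open>m\<close> is the pair of maps \<open>x \<mapsto> m x\<close> and \<open>x \<mapsto> x m\<close> (a double centralizer).\<close>

typedef (overloaded) 'a multiplier =
  "{(L, R). clinear L \<and> clinear R \<and>
      (\<forall>(x::'a::complex_algebra) y. L (x * y) = L x * y) \<and> (\<forall>x y. R (x * y) = x * R y) \<and> (\<forall>x y. x * L y = R x * y)}"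
  by (rule exI[of _ "(\<lambda>x. x, \<lambda>x. x)"]) (simp add: clinear_iff)

setup_lifting type_definition_multiplier

lift_definition lact :: "'a::complex_algebra multiplier \<Rightarrow> 'a \<Rightarrow> 'a" is fst .

lift_definition ract :: "'a::complex_algebra \<Rightarrow> 'a multiplier \<Rightarrow> 'a" is "\<lambda>x m. snd m x" .

lemma multiplier_eqI: "(\<And>x. lact m x = lact n x) \<Longrightarrow> (\<And>x. ract x m = ract x n) \<Longrightarrow> m = n"
  by transfer (auto simp: fun_eq_iff)

lemma
  shows lact_linear: "clinear (lact m)"
    and ract_linear: "clinear (\<lambda>x. ract x m)"
    and lact_mult: "lact m (x * y) = lact m x * y"
    and ract_mult: "ract (x * y) m = x * ract y m"
    and mult_lact: "x * lact m y = ract x m * y"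
  by (transfer, auto)+

lift_definition mult_of :: "'a::complex_algebra \<Rightarrow> 'a multiplier"
  is "\<lambda>a. (\<lambda>x. a * x, \<lambda>x. x * a)"
  by (simp add: clinear_iff algebra_simps scaleC_mult_left scaleC_mult_right)

lemma lact_mult_of [simp]: "lact (mult_of a) x = a * x"
  and ract_mult_of [simp]: "ract x (mult_of a) = x * a"
  by (transfer, simp)+

text \<open>The element of the algebra represented by a multiplier in the range of \<^const>\<open>mult_of\<close>;
  \<^const>\<open>mult_of\<close> is injective when the product is non-degenerate.\<close>

definition alg_of :: "'a::complex_algebra multiplier \<Rightarrow> 'a"
  where "alg_of = the_inv mult_of"

instantiation multiplier :: (complex_algebra) complex_algebra
begin

lift_definition zero_multiplier :: "'a multiplier" is "(\<lambda>x. 0, \<lambda>x. 0)"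
  by (simp add: clinear_iff)

lift_definition plus_multiplier :: "'a multiplier \<Rightarrow> 'a multiplier \<Rightarrow> 'a multiplier"
  is "\<lambda>m n. (\<lambda>x. fst m x + fst n x, \<lambda>x. snd m x + snd n x)"
  by (auto simp: clinear_iff algebra_simps scaleC_add_right)

lift_definition uminus_multiplier :: "'a multiplier \<Rightarrow> 'a multiplier"
  is "\<lambda>m. (\<lambda>x. - fst m x, \<lambda>x. - snd m x)"
  by (auto simp: clinear_iff)

lift_definition minus_multiplier :: "'a multiplier \<Rightarrow> 'a multiplier \<Rightarrow> 'a multiplier"
  is "\<lambda>m n. (\<lambda>x. fst m x - fst n x, \<lambda>x. snd m x - snd n x)"
  by (auto simp: clinear_iff algebra_simps complex_vector.scale_right_diff_distrib)

lift_definition scaleC_multiplier :: "complex \<Rightarrow> 'a multiplier \<Rightarrow> 'a multiplier"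
  is "\<lambda>c m. (\<lambda>x. c *\<^sub>C fst m x, \<lambda>x. c *\<^sub>C snd m x)"
  by (auto simp: clinear_iff scaleC_add_right scaleC_scaleC mult.commute scaleC_mult_left scaleC_mult_right)

lift_definition times_multiplier :: "'a multiplier \<Rightarrow> 'a multiplier \<Rightarrow> 'a multiplier"
  is "\<lambda>m n. (\<lambda>x. fst m (fst n x), \<lambda>x. snd n (snd m x))"
  by (auto simp: clinear_iff)

lemma
  shows lact_zero [simp]: "lact 0 x = 0"
    and ract_zero [simp]: "ract x 0 = 0"
    and lact_plus [simp]: "lact (m + n) x = lact m x + lact n x"
    and ract_plus [simp]: "ract x (m + n) = ract x m + ract x n"
    and lact_uminus [simp]: "lact (- m) x = - lact m x"
    and ract_uminus [simp]: "ract x (- m) = - ract x m"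
    and lact_minus [simp]: "lact (m - n) x = lact m x - lact n x"
    and ract_minus [simp]: "ract x (m - n) = ract x m - ract x n"
    and lact_scale [simp]: "lact (c *\<^sub>C m) x = c *\<^sub>C lact m x"
    and ract_scale [simp]: "ract x (c *\<^sub>C m) = c *\<^sub>C ract x m"
    and lact_times [simp]: "lact (m * n) x = lact m (lact n x)"
    and ract_times [simp]: "ract x (m * n) = ract (ract x m) n"
  by (transfer, simp)+

instance
proof
  fix a b c :: "'a multiplier" and k l :: complex
  note lin = lact_linear[unfolded clinear_iff] ract_linear[unfolded clinear_iff]
  show "a + b + c = a + (b + c)" by (rule multiplier_eqI) (simp_all add: add.assoc)
  show "a + b = b + a" by (rule multiplier_eqI) (simp_all add: add.commute)
  show "0 + a = a" by (rule multiplier_eqI) simp_all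
  show "- a + a = 0" by (rule multiplier_eqI) simp_all
  show "a - b = a + - b" by (rule multiplier_eqI) simp_all
  show "k *\<^sub>C (a + b) = k *\<^sub>C a + k *\<^sub>C b" by (rule multiplier_eqI) (simp_all add: scaleC_add_right)
  show "(k + l) *\<^sub>C a = k *\<^sub>C a + l *\<^sub>C a" by (rule multiplier_eqI) (simp_all add: scaleC_add_left)
  show "k *\<^sub>C l *\<^sub>C a = (k * l) *\<^sub>C a" by (rule multiplier_eqI) (simp_all add: scaleC_scaleC)
  show "1 *\<^sub>C a = a" by (rule multiplier_eqI) (simp_all add: scaleC_one)
  show "a * b * c = a * (b * c)" by (rule multiplier_eqI) simp_all
  show "(a + b) * c = a * c + b * c" by (rule multiplier_eqI) (simp_all add: lin)
  show "a * (b + c) = a * b + a * c" by (rule multiplier_eqI) (simp_all add: lin)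
  show "(k *\<^sub>C a) * b = k *\<^sub>C (a * b)" by (rule multiplier_eqI) (simp_all add: lin)
  show "a * (k *\<^sub>C b) = k *\<^sub>C (a * b)" by (rule multiplier_eqI) (simp_all add: lin)
qed

end

instantiation multiplier :: (complex_algebra) monoid_mult
begin
lift_definition one_multiplier :: "'a multiplier" is "(\<lambda>x. x, \<lambda>x. x)"
  by (simp add: clinear_iff)
instance by standard (transfer, auto)+
end

lemma
  shows lact_one [simp]: "lact 1 x = x"
    and ract_one [simp]: "ract x 1 = x"
  by (transfer, simp)+

lemma bilinear_on_tens_linear:
  assumes "clinear f" "clinear g"
  shows "bilinear_on UNIV UNIV (\<lambda>x y. f x \<otimes>\<^sub>T g y)"
  using assms
  by (intro bilinear_onI)
    (simp_all add: clinear_iff tens_add_left tens_add_right tens_scale_left tens_scale_right)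

lemma tensor_mult_eqI:
  fixes F G :: "('a::complex_algebra, 'b::complex_algebra) tensor \<Rightarrow> ('a, 'b) tensor \<Rightarrow> 'c::complex_vector"
  assumes "\<And>s. clinear (F s)" "\<And>t. clinear (\<lambda>s. F s t)" "\<And>s. clinear (G s)" "\<And>t. clinear (\<lambda>s. G s t)"
    and "\<And>x y z w. F (x \<otimes>\<^sub>T y) (z \<otimes>\<^sub>T w) = G (x \<otimes>\<^sub>T y) (z \<otimes>\<^sub>T w)"
  shows "F s t = G s t"
proof (induct s)
  case (tens x y)
  show ?case by (induct t) (use assms in \<open>auto simp: clinear_iff\<close>)
qed (use assms in \<open>auto simp: clinear_iff\<close>)

text \<open>The embedding of \<open>M(A) \<otimes> M(B)\<close> into \<open>M(A \<otimes> B)\<close>, on elementary tensors.\<close>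

lift_definition multiplier_tens ::
  "'a::complex_algebra multiplier \<Rightarrow> 'b::complex_algebra multiplier \<Rightarrow> ('a, 'b) tensor multiplier"
    (infixr \<open>\<otimes>\<^sub>M\<close> 72)
  is "\<lambda>m n. (tensor_lift (\<lambda>x y. fst m x \<otimes>\<^sub>T fst n y), tensor_lift (\<lambda>x y. snd m x \<otimes>\<^sub>T snd n y))"
proof (clarsimp, goal_cases)
  case (1 L R L' R')
  have L: "bilinear_on UNIV UNIV (\<lambda>x y. L x \<otimes>\<^sub>T L' y)" and R: "bilinear_on UNIV UNIV (\<lambda>x y. R x \<otimes>\<^sub>T R' y)"
    using 1 by (auto intro: bilinear_on_tens_linear)
  note lin = clinear_tensor_lift[OF L, unfolded clinear_iff] clinear_tensor_lift[OF R, unfolded clinear_iff]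
  have 2: "tensor_lift (\<lambda>x y. L x \<otimes>\<^sub>T L' y) (s * t) = tensor_lift (\<lambda>x y. L x \<otimes>\<^sub>T L' y) s * t" for s t
    by (rule tensor_mult_eqI[where F = "\<lambda>s t. tensor_lift (\<lambda>x y. L x \<otimes>\<^sub>T L' y) (s * t)"])
      (use 1 lin in \<open>simp_all add: clinear_iff distrib_left distrib_right scaleC_mult_left scaleC_mult_right
         times_tensor_tens tensor_lift[OF L]\<close>)
  have 3: "tensor_lift (\<lambda>x y. R x \<otimes>\<^sub>T R' y) (s * t) = s * tensor_lift (\<lambda>x y. R x \<otimes>\<^sub>T R' y) t" for s t
    by (rule tensor_mult_eqI[where F = "\<lambda>s t. tensor_lift (\<lambda>x y. R x \<otimes>\<^sub>T R' y) (s * t)"])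
      (use 1 lin in \<open>simp_all add: clinear_iff distrib_left distrib_right scaleC_mult_left scaleC_mult_right
         times_tensor_tens tensor_lift[OF R]\<close>)
  have 4: "s * tensor_lift (\<lambda>x y. L x \<otimes>\<^sub>T L' y) t = tensor_lift (\<lambda>x y. R x \<otimes>\<^sub>T R' y) s * t" for s t
    by (rule tensor_mult_eqI[where F = "\<lambda>s t. s * tensor_lift (\<lambda>x y. L x \<otimes>\<^sub>T L' y) t"])
      (use 1 lin in \<open>simp_all add: clinear_iff distrib_left distrib_right scaleC_mult_left scaleC_mult_right
         times_tensor_tens tensor_lift[OF L] tensor_lift[OF R]\<close>)
  show ?case using clinear_tensor_lift[OF L] clinear_tensor_lift[OF R] 2 3 4 by simp
qed

lemma
  shows lact_multiplier_tens: "lact (m \<otimes>\<^sub>M n) (x \<otimes>\<^sub>T y) = lact m x \<otimes>\<^sub>T lact n y"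
    and ract_multiplier_tens: "ract (x \<otimes>\<^sub>T y) (m \<otimes>\<^sub>M n) = ract x m \<otimes>\<^sub>T ract y n"
  using lact_linear[of m] lact_linear[of n] ract_linear[of m] ract_linear[of n]
  unfolding lact.rep_eq ract.rep_eq multiplier_tens.rep_eq
  by (simp_all add: tensor_lift[OF bilinear_on_tens_linear])

text \<open>Used only for algebra isomorphisms \<open>f\<close>, which extend to the multiplier algebras.\<close>

definition transport_multiplier ::
  "('a::complex_algebra \<Rightarrow> 'b::complex_algebra) \<Rightarrow> 'a multiplier \<Rightarrow> 'b multiplier"
  where "transport_multiplier f m =
    Abs_multiplier (\<lambda>x. f (lact m (inv_into UNIV f x)), \<lambda>x. f (ract (inv_into UNIV f x) m))"

lemma transport_multiplier:
  assumes "clinear f" "bij f" "\<And>x y. f (x * y) = f x * f y"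
  shows "lact (transport_multiplier f m) (f x) = f (lact m x)"
    and "ract (f x) (transport_multiplier f m) = f (ract x m)"
proof -
  define g where "g = inv_into UNIV f"
  have s: "f (g x) = x" for x using assms(2) by (simp add: g_def bij_is_surj surj_f_inv_f)
  have i: "g (f x) = x" for x using assms(2) by (simp add: g_def bij_is_inj)
  have fl: "f (x + y) = f x + f y" "f (c *\<^sub>C x) = c *\<^sub>C f x" for x y c
    using assms(1) by (auto simp: clinear_iff)
  have gl: "g (x + y) = g x + g y" "g (c *\<^sub>C x) = c *\<^sub>C g x" "g (x * y) = g x * g y" for x y c
    using i[of "g x + g y"] i[of "c *\<^sub>C g x"] i[of "g x * g y"] by (simp_all add: fl s assms(3))
  have "x * f (lact m (g y)) = f (ract (g x) m) * y" for x y
    using mult_lact[of "g x" m "g y", THEN arg_cong[of _ _ f]] by (simp add: assms(3) s)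
  then have "(\<lambda>x. f (lact m (g x)), \<lambda>x. f (ract (g x) m)) \<in>
    {(L, R). clinear L \<and> clinear R \<and>
      (\<forall>x y. L (x * y) = L x * y) \<and> (\<forall>x y. R (x * y) = x * R y) \<and> (\<forall>x y. x * L y = R x * y)}"
    by (simp add: clinear_iff fl gl lact_linear[unfolded clinear_iff] ract_linear[unfolded clinear_iff]
        lact_mult ract_mult assms(3) s)
  then show "lact (transport_multiplier f m) (f x) = f (lact m x)"
    and "ract (f x) (transport_multiplier f m) = f (ract x m)"
    unfolding transport_multiplier_def g_def[symmetric]
    by (simp_all add: lact.rep_eq ract.rep_eq Abs_multiplier_inverse i)
qed

lemma tensor_flip:
  shows "bij (tensor_flip :: ('a::complex_algebra, 'b::complex_algebra) tensor \<Rightarrow> _)"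
    and "tensor_flip ((s :: ('a, 'b) tensor) * t) = tensor_flip s * tensor_flip t"
proof -
  note lin = clinear_tensor_flip[unfolded clinear_iff]
  have inv: "tensor_flip (tensor_flip s) = s" for s :: "('c::complex_vector, 'd::complex_vector) tensor"
    by (induct s) (simp_all add: tensor_flip_tens lin)
  show "bij (tensor_flip :: ('a, 'b) tensor \<Rightarrow> _)" by (rule o_bij[of tensor_flip]) (simp_all add: fun_eq_iff inv)
  show "tensor_flip (s * t) = tensor_flip s * tensor_flip t"
    by (rule tensor_mult_eqI[where F = "\<lambda>s t. tensor_flip (s * t)"])
      (simp_all add: clinear_iff lin distrib_left distrib_right scaleC_mult_left scaleC_mult_right
        times_tensor_tens tensor_flip_tens)
qed

lemma bij_tensor_assoc: "bij tensor_assoc"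
proof -
  define r :: "('a, ('b, 'c) tensor) tensor \<Rightarrow> (('a, 'b) tensor, 'c) tensor"
    where "r t = tensor_flip (tensor_lift (\<lambda>z s. z \<otimes>\<^sub>T tensor_flip s) (tensor_assoc (tensor_flip
      (tensor_lift (\<lambda>x s. x \<otimes>\<^sub>T tensor_flip s) t))))" for t
  have b: "bilinear_on UNIV UNIV (\<lambda>x (s :: ('d::complex_vector, 'e::complex_vector) tensor). x \<otimes>\<^sub>T tensor_flip s)"
    by (rule bilinear_onI)
      (simp_all add: tens_add_left tens_add_right tens_scale_left tens_scale_right
        clinear_tensor_flip[unfolded clinear_iff])
  note lin = clinear_tensor_assoc[unfolded clinear_iff] clinear_tensor_flip[unfolded clinear_iff]
    clinear_tensor_lift[OF b, unfolded clinear_iff]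
  have r: "r (x \<otimes>\<^sub>T (y \<otimes>\<^sub>T z)) = (x \<otimes>\<^sub>T y) \<otimes>\<^sub>T z" for x y z
    by (simp add: r_def tensor_lift[OF b] tensor_flip_tens tensor_assoc_tens)
  have r_lin: "r (s + t) = r s + r t" for s t by (simp add: r_def lin)
  have "r (tensor_assoc t) = t" for t
  proof (induct t)
    case (tens s z)
    show ?case by (induct s) (simp_all add: tensor_assoc_tens r tens_add_left lin r_lin)
  qed (simp add: lin r_lin)
  moreover have "tensor_assoc (r t) = t" for t
  proof (induct t)
    case (tens x s)
    show ?case by (induct s) (simp_all add: tensor_assoc_tens r tens_add_right lin r_lin)
  qed (simp add: lin r_lin)
  ultimately show ?thesis by (intro o_bij[of r]) (simp_all add: fun_eq_iff)
qed

lemma tensor_assoc_mult: "tensor_assoc (s * t) = tensor_assoc s * tensor_assoc t"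
  for s t :: "(('a::complex_algebra, 'b::complex_algebra) tensor, 'c::complex_algebra) tensor"
proof (rule tensor_mult_eqI[where F = "\<lambda>s t. tensor_assoc (s * t)"])
  note lin = clinear_tensor_assoc[unfolded clinear_iff] distrib_left distrib_right
    scaleC_mult_left scaleC_mult_right
  show "clinear (\<lambda>t. tensor_assoc (s * t))" "clinear (\<lambda>t. tensor_assoc (t * s))"
    "clinear (\<lambda>t. tensor_assoc s * tensor_assoc t)" "clinear (\<lambda>t. tensor_assoc t * tensor_assoc s)"
    for s :: "(('a, 'b) tensor, 'c) tensor"
    by (simp_all add: clinear_iff lin)
  fix u v :: "('a, 'b) tensor" and z w :: 'c
  show "tensor_assoc ((u \<otimes>\<^sub>T z) * (v \<otimes>\<^sub>T w)) = tensor_assoc (u \<otimes>\<^sub>T z) * tensor_assoc (v \<otimes>\<^sub>T w)"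
    by (rule tensor_mult_eqI[where
          F = "\<lambda>u v. tensor_assoc ((u \<otimes>\<^sub>T z) * (v \<otimes>\<^sub>T w))" and
          G = "\<lambda>u v. tensor_assoc (u \<otimes>\<^sub>T z) * tensor_assoc (v \<otimes>\<^sub>T w)"])
      (simp_all add: clinear_iff lin tens_add_left tens_scale_left times_tensor_tens tensor_assoc_tens)
qed

lemma bilinear_multiplier_tens: "bilinear_on UNIV UNIV (\<otimes>\<^sub>M)"
proof -
  have eqI: "m = n"
    if "\<And>x y. lact m (x \<otimes>\<^sub>T y) = lact n (x \<otimes>\<^sub>T y)" "\<And>x y. ract (x \<otimes>\<^sub>T y) m = ract (x \<otimes>\<^sub>T y) n"
    for m n :: "('c::complex_algebra, 'd::complex_algebra) tensor multiplier"
  proof (rule multiplier_eqI)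
    fix t
    show "lact m t = lact n t"
      using clinear_tensor_eqI[OF lact_linear lact_linear that(1)] by (rule fun_cong)
    show "ract t m = ract t n"
      using clinear_tensor_eqI[OF ract_linear ract_linear that(2)] by (rule fun_cong)
  qed
  show ?thesis
    by (rule bilinear_onI; rule eqI)
      (simp_all add: lact_multiplier_tens ract_multiplier_tens tens_add_left tens_add_right
        tens_scale_left tens_scale_right)
qed


section \<open>Multiplier Hopf algebras\<close>

text \<open>\<open>\<Delta>(a)(1 \<otimes> b)\<close> and \<open>(a \<otimes> 1)\<Delta>(b)\<close> as elements of \<open>A \<otimes> A\<close>.\<close>

definition right_cov ::
  "('a::complex_algebra \<Rightarrow> ('a, 'a) tensor multiplier) \<Rightarrow> 'a \<Rightarrow> 'a \<Rightarrow> ('a, 'a) tensor"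
  where "right_cov \<Delta> a b = alg_of (\<Delta> a * (1 \<otimes>\<^sub>M mult_of b))"

definition left_cov ::
  "('a::complex_algebra \<Rightarrow> ('a, 'a) tensor multiplier) \<Rightarrow> 'a \<Rightarrow> 'a \<Rightarrow> ('a, 'a) tensor"
  where "left_cov \<Delta> a b = alg_of ((mult_of a \<otimes>\<^sub>M 1) * \<Delta> b)"

locale multiplier_hopf_algebra =
  fixes \<Delta> :: "'a::complex_algebra \<Rightarrow> ('a, 'a) tensor multiplier"
  assumes nondegenerate: "nondegenerate TYPE('a)"
    and comult_linear: "clinear \<Delta>"
    and comult_mult: "\<Delta> (a * b) = \<Delta> a * \<Delta> b"
    and right_cov: "\<Delta> a * (1 \<otimes>\<^sub>M mult_of b) \<in> range mult_of"
    and left_cov: "(mult_of a \<otimes>\<^sub>M 1) * \<Delta> b \<in> range mult_of"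
    and coassoc:
      "transport_multiplier tensor_assoc
         (((mult_of a \<otimes>\<^sub>M 1) \<otimes>\<^sub>M 1) * tensor_lift (\<lambda>x y. \<Delta> x \<otimes>\<^sub>M mult_of y) (right_cov \<Delta> b c))
       = tensor_lift (\<lambda>x y. mult_of x \<otimes>\<^sub>M \<Delta> y) (left_cov \<Delta> a b) * (1 \<otimes>\<^sub>M (1 \<otimes>\<^sub>M mult_of c))"
    and bij_right_cov: "bij (tensor_lift (right_cov \<Delta>))"
    and bij_left_cov: "bij (tensor_lift (left_cov \<Delta>))"

definition regular_multiplier_hopf_algebra ::
  "('a::complex_algebra \<Rightarrow> ('a, 'a) tensor multiplier) \<Rightarrow> bool"
  where "regular_multiplier_hopf_algebra \<Delta> \<longleftrightarrow>
    multiplier_hopf_algebra \<Delta> \<and>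
    multiplier_hopf_algebra (\<lambda>a. transport_multiplier tensor_flip (\<Delta> a))"

definition is_counit ::
  "('a::complex_algebra \<Rightarrow> ('a, 'a) tensor multiplier) \<Rightarrow> ('a \<Rightarrow> complex) \<Rightarrow> bool"
  where "is_counit \<Delta> \<epsilon> \<longleftrightarrow>
    clinear \<epsilon> \<and> (\<forall>a b. \<epsilon> (a * b) = \<epsilon> a * \<epsilon> b) \<and>
    (\<forall>a b. tensor_lift (\<lambda>x y. \<epsilon> x *\<^sub>C y) (right_cov \<Delta> a b) = a * b) \<and>
    (\<forall>a b. tensor_lift (\<lambda>x y. \<epsilon> y *\<^sub>C x) (left_cov \<Delta> a b) = a * b)"

definition counit :: "('a::complex_algebra \<Rightarrow> ('a, 'a) tensor multiplier) \<Rightarrow> 'a \<Rightarrow> complex"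
  where "counit \<Delta> = (THE \<epsilon>. is_counit \<Delta> \<epsilon>)"

definition is_antipode ::
  "('a::complex_algebra \<Rightarrow> ('a, 'a) tensor multiplier) \<Rightarrow> ('a \<Rightarrow> 'a multiplier) \<Rightarrow> bool"
  where "is_antipode \<Delta> S \<longleftrightarrow>
    clinear S \<and> (\<forall>a b. S (a * b) = S b * S a) \<and>
    (\<forall>a b. tensor_lift (\<lambda>x y. lact (S x) y) (right_cov \<Delta> a b) = counit \<Delta> a *\<^sub>C b) \<and>
    (\<forall>a b. tensor_lift (\<lambda>x y. ract x (S y)) (left_cov \<Delta> b a) = counit \<Delta> a *\<^sub>C b)"

definition antipode :: "('a::complex_algebra \<Rightarrow> ('a, 'a) tensor multiplier) \<Rightarrow> 'a \<Rightarrow> 'a multiplier"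
  where "antipode \<Delta> = (THE S. is_antipode \<Delta> S)"

text \<open>The multipliers \<open>(\<iota> \<otimes> \<phi>)(\<Delta> a)\<close> and \<open>(\<psi> \<otimes> \<iota>)(\<Delta> a)\<close>. They are meaningful for regular
  multiplier Hopf algebras, where \<open>\<Delta>(a)(b \<otimes> 1)\<close> and \<open>(1 \<otimes> b)\<Delta>(a)\<close> lie in \<open>A \<otimes> A\<close>.\<close>

definition slice_right ::
  "('a::complex_algebra \<Rightarrow> ('a, 'a) tensor multiplier) \<Rightarrow> ('a \<Rightarrow> complex) \<Rightarrow> 'a \<Rightarrow> 'a multiplier"
  where "slice_right \<Delta> \<phi> a = (THE m. \<forall>b.
    lact m b = tensor_lift (\<lambda>x y. \<phi> y *\<^sub>C x) (alg_of (\<Delta> a * (mult_of b \<otimes>\<^sub>M 1))) \<and>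
    ract b m = tensor_lift (\<lambda>x y. \<phi> y *\<^sub>C x) (alg_of ((mult_of b \<otimes>\<^sub>M 1) * \<Delta> a)))"

definition slice_left ::
  "('a::complex_algebra \<Rightarrow> ('a, 'a) tensor multiplier) \<Rightarrow> ('a \<Rightarrow> complex) \<Rightarrow> 'a \<Rightarrow> 'a multiplier"
  where "slice_left \<Delta> \<psi> a = (THE m. \<forall>b.
    lact m b = tensor_lift (\<lambda>x y. \<psi> x *\<^sub>C y) (alg_of (\<Delta> a * (1 \<otimes>\<^sub>M mult_of b))) \<and>
    ract b m = tensor_lift (\<lambda>x y. \<psi> x *\<^sub>C y) (alg_of ((1 \<otimes>\<^sub>M mult_of b) * \<Delta> a)))"

definition left_integral ::
  "('a::complex_algebra \<Rightarrow> ('a, 'a) tensor multiplier) \<Rightarrow> ('a \<Rightarrow> complex) \<Rightarrow> bool"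
  where "left_integral \<Delta> \<phi> \<longleftrightarrow>
    clinear \<phi> \<and> \<phi> \<noteq> (\<lambda>x. 0) \<and> (\<forall>a. slice_right \<Delta> \<phi> a = \<phi> a *\<^sub>C 1)"

definition right_integral ::
  "('a::complex_algebra \<Rightarrow> ('a, 'a) tensor multiplier) \<Rightarrow> ('a \<Rightarrow> complex) \<Rightarrow> bool"
  where "right_integral \<Delta> \<psi> \<longleftrightarrow>
    clinear \<psi> \<and> \<psi> \<noteq> (\<lambda>x. 0) \<and> (\<forall>a. slice_left \<Delta> \<psi> a = \<psi> a *\<^sub>C 1)"


section \<open>The dual\<close>

definition tensor_functional ::
  "('a::complex_vector \<Rightarrow> complex) \<Rightarrow> ('b::complex_vector \<Rightarrow> complex) \<Rightarrow> ('a, 'b) tensor \<Rightarrow> complex"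
  where "tensor_functional f g = tensor_lift (\<lambda>x y. f x * g y)"

text \<open>An element of \<open>A' \<otimes> A'\<close> evaluated at \<open>x \<otimes> y\<close>.\<close>

definition tensor_eval :: "('a \<Rightarrow> complex, 'b \<Rightarrow> complex) tensor \<Rightarrow> 'a \<Rightarrow> 'b \<Rightarrow> complex"
  where "tensor_eval t x y = tensor_lift (\<lambda>f g. f x * g y) t"

definition dual_space :: "('a::complex_algebra \<Rightarrow> complex) \<Rightarrow> ('a \<Rightarrow> complex) set"
  where "dual_space \<phi> = {\<lambda>x. \<phi> (x * a) | a. True}"

text \<open>Duality \<open>(\<omega>\<^sub>1 \<omega>\<^sub>2)(x) = (\<omega>\<^sub>1 \<otimes> \<omega>\<^sub>2)(\<Delta>(x))\<close>. For \<open>\<omega>\<^sub>1 = \<phi>(\<cdot> a)\<close> and \<open>\<omega>\<^sub>2 = \<phi>(\<cdot> b)\<close> the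
  right-hand side means \<open>(\<phi> \<otimes> \<phi>)(\<Delta>(x)(a \<otimes> b))\<close>, since \<open>\<Delta>(x)\<close> is only a multiplier.\<close>

definition dual_product ::
  "('a::complex_algebra \<Rightarrow> ('a, 'a) tensor multiplier) \<Rightarrow> ('a \<Rightarrow> complex)
    \<Rightarrow> (('a \<Rightarrow> complex) \<Rightarrow> ('a \<Rightarrow> complex) \<Rightarrow> ('a \<Rightarrow> complex)) \<Rightarrow> bool"
  where "dual_product \<Delta> \<phi> mul \<longleftrightarrow> (\<forall>a b x.
    mul (\<lambda>x. \<phi> (x * a)) (\<lambda>x. \<phi> (x * b)) x = tensor_functional \<phi> \<phi> (lact (\<Delta> x) (a \<otimes>\<^sub>T b)))"

definition dual_coproduct ::
  "('a::complex_algebra \<Rightarrow> complex) \<Rightarrow> (('a \<Rightarrow> complex) \<Rightarrow> ('a \<Rightarrow> complex, 'a \<Rightarrow> complex) tensor) \<Rightarrow> bool"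
  where "dual_coproduct \<phi> D \<longleftrightarrow>
    (\<forall>\<omega>\<in>dual_space \<phi>. \<forall>x y. tensor_eval (D \<omega>) x y = \<omega> (x * y))"

text \<open>The product of \<open>V \<otimes> V\<close>, for an algebra on a subspace \<open>V\<close> of an ambient vector space.\<close>

definition tensor_mult ::
  "'v::complex_vector set \<Rightarrow> ('v \<Rightarrow> 'v \<Rightarrow> 'v) \<Rightarrow> ('v, 'v) tensor \<Rightarrow> ('v, 'v) tensor \<Rightarrow> ('v, 'v) tensor"
  where "tensor_mult V mul s t =
    tensor_lift_on V V (\<lambda>a b. tensor_lift_on V V (\<lambda>c d. mul a c \<otimes>\<^sub>T mul b d) t) s"

locale hopf_algebra_on =
  fixes V :: "'v::complex_vector set"
    and mul :: "'v \<Rightarrow> 'v \<Rightarrow> 'v" and u :: 'v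
    and D :: "'v \<Rightarrow> ('v, 'v) tensor" and e :: "'v \<Rightarrow> complex" and S :: "'v \<Rightarrow> 'v"
  assumes subspace: "csubspace V"
    and mul_bilinear: "bilinear_on V V mul"
    and mul_closed: "f \<in> V \<Longrightarrow> g \<in> V \<Longrightarrow> mul f g \<in> V"
    and mul_assoc: "f \<in> V \<Longrightarrow> g \<in> V \<Longrightarrow> h \<in> V \<Longrightarrow> mul (mul f g) h = mul f (mul g h)"
    and unit_in: "u \<in> V"
    and unit_left: "f \<in> V \<Longrightarrow> mul u f = f"
    and unit_right: "f \<in> V \<Longrightarrow> mul f u = f"
    and comult_linear: "linear_on V D"
    and comult_in: "f \<in> V \<Longrightarrow> D f \<in> V \<otimes>\<^sub>S V"
    and comult_coassoc: "f \<in> V \<Longrightarrow>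
      tensor_assoc (tensor_lift_on V V (\<lambda>a b. D a \<otimes>\<^sub>T b) (D f)) = tensor_lift_on V V (\<lambda>a b. a \<otimes>\<^sub>T D b) (D f)"
    and counit_linear: "linear_on V e"
    and counit_left: "f \<in> V \<Longrightarrow> tensor_lift_on V V (\<lambda>a b. e a *\<^sub>C b) (D f) = f"
    and counit_right: "f \<in> V \<Longrightarrow> tensor_lift_on V V (\<lambda>a b. e b *\<^sub>C a) (D f) = f"
    and comult_mul: "f \<in> V \<Longrightarrow> g \<in> V \<Longrightarrow> D (mul f g) = tensor_mult V mul (D f) (D g)"
    and comult_unit: "D u = u \<otimes>\<^sub>T u"
    and counit_mul: "f \<in> V \<Longrightarrow> g \<in> V \<Longrightarrow> e (mul f g) = e f * e g"
    and counit_unit: "e u = 1"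
    and antipode_linear: "linear_on V S"
    and antipode_in: "f \<in> V \<Longrightarrow> S f \<in> V"
    and antipode_left: "f \<in> V \<Longrightarrow> tensor_lift_on V V (\<lambda>a b. mul (S a) b) (D f) = e f *\<^sub>C u"
    and antipode_right: "f \<in> V \<Longrightarrow> tensor_lift_on V V (\<lambda>a b. mul a (S b)) (D f) = e f *\<^sub>C u"


section \<open>Group-cograded multiplier Hopf algebras\<close>

locale group_cograded = group G + multiplier_hopf_algebra \<Delta>
  for G :: "('g, 'm) monoid_scheme" (structure)
    and \<Delta> :: "'a::complex_algebra \<Rightarrow> ('a, 'a) tensor multiplier" +
  fixes A :: "'g \<Rightarrow> 'a set"
  assumes component_subspace: "p \<in> carrier G \<Longrightarrow> csubspace (A p)"
    and component_mult: "p \<in> carrier G \<Longrightarrow> x \<in> A p \<Longrightarrow> y \<in> A p \<Longrightarrow> x * y \<in> A p"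
    and component_nontrivial: "p \<in> carrier G \<Longrightarrow> A p \<noteq> {0}"
    and direct_sum: "\<exists>!x. (\<forall>p\<in>carrier G. x p \<in> A p) \<and> (\<forall>p. p \<notin> carrier G \<longrightarrow> x p = 0) \<and>
      finite {p. x p \<noteq> 0} \<and> a = (\<Sum>p | x p \<noteq> 0. x p)"
    and component_orthogonal: "p \<in> carrier G \<Longrightarrow> q \<in> carrier G \<Longrightarrow> p \<noteq> q \<Longrightarrow>
      x \<in> A p \<Longrightarrow> y \<in> A q \<Longrightarrow> x * y = 0"
    and right_cov_component: "p \<in> carrier G \<Longrightarrow> q \<in> carrier G \<Longrightarrow>
      cspan {right_cov \<Delta> a b | a b. a \<in> A (p \<otimes> q) \<and> b \<in> A q} = A p \<otimes>\<^sub>S A q"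
    and left_cov_component: "p \<in> carrier G \<Longrightarrow> q \<in> carrier G \<Longrightarrow>
      cspan {left_cov \<Delta> a b | a b. a \<in> A p \<and> b \<in> A (p \<otimes> q)} = A p \<otimes>\<^sub>S A q"

definition finite_dim :: "'a::complex_vector set \<Rightarrow> bool"
  where "finite_dim V \<longleftrightarrow> (\<exists>B. finite B \<and> V = cspan B)"

definition is_identity :: "'a::complex_algebra set \<Rightarrow> 'a \<Rightarrow> bool"
  where "is_identity V u \<longleftrightarrow> u \<in> V \<and> (\<forall>x\<in>V. u * x = x \<and> x * u = x)"

definition identity_of :: "'a::complex_algebra set \<Rightarrow> 'a"
  where "identity_of V = (THE u. is_identity V u)"

text \<open>\<open>\<Delta>\<^sub>p\<^sub>,\<^sub>q(a)\<close> for \<open>a\<close> in \<open>A\<^sub>p\<^sub>q\<close>. When the components have identities, \<open>M(A\<^sub>p \<otimes> A\<^sub>q)\<close> is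
  \<open>A\<^sub>p \<otimes> A\<^sub>q\<close>, and the component of \<open>\<Delta>(a)\<close> is the element that acts on \<open>A\<^sub>p \<otimes> A\<^sub>q\<close> like \<open>\<Delta>(a)\<close>.\<close>

definition comult_component ::
  "('a::complex_algebra \<Rightarrow> ('a, 'a) tensor multiplier) \<Rightarrow> ('g \<Rightarrow> 'a set) \<Rightarrow> 'g \<Rightarrow> 'g
    \<Rightarrow> 'a \<Rightarrow> ('a, 'a) tensor"
  where "comult_component \<Delta> A p q a = (THE t. t \<in> A p \<otimes>\<^sub>S A q \<and>
    (\<forall>s\<in>A p \<otimes>\<^sub>S A q. t * s = lact (\<Delta> a) s \<and> s * t = ract s (\<Delta> a)))"

text \<open>\<open>A\<^sub>p'\<close>, its elements being extended by zero to the other components, and \<open>A\<^sup>* = \<Oplus>\<^sub>p A\<^sub>p'\<close>.\<close>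

definition component_dual ::
  "('g, 'm) monoid_scheme \<Rightarrow> ('g \<Rightarrow> 'a::complex_vector set) \<Rightarrow> 'g \<Rightarrow> ('a \<Rightarrow> complex) set"
  where "component_dual G A p =
    {f. clinear f \<and> (\<forall>q\<in>carrier G. q \<noteq> p \<longrightarrow> (\<forall>x\<in>A q. f x = 0))}"

definition graded_dual ::
  "('g, 'm) monoid_scheme \<Rightarrow> ('g \<Rightarrow> 'a::complex_vector set) \<Rightarrow> ('a \<Rightarrow> complex) set"
  where "graded_dual G A = cspan (\<Union>p\<in>carrier G. component_dual G A p)"

end

theory Submission
  imports Defs
begin

text \<open>The components \<open>\<Delta>\<^sub>p\<^sub>,\<^sub>q\<close> of the coproduct are unital homomorphisms, and \<open>A\<^sup>*\<close> is the graded bialgebra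
  dual to them; counit and antipode are read off the inverse of the bijection
  \<open>a \<otimes> b \<mapsto> \<Delta>(a)(1 \<otimes> b)\<close>. Since all \<open>A\<^sub>q\<close> are finite-dimensional, the trace over \<open>A\<^sub>q\<close> of
  \<open>a \<mapsto> x S\<^sup>2(a\<^sub>1) f(a\<^sub>2)\<close> is defined for every functional \<open>f\<close> on \<open>A\<^sub>e\<close>; as a function of \<open>x \<in> A\<^sub>q\<close> it
  satisfies left invariance because the trace is cyclic, and it cannot vanish for all \<open>f\<close>. A left
  integral \<open>\<phi>\<close> is faithful, since \<open>\<phi>(y) a = \<phi>(y S\<^sup>2(a\<^sub>2) S(a\<^sub>1)) a\<^sub>3\<close> vanishes when \<open>\<phi>(x S(a)) = 0\<close> for
  all \<open>x\<close>. Hence \<open>S\<close> is bijective, \<open>\<phi> \<circ> S\<close> is a right integral, and by counting dimensions every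
  functional on \<open>A\<^sub>q\<close> is of the form \<open>\<phi>(\<cdot> a)\<close>.\<close>

section \<open>Sums over representations of tensors\<close>

text \<open>\<Delta>(a) is only a multiplier and may have infinitely many components, so Sweedler
  sums make no sense globally. Cutting with the central elements 1_p \<otimes> 1_q gives genuine
  tensors \<Delta>_{p,q}(a); every Hopf identity is therefore proved with explicit group indices,
  which also decide when products of components vanish. The inverse T^-1 of the bijection T carries
  both counit and antipode because formally T^-1(a \<otimes> b) = a_1 \<otimes> S(a_2) b:
  multiplying the legs gives \<epsilon>(a) b, and applying \<epsilon> to the first leg gives S(a) b.
  In the trace, S^2 is what makes cyclicity usable: \<Delta>(a)(1 \<otimes> S^2(u)) = \<Delta>(a
  S^2(u_2))(S(u_1) \<otimes> 1) moves the operator from A_q to A_{pq}. The functional f sees only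
  the last leg, which stays in A_e, so one f serves all q; the traces then fit together to a single
  functional, and it is enough to see that it does not vanish on A_e. Since S maps A_p to A_{p^-1},
  bijectivity is obtained from the endomorphism S^2 of A_p.\<close>

abbreviation bilinear :: "('a::complex_vector \<Rightarrow> 'b::complex_vector \<Rightarrow> 'c::complex_vector) \<Rightarrow> bool"
  where "bilinear \<equiv> bilinear_on UNIV UNIV"

lemma bilinear_iff:
  "bilinear f \<longleftrightarrow> (\<forall>x x' y. f (x + x') y = f x y + f x' y) \<and> (\<forall>c x y. f (c *\<^sub>C x) y = c *\<^sub>C f x y) \<and>
    (\<forall>x y y'. f x (y + y') = f x y + f x y') \<and> (\<forall>c x y. f x (c *\<^sub>C y) = c *\<^sub>C f x y)"
  by (auto simp: bilinear_on_def linear_on_def)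

definition trilinear ::
  "('a::complex_vector \<Rightarrow> 'b::complex_vector \<Rightarrow> 'c::complex_vector \<Rightarrow> 'd::complex_vector) \<Rightarrow> bool"
  where "trilinear f \<longleftrightarrow> (\<forall>z. bilinear (\<lambda>x y. f x y z)) \<and> (\<forall>x. bilinear (f x))"

lemma trilinear_iff:
  "trilinear f \<longleftrightarrow> (\<forall>x x' y z. f (x + x') y z = f x y z + f x' y z) \<and> (\<forall>c x y z. f (c *\<^sub>C x) y z = c *\<^sub>C f x y z) \<and>
    (\<forall>x y y' z. f x (y + y') z = f x y z + f x y' z) \<and> (\<forall>c x y z. f x (c *\<^sub>C y) z = c *\<^sub>C f x y z) \<and>
    (\<forall>x y z z'. f x y (z + z') = f x y z + f x y z') \<and> (\<forall>c x y z. f x y (c *\<^sub>C z) = c *\<^sub>C f x y z)"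
  by (auto simp: trilinear_def bilinear_iff)

lemma clinear_add: "clinear f \<Longrightarrow> f (x + y) = f x + f y"
  and clinear_scale: "clinear f \<Longrightarrow> f (c *\<^sub>C x) = c *\<^sub>C f x"
  by (simp_all add: clinear_iff)

lemmas clinear_simps = clinear_add clinear_scale

lemma scaleC_complex [simp]: "(c *\<^sub>C d :: complex) = c * d"
  by (simp add: scaleC_complex_def)

text \<open>Summation over a representation of a tensor by elementary tensors plays the role of
  Sweedler's notation. Since a fixed representation is used, sums over independent tensors commute
  and commute with linear maps unconditionally; bilinearity is needed only for changing the
  representation.\<close>

definition tensor_rep :: "('a::complex_vector, 'b::complex_vector) tensor \<Rightarrow> ('a \<times> 'b) list"
  where "tensor_rep t = (SOME xs. t = (\<Sum>(x, y)\<leftarrow>xs. x \<otimes>\<^sub>T y))"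

definition tsum ::
  "('a::complex_vector, 'b::complex_vector) tensor \<Rightarrow> ('a \<Rightarrow> 'b \<Rightarrow> 'c::complex_vector) \<Rightarrow> 'c"
  where "tsum t f = (\<Sum>(x, y)\<leftarrow>tensor_rep t. f x y)"

lemma tsum_tens: "tsum t (\<otimes>\<^sub>T) = t"
proof -
  have "\<exists>xs. t = (\<Sum>(x, y)\<leftarrow>xs. x \<otimes>\<^sub>T y)"
  proof (induct t)
    case (tens x y)
    show ?case by (rule exI[of _ "[(x, y)]"]) simp
  next
    case (add s t)
    then obtain xs ys where "s = (\<Sum>(x, y)\<leftarrow>xs. x \<otimes>\<^sub>T y)" "t = (\<Sum>(x, y)\<leftarrow>ys. x \<otimes>\<^sub>T y)" by blast
    then show ?case by (intro exI[of _ "xs @ ys"]) simp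
  qed
  from someI_ex[OF this] show ?thesis by (simp add: tsum_def tensor_rep_def)
qed

lemma tsum_linear: "clinear h \<Longrightarrow> h (tsum t f) = tsum t (\<lambda>x y. h (f x y))"
proof -
  assume h: "clinear h"
  have "h (\<Sum>(x, y)\<leftarrow>xs. f x y) = (\<Sum>(x, y)\<leftarrow>xs. h (f x y))" for xs
    by (induct xs) (auto simp: h clinear_add clinear_0)
  then show ?thesis by (simp add: tsum_def)
qed

lemma tsum_eq_lift: "bilinear f \<Longrightarrow> tsum t f = tensor_lift f t"
  using tsum_linear[OF clinear_tensor_lift, of f t "(\<otimes>\<^sub>T)"] by (simp add: tsum_tens tensor_lift)

lemma
  assumes "bilinear f"
  shows tsum_plus_tensor: "tsum (s + t) f = tsum s f + tsum t f"
    and tsum_scale_tensor: "tsum (c *\<^sub>C s) f = c *\<^sub>C tsum s f"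
    and tsum_zero_tensor: "tsum 0 f = 0"
    and tsum_of_tens: "tsum (x \<otimes>\<^sub>T y) f = f x y"
  using assms clinear_0[OF clinear_tensor_lift[OF assms]]
  by (simp_all add: tsum_eq_lift tensor_lift clinear_add clinear_scale clinear_tensor_lift)

lemmas tsum_linear_tensor = tsum_plus_tensor tsum_scale_tensor

lemma tsum_add [simp]: "tsum t (\<lambda>x y. f x y + g x y) = tsum t f + tsum t g"
proof -
  have "(\<Sum>(x, y)\<leftarrow>xs. f x y + g x y) = (\<Sum>(x, y)\<leftarrow>xs. f x y) + (\<Sum>(x, y)\<leftarrow>xs. g x y)" for xs
    by (induct xs) (auto simp: algebra_simps)
  then show ?thesis by (simp add: tsum_def)
qed

lemma clinear_scaleC: "clinear (\<lambda>x. c *\<^sub>C x)"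
  by (simp add: clinear_iff scaleC_add_right scaleC_scaleC mult.commute)

lemma clinear_scaleC_left: "clinear (\<lambda>c. c *\<^sub>C x)"
  by (simp add: clinear_iff scaleC_add_left scaleC_scaleC)

lemma tsum_scale [simp]: "tsum t (\<lambda>x y. c *\<^sub>C f x y) = c *\<^sub>C tsum t f"
  by (rule tsum_linear[OF clinear_scaleC, symmetric])

lemma tsum_0 [simp]: "tsum t (\<lambda>x y. 0) = 0"
  using tsum_scale[of t 0 "\<lambda>x y. 0"] by simp

lemma tsum_sum: "tsum t (\<lambda>x y. \<Sum>i\<in>I. f i x y) = (\<Sum>i\<in>I. tsum t (f i))"
  by (induct I rule: infinite_finite_induct) auto

lemma tsum_swap: "tsum s (\<lambda>x y. tsum t (\<lambda>u v. f x y u v)) = tsum t (\<lambda>u v. tsum s (\<lambda>x y. f x y u v))"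
proof -
  have "(\<Sum>(x, y)\<leftarrow>xs. tsum t (f x y)) = tsum t (\<lambda>u v. \<Sum>(x, y)\<leftarrow>xs. f x y u v)" for xs
    by (induct xs) auto
  then show ?thesis by (simp add: tsum_def)
qed

lemma tsum_tsum:
  assumes "bilinear h"
  shows "tsum (tsum t (\<lambda>x y. f x y \<otimes>\<^sub>T g x y)) h = tsum t (\<lambda>x y. h (f x y) (g x y))"
  using tsum_linear[OF clinear_tensor_lift[OF assms], of t "\<lambda>x y. f x y \<otimes>\<^sub>T g x y"] assms
  by (simp add: tsum_eq_lift[OF assms] tensor_lift)

lemma tsum_tsum_tensor:
  assumes "bilinear h"
  shows "tsum (tsum t f) h = tsum t (\<lambda>x y. tsum (f x y) h)"
  using tsum_linear[OF clinear_tensor_lift[OF assms], of t f] assms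
  by (simp add: tsum_eq_lift[OF assms] tensor_lift)

lemma tsum_times: "bilinear f \<Longrightarrow>
    tsum (s * t) f = tsum s (\<lambda>x y. tsum t (\<lambda>u v. f (x * u) (y * v)))"
  for s t :: "('a::complex_algebra, 'b::complex_algebra) tensor"
proof -
  assume f: "bilinear f"
  have "s * t = tsum s (\<lambda>x y. x \<otimes>\<^sub>T y) * tsum t (\<lambda>x y. x \<otimes>\<^sub>T y)" by (simp only: tsum_tens)
  also have "\<dots> = tsum s (\<lambda>x y. (x \<otimes>\<^sub>T y) * tsum t (\<lambda>x y. x \<otimes>\<^sub>T y))"
    by (rule tsum_linear) (simp add: clinear_iff distrib_right scaleC_mult_left)
  also have "\<dots> = tsum s (\<lambda>x y. tsum t (\<lambda>u v. (x \<otimes>\<^sub>T y) * (u \<otimes>\<^sub>T v)))"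
    by (subst tsum_linear[of "\<lambda>t. _ * t"]) (simp_all add: clinear_iff distrib_left scaleC_mult_right)
  finally show ?thesis by (simp add: f times_tensor_tens tsum_tsum_tensor tsum_of_tens)
qed

text \<open>The slice maps f \<otimes> \<iota> and \<iota> \<otimes> f.\<close>

abbreviation lslice
  where "lslice f t \<equiv> tsum t (\<lambda>x y. f x *\<^sub>C y)"

abbreviation rslice
  where "rslice f t \<equiv> tsum t (\<lambda>x y. f y *\<^sub>C x)"

lemma tensor_span_I: "x \<in> V \<Longrightarrow> y \<in> W \<Longrightarrow> x \<otimes>\<^sub>T y \<in> V \<otimes>\<^sub>S W"
  unfolding tensor_span_def by (rule complex_vector.span_base) blast

lemma csubspace_tensor_span: "csubspace (V \<otimes>\<^sub>S W)"
  unfolding tensor_span_def by (rule complex_vector.subspace_span)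

lemma linear_eq_on_tensor_span:
  assumes "clinear f" "clinear g" "\<And>x y. x \<in> V \<Longrightarrow> y \<in> W \<Longrightarrow> f (x \<otimes>\<^sub>T y) = g (x \<otimes>\<^sub>T y)" "t \<in> V \<otimes>\<^sub>S W"
  shows "f t = g t"
  using complex_vector.linear_eq_on[OF assms(1,2) assms(4)[unfolded tensor_span_def]] assms(3) by auto

lemma linear_functional_exists:
  fixes v :: "'a::complex_vector"
  assumes "v \<noteq> 0"
  obtains f :: "'a \<Rightarrow> complex" where "clinear f" "f v = 1"
proof -
  have "complex_vector.independent {v}"
    using assms by (simp add: complex_vector.dependent_single)
  from complex_vector.linear_independent_extend[OF this, of "\<lambda>_. 1 :: complex"]
  show ?thesis using that by auto
qed

text \<open>Slicing with a functional that is 1 at \<open>v\<close> recovers the other factor. Used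
  to strip an auxiliary identity off an equation between tensors.\<close>

lemma tens_left_cancel:
  assumes "v \<otimes>\<^sub>T x = v \<otimes>\<^sub>T y" "v \<noteq> 0"
  shows "x = y"
proof -
  obtain f :: "'a \<Rightarrow> complex" where f: "clinear f" "f v = 1" using linear_functional_exists[OF assms(2)] by blast
  have b: "bilinear (\<lambda>x y. f x *\<^sub>C y)"
    using f(1) by (auto simp: bilinear_iff clinear_iff scaleC_add_left scaleC_add_right scaleC_scaleC mult.commute)
  show ?thesis using arg_cong[OF assms(1), of "tensor_lift (\<lambda>x y. f x *\<^sub>C y)"]
    by (simp add: tensor_lift[OF b] f(2) scaleC_one)
qed

lemma tens_right_cancel:
  assumes "x \<otimes>\<^sub>T v = y \<otimes>\<^sub>T v" "v \<noteq> 0"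
  shows "x = y"
  using tens_left_cancel[of v x y] arg_cong[OF assms(1), of tensor_flip] assms(2)
  by (simp add: tensor_flip_tens)

lemma tens_0_left [simp]: "0 \<otimes>\<^sub>T y = 0" and tens_0_right [simp]: "x \<otimes>\<^sub>T 0 = 0"
  using tens_scale_left[of 0 0 y] tens_scale_right[of x 0 0] by simp_all

lemma tsum_scale_mult:
  "tsum t (\<lambda>x y. (c * f x y) *\<^sub>C g x y) = c *\<^sub>C tsum t (\<lambda>x y. f x y *\<^sub>C g x y)"
  "tsum t (\<lambda>x y. (f x y * c) *\<^sub>C g x y) = c *\<^sub>C tsum t (\<lambda>x y. f x y *\<^sub>C g x y)"
  by (simp_all only: tsum_linear[OF clinear_scaleC] scaleC_scaleC mult.commute)

lemma sum_apply: "(\<Sum>i\<in>I. f i) x = (\<Sum>i\<in>I. f i x)"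
  by (induct I rule: infinite_finite_induct) auto

lemma tensor_lift_on_linear:
  assumes "csubspace V" "csubspace W" "bilinear_on V W f"
  shows "tensor_lift_on V W f (s + t) = tensor_lift_on V W f s + tensor_lift_on V W f t"
    and "tensor_lift_on V W f (c *\<^sub>C s) = c *\<^sub>C tensor_lift_on V W f s"
    and "tensor_lift_on V W f (sum g I) = (\<Sum>i\<in>I. tensor_lift_on V W f (g i))"
  using clinear_tensor_lift_on[OF assms]
  by (simp_all add: clinear_add clinear_scale clinear_sum)

lemma bilinear_on_intro:
  assumes "\<And>x x' y. x \<in> V \<Longrightarrow> x' \<in> V \<Longrightarrow> y \<in> W \<Longrightarrow> f (x + x') y = f x y + f x' y"
    and "\<And>c x y. x \<in> V \<Longrightarrow> y \<in> W \<Longrightarrow> f (c *\<^sub>C x) y = c *\<^sub>C f x y"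
    and "\<And>x y y'. x \<in> V \<Longrightarrow> y \<in> W \<Longrightarrow> y' \<in> W \<Longrightarrow> f x (y + y') = f x y + f x y'"
    and "\<And>c x y. x \<in> V \<Longrightarrow> y \<in> W \<Longrightarrow> f x (c *\<^sub>C y) = c *\<^sub>C f x y"
  shows "bilinear_on V W f"
  unfolding bilinear_on_def linear_on_def using assms by blast

section \<open>Finite-dimensional subspaces\<close>

lemma finite_dim_basis:
  assumes "finite_dim V"
  obtains B where "finite B" "complex_vector.independent B" "V = cspan B"
proof -
  obtain C where C: "finite C" "V = cspan C" using assms by (auto simp: finite_dim_def)
  obtain B where B: "B \<subseteq> C" "complex_vector.independent B" "C \<subseteq> cspan B"
    using complex_vector.maximal_independent_subset[of C] by blast
  show thesis
  proof
    show "finite B" using B(1) C(1) finite_subset by blast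
    show "V = cspan B" using complex_vector.span_minimal[OF B(3)] complex_vector.span_mono[OF B(1)] C(2)
      by (simp add: complex_vector.subspace_span)
  qed (rule B(2))
qed

text \<open>The functionals \<open>d b\<close> are linear on the whole type, and duality is demanded
  on \<open>V\<close> only; this avoids partial maps. The trace over \<open>V\<close> of an operator
  h is then the sum of d b (h b) over \<open>B\<close>.\<close>

definition dual_basis :: "'a::complex_vector set \<Rightarrow> 'a set \<Rightarrow> ('a \<Rightarrow> 'a \<Rightarrow> complex) \<Rightarrow> bool"
  where "dual_basis V B d \<longleftrightarrow> finite B \<and> B \<subseteq> V \<and> (\<forall>b. clinear (d b)) \<and>
    (\<forall>x\<in>V. x = (\<Sum>b\<in>B. d b x *\<^sub>C b)) \<and> (\<forall>b\<in>B. \<forall>c\<in>B. d b c = (if b = c then 1 else 0))"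

lemma dual_basis_exists:
  assumes "finite_dim V"
  shows "\<exists>B d. dual_basis V B d"
proof -
  obtain B where fin: "finite B" and B: "complex_vector.independent B" and V: "V = cspan B"
    by (rule finite_dim_basis[OF assms])
  have "\<forall>b. \<exists>g. clinear g \<and> (\<forall>x\<in>B. g x = (if b = x then 1 else 0 :: complex))"
    by (intro allI complex_vector.linear_independent_extend[OF B])
  from choice[OF this] obtain d where d: "\<And>b. clinear (d b)" "\<And>b x. x \<in> B \<Longrightarrow> d b x = (if b = x then 1 else 0 :: complex)"
    by blast
  have lin: "clinear (\<lambda>x. \<Sum>b\<in>B. d b x *\<^sub>C b)"
    by (simp add: clinear_iff clinear_simps[OF d(1)] scaleC_add_left sum.distrib
        complex_vector.scale_sum_right scaleC_scaleC)
  have "x = (\<Sum>b\<in>B. d b x *\<^sub>C b)" if "x \<in> V" for x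
  proof (rule complex_vector.linear_eq_on[of "\<lambda>x. x", OF _ lin])
    show "clinear (\<lambda>x::'a. x)" by (simp add: clinear_iff)
    show "x \<in> cspan B" using that V by simp
    fix y assume "y \<in> B"
    then show "y = (\<Sum>b\<in>B. d b y *\<^sub>C b)"
      using fin by (simp add: d(2) if_distrib[of "\<lambda>c. c *\<^sub>C _"] scaleC_one cong: if_cong)
  qed
  moreover have "B \<subseteq> V" unfolding V by (rule complex_vector.span_superset)
  ultimately have "dual_basis V B d" using fin d by (simp add: dual_basis_def)
  then show ?thesis by blast
qed

lemma dual_basis_expand: "dual_basis V B d \<Longrightarrow> clinear h \<Longrightarrow> x \<in> V \<Longrightarrow> h x = (\<Sum>b\<in>B. d b x *\<^sub>C h b)"
proof -
  assume a: "dual_basis V B d" "clinear h" "x \<in> V"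
  have "h x = h (\<Sum>b\<in>B. d b x *\<^sub>C b)" using a by (auto simp: dual_basis_def)
  then show ?thesis by (simp add: clinear_sum[OF a(2)] clinear_scale[OF a(2)])
qed

lemma injective_on_finite_dim_imp_surjective:
  assumes "finite_dim V" "clinear h" "h ` V \<subseteq> V" "\<And>x. x \<in> V \<Longrightarrow> h x = 0 \<Longrightarrow> x = 0"
  shows "h ` V = V"
proof -
  obtain B where fin: "finite B" and B: "complex_vector.independent B" and V: "V = cspan B"
    by (rule finite_dim_basis[OF assms(1)])
  have inj: "inj_on h (cspan B)"
    unfolding V[symmetric]
  proof (rule inj_onI)
    fix x y assume "x \<in> V" "y \<in> V" "h x = h y"
    then have "x - y \<in> V" "h (x - y) = 0"
      using V assms(2) by (auto simp: complex_vector.span_diff complex_vector.linear_diff)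
    then show "x = y" using assms(4)[of "x - y"] by simp
  qed
  have ind: "complex_vector.independent (h ` B)"
    using complex_vector.linear_independent_injective_image[OF assms(2) B inj] .
  have sub: "h ` B \<subseteq> cspan B" using assms(3) V complex_vector.span_superset[of B] by blast
  have card: "card (h ` B) = card B"
    using inj complex_vector.span_superset[of B] by (meson card_image inj_on_subset)
  have "B \<subseteq> cspan (h ` B)"
  proof (rule ccontr)
    assume "\<not> B \<subseteq> cspan (h ` B)"
    then obtain b where b: "b \<in> B" "b \<notin> cspan (h ` B)" by blast
    \<comment> \<open>Adding \<open>b\<close> to the image of \<open>B\<close> would give card B + 1
      independent vectors in the span of \<open>B\<close>.\<close>
    have "complex_vector.independent (insert b (h ` B))"
      using complex_vector.independent_insertI[OF b(2) ind] .
    moreover have "insert b (h ` B) \<subseteq> cspan B"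
      using sub b(1) complex_vector.span_base by blast
    ultimately have "card (insert b (h ` B)) \<le> card B"
      using complex_vector.independent_span_bound[OF fin] by blast
    moreover have "b \<notin> h ` B" using b(2) complex_vector.span_base by blast
    ultimately show False using card fin by simp
  qed
  then have "B \<subseteq> h ` cspan B" using complex_vector.linear_span_image[OF assms(2), of B] by simp
  then have "cspan B \<subseteq> h ` cspan B"
    by (rule complex_vector.span_minimal)
      (rule complex_vector.linear_subspace_image[OF assms(2) complex_vector.subspace_span])
  then show ?thesis using assms(3) V by blast
qed

section \<open>Components with identities\<close>

lemma clinear_lact_left: "clinear (\<lambda>m. lact m x)"
  by (simp add: clinear_iff)

lemma clinear_mult_of: "clinear mult_of"
  unfolding clinear_iff
  by (auto intro!: multiplier_eqI simp: algebra_simps scaleC_mult_left scaleC_mult_right)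

lemma clinear_mult_left: "clinear (\<lambda>x::'a::complex_algebra. a * x)"
  and clinear_mult_right: "clinear (\<lambda>x::'a::complex_algebra. x * a)"
  by (simp_all add: clinear_iff algebra_simps scaleC_mult_left scaleC_mult_right)

lemmas tens_linear_simps = tens_add_left tens_add_right tens_scale_left tens_scale_right

locale unital_cograded = group_cograded G \<Delta> A
  for G :: "('g, 'm) monoid_scheme" (structure)
    and \<Delta> :: "'a::complex_algebra \<Rightarrow> ('a, 'a) tensor multiplier"
    and A :: "'g \<Rightarrow> 'a set" +
  assumes component_finite: "p \<in> carrier G \<Longrightarrow> finite_dim (A p)"
    and component_unital: "p \<in> carrier G \<Longrightarrow> \<exists>u. is_identity (A p) u"
begin

definition un :: "'g \<Rightarrow> 'a" where "un p = identity_of (A p)"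

lemma is_identity_un: "p \<in> carrier G \<Longrightarrow> is_identity (A p) (un p)"
proof -
  assume "p \<in> carrier G"
  then obtain u where "is_identity (A p) u" using component_unital by blast
  then have "\<exists>!u. is_identity (A p) u" by (intro ex1I[of _ u]) (auto simp: is_identity_def)
  then show ?thesis unfolding un_def identity_of_def by (rule theI')
qed

context fixes p assumes p: "p \<in> carrier G" begin

lemma un_in: "un p \<in> A p"
  and un_left: "x \<in> A p \<Longrightarrow> un p * x = x"
  and un_right: "x \<in> A p \<Longrightarrow> x * un p = x"
  using is_identity_un[OF p] by (auto simp: is_identity_def)

lemmas component_0 = complex_vector.subspace_0[OF component_subspace[OF p]]
  and component_scale = complex_vector.subspace_scale[OF component_subspace[OF p]]
  and component_sum = complex_vector.subspace_sum[OF component_subspace[OF p]]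

lemma un_nonzero: "un p \<noteq> 0"
proof
  assume 0: "un p = 0"
  have "A p \<subseteq> {0}" using un_left by (auto simp: 0)
  then show False using component_nontrivial[OF p] component_0 by blast
qed

end

lemma
  assumes "p \<in> carrier G" "q \<in> carrier G" "p \<noteq> q" "x \<in> A q"
  shows un_left_other: "un p * x = 0" and un_right_other: "x * un p = 0"
  using component_orthogonal[of p q "un p" x] component_orthogonal[of q p x "un p"] assms un_in by auto

definition supp :: "'a \<Rightarrow> 'g set" where "supp a = {p \<in> carrier G. un p * a \<noteq> 0}"

lemma supp_carrier: "supp a \<subseteq> carrier G"
  by (auto simp: supp_def)

text \<open>Multiplication by 1_p, from either side, picks out the p-th summand of the direct sum
  decomposition. The identities 1_p are therefore central projections, and later decompositions are
  written with them.\<close>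

lemma
  shows un_mult_in: "p \<in> carrier G \<Longrightarrow> un p * a \<in> A p"
    and finite_supp: "finite (supp a)"
    and decomposition: "a = (\<Sum>p\<in>supp a. un p * a)"
    and un_central: "p \<in> carrier G \<Longrightarrow> a * un p = un p * a"
proof -
  obtain x where x: "\<And>p. p \<in> carrier G \<Longrightarrow> x p \<in> A p" "\<And>p. p \<notin> carrier G \<Longrightarrow> x p = 0"
    "finite {p. x p \<noteq> 0}" "a = (\<Sum>p | x p \<noteq> 0. x p)"
    using direct_sum[of a] by auto
  have c: "{p. x p \<noteq> 0} \<subseteq> carrier G" using x(2) by auto
  have l: "un p * a = x p" if p: "p \<in> carrier G" for p
  proof -
    have "un p * a = (\<Sum>q | x q \<noteq> 0. un p * x q)"
      by (subst x(4)) (rule clinear_sum[OF clinear_mult_left])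
    also have "\<dots> = (\<Sum>q | x q \<noteq> 0. if q = p then x p else 0)"
      using c x(1) un_left[OF p] un_left_other[OF p] by (intro sum.cong) auto
    also have "\<dots> = x p" using x(3) by auto
    finally show ?thesis .
  qed
  have r: "a * un p = x p" if p: "p \<in> carrier G" for p
  proof -
    have "a * un p = (\<Sum>q | x q \<noteq> 0. x q * un p)"
      by (subst x(4)) (rule clinear_sum[OF clinear_mult_right])
    also have "\<dots> = (\<Sum>q | x q \<noteq> 0. if q = p then x p else 0)"
      using c x(1) un_right[OF p] un_right_other[OF p] by (intro sum.cong) auto
    also have "\<dots> = x p" using x(3) by auto
    finally show ?thesis .
  qed
  have s: "supp a = {p. x p \<noteq> 0}" using c l by (auto simp: supp_def)
  show "p \<in> carrier G \<Longrightarrow> un p * a \<in> A p" using l x(1) by simp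
  show "finite (supp a)" using s x(3) by simp
  show "p \<in> carrier G \<Longrightarrow> a * un p = un p * a" using l r by simp
  have "(\<Sum>p\<in>supp a. un p * a) = (\<Sum>p | x p \<noteq> 0. x p)"
    unfolding s using c l by (intro sum.cong) auto
  then show "a = (\<Sum>p\<in>supp a. un p * a)" using x(4) by simp
qed

lemma component_iff: "p \<in> carrier G \<Longrightarrow> a \<in> A p \<longleftrightarrow> un p * a = a"
  using un_left un_mult_in by metis

lemma un_idem: "p \<in> carrier G \<Longrightarrow> un p * un p = un p"
  using un_in un_left by blast

lemma component_induct [case_names component add]:
  assumes "\<And>p x. p \<in> carrier G \<Longrightarrow> x \<in> A p \<Longrightarrow> P x" "\<And>x y. P x \<Longrightarrow> P y \<Longrightarrow> P (x + y)"
  shows "P a"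
proof -
  have "P (\<Sum>p\<in>F. un p * a)" if "finite F" "F \<subseteq> carrier G" for F
    using that
  proof induct
    case empty
    show ?case using assms(1)[OF one_closed component_0[OF one_closed]] by simp
  next
    case (insert p F)
    then show ?case using assms(1)[of p "un p * a"] assms(2) un_mult_in by auto
  qed
  from this[OF finite_supp supp_carrier] show ?thesis using decomposition by metis
qed

lemma tensor_component_induct [case_names component add]:
  assumes "\<And>p q x y. p \<in> carrier G \<Longrightarrow> q \<in> carrier G \<Longrightarrow> x \<in> A p \<Longrightarrow> y \<in> A q \<Longrightarrow> P (x \<otimes>\<^sub>T y)"
    "\<And>s t. P s \<Longrightarrow> P t \<Longrightarrow> P (s + t)"
  shows "P t"
proof (induct t)
  case (tens x y)
  show ?case
  proof (induct x rule: component_induct)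
    case (component p x)
    then show ?case
      by (induct y rule: component_induct) (use assms in \<open>auto simp: tens_add_right\<close>)
  qed (use assms(2) in \<open>auto simp: tens_add_left\<close>)
qed (rule assms(2))

text \<open>When \<open>carrier G\<close> is infinite, the algebra has no identity; finite sums of
  the 1_p take over its role.\<close>

lemma local_unit:
  assumes "finite F" "F \<subseteq> carrier G" "supp a \<subseteq> F"
  shows "a * (\<Sum>p\<in>F. un p) = a" and "(\<Sum>p\<in>F. un p) * a = a"
proof -
  have "(\<Sum>p\<in>F. un p) * a = (\<Sum>p\<in>F. un p * a)" by (rule clinear_sum[OF clinear_mult_right])
  also have "\<dots> = (\<Sum>p\<in>supp a. un p * a)"
    using assms by (intro sum.mono_neutral_right) (auto simp: supp_def)
  finally show l: "(\<Sum>p\<in>F. un p) * a = a" using decomposition by metis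
  have "a * (\<Sum>p\<in>F. un p) = (\<Sum>p\<in>F. a * un p)" by (rule clinear_sum[OF clinear_mult_left])
  also have "\<dots> = (\<Sum>p\<in>F. un p * a)" using assms(2) un_central by (intro sum.cong) auto
  also have "\<dots> = (\<Sum>p\<in>F. un p) * a" by (rule clinear_sum[OF clinear_mult_right, symmetric])
  finally show "a * (\<Sum>p\<in>F. un p) = a" using l by simp
qed

text \<open>The bound holds for every finite set containing \<open>F\<close>, so that in the
  induction the local units of two summands can be replaced by a common one.\<close>

lemma tensor_local_unit:
  "\<exists>F. finite F \<and> F \<subseteq> carrier G \<and> (\<forall>F'. finite F' \<longrightarrow> F' \<subseteq> carrier G \<longrightarrow> F \<subseteq> F' \<longrightarrow>
    t * ((\<Sum>p\<in>F'. un p) \<otimes>\<^sub>T (\<Sum>p\<in>F'. un p)) = t)"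
proof (induct t)
  case (tens x y)
  show ?case using finite_supp supp_carrier local_unit
    by (intro exI[of _ "supp x \<union> supp y"]) (auto simp: times_tensor_tens)
next
  case (add s t)
  then obtain F1 F2 where "finite F1" "F1 \<subseteq> carrier G" "finite F2" "F2 \<subseteq> carrier G"
    "\<forall>F'. finite F' \<longrightarrow> F' \<subseteq> carrier G \<longrightarrow> F1 \<subseteq> F' \<longrightarrow> s * ((\<Sum>p\<in>F'. un p) \<otimes>\<^sub>T (\<Sum>p\<in>F'. un p)) = s"
    "\<forall>F'. finite F' \<longrightarrow> F' \<subseteq> carrier G \<longrightarrow> F2 \<subseteq> F' \<longrightarrow> t * ((\<Sum>p\<in>F'. un p) \<otimes>\<^sub>T (\<Sum>p\<in>F'. un p)) = t"
    by blast
  then show ?case by (intro exI[of _ "F1 \<union> F2"]) (auto simp: distrib_right)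
qed

lemma tens_sum_left: "sum f I \<otimes>\<^sub>T y = (\<Sum>i\<in>I. f i \<otimes>\<^sub>T y)"
  by (rule clinear_sum[of "\<lambda>x. x \<otimes>\<^sub>T y"]) (simp add: clinear_iff tens_linear_simps)

lemma tens_sum_right: "x \<otimes>\<^sub>T sum f I = (\<Sum>i\<in>I. x \<otimes>\<^sub>T f i)"
  by (rule clinear_sum[of "\<lambda>y. x \<otimes>\<^sub>T y"]) (simp add: clinear_iff tens_linear_simps)

text \<open>A local unit of \<open>s - t\<close> is a finite sum of the elements 1_p \<otimes> 1_q,
  each of which annihilates the difference.\<close>

lemma tensor_eqI:
  assumes "\<And>p q. p \<in> carrier G \<Longrightarrow> q \<in> carrier G \<Longrightarrow> s * (un p \<otimes>\<^sub>T un q) = t * (un p \<otimes>\<^sub>T un q)"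
  shows "s = t"
proof -
  obtain F where F: "finite F" "F \<subseteq> carrier G"
    "(s - t) * ((\<Sum>p\<in>F. un p) \<otimes>\<^sub>T (\<Sum>p\<in>F. un p)) = s - t"
    using tensor_local_unit[of "s - t"] by blast
  have "(s - t) * (\<Sum>q\<in>F. \<Sum>p\<in>F. un p \<otimes>\<^sub>T un q) = (\<Sum>q\<in>F. \<Sum>p\<in>F. (s - t) * (un p \<otimes>\<^sub>T un q))"
    by (simp add: clinear_sum[OF clinear_mult_left])
  also have "\<dots> = 0"
  proof (intro sum.neutral ballI)
    fix p q assume "p \<in> F" "q \<in> F"
    then have "s * (un p \<otimes>\<^sub>T un q) = t * (un p \<otimes>\<^sub>T un q)" using assms F(2) by auto
    then show "(s - t) * (un p \<otimes>\<^sub>T un q) = 0" by (simp add: left_diff_distrib)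
  qed
  finally have "s - t = 0" using F(3) by (simp add: tens_sum_left tens_sum_right)
  then show ?thesis by simp
qed

lemma inj_mult_of: "inj (mult_of :: 'a \<Rightarrow> _)"
proof (rule injI)
  fix x y :: 'a assume "mult_of x = mult_of y"
  then have "x * b = y * b" for b by (metis lact_mult_of)
  then have "\<forall>b. (x - y) * b = 0" by (simp add: left_diff_distrib)
  then show "x = y" using nondegenerate unfolding nondegenerate_def by (metis right_minus_eq)
qed

lemma inj_mult_of_tensor: "inj (mult_of :: ('a, 'a) tensor \<Rightarrow> _)"
proof (rule injI)
  fix x y :: "('a, 'a) tensor" assume "mult_of x = mult_of y"
  then have "x * b = y * b" for b by (metis lact_mult_of)
  then show "x = y" by (metis tensor_eqI)
qed

lemma alg_of_mult_of [simp]: "alg_of (mult_of x) = (x :: 'a)"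
  unfolding alg_of_def by (rule the_inv_f_f[OF inj_mult_of])

lemma alg_of_mult_of_tensor [simp]: "alg_of (mult_of x) = (x :: ('a, 'a) tensor)"
  unfolding alg_of_def by (rule the_inv_f_f[OF inj_mult_of_tensor])

lemma un_tens_central:
  assumes "p \<in> carrier G" "q \<in> carrier G"
  shows "t * (un p \<otimes>\<^sub>T un q) = (un p \<otimes>\<^sub>T un q) * t"
  by (induct t) (simp_all add: times_tensor_tens un_central assms distrib_left distrib_right)

lemma tensor_span_restrict:
  assumes "p \<in> carrier G" "q \<in> carrier G" "t \<in> A p \<otimes>\<^sub>S A q"
  shows "t * (un p \<otimes>\<^sub>T un q) = t" and "(un p \<otimes>\<^sub>T un q) * t = t"
proof -
  show "t * (un p \<otimes>\<^sub>T un q) = t"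
    by (rule linear_eq_on_tensor_span[where g = "\<lambda>t. t", OF clinear_mult_right _ _ assms(3)])
      (simp_all add: clinear_iff times_tensor_tens un_right assms)
  then show "(un p \<otimes>\<^sub>T un q) * t = t" using un_tens_central assms by simp
qed

lemma tensor_span_restrict_other:
  assumes "p \<in> carrier G" "q \<in> carrier G" "p' \<in> carrier G" "q' \<in> carrier G"
    "p \<noteq> p' \<or> q \<noteq> q'" "t \<in> A p \<otimes>\<^sub>S A q"
  shows "t * (un p' \<otimes>\<^sub>T un q') = 0"
proof (rule linear_eq_on_tensor_span[where g = "\<lambda>t. 0", OF clinear_mult_right _ _ assms(6)])
  fix x y assume "x \<in> A p" "y \<in> A q"
  then have "x * un p' = 0 \<or> y * un q' = 0"
    using assms(1-5) un_right_other[of p' p x] un_right_other[of q' q y] by blast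
  then show "(x \<otimes>\<^sub>T y) * (un p' \<otimes>\<^sub>T un q') = 0" by (auto simp: times_tensor_tens)
qed (simp add: clinear_iff)

text \<open>Turns membership into an equation, which is stable under linear maps and
  products.\<close>

lemma tensor_span_iff:
  assumes "p \<in> carrier G" "q \<in> carrier G"
  shows "t \<in> A p \<otimes>\<^sub>S A q \<longleftrightarrow> t * (un p \<otimes>\<^sub>T un q) = t"
proof
  show "t \<in> A p \<otimes>\<^sub>S A q \<Longrightarrow> t * (un p \<otimes>\<^sub>T un q) = t" using tensor_span_restrict assms by blast
  have "t * (un p \<otimes>\<^sub>T un q) \<in> A p \<otimes>\<^sub>S A q"
  proof (induct t)
    case (tens x y)
    show ?case using assms by (simp add: times_tensor_tens un_central un_mult_in tensor_span_I)
  next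
    case (add s t)
    then show ?case
      by (simp add: distrib_right complex_vector.subspace_add[OF csubspace_tensor_span])
  qed
  then show "t * (un p \<otimes>\<^sub>T un q) = t \<Longrightarrow> t \<in> A p \<otimes>\<^sub>S A q" by simp
qed

text \<open>The linear map on the whole algebra with prescribed restrictions \<open>h p\<close> to
  the components. The antipode and the left integral are built in this way.\<close>

definition glue :: "('g \<Rightarrow> 'a \<Rightarrow> 'b::complex_vector) \<Rightarrow> 'a \<Rightarrow> 'b"
  where "glue h x = (\<Sum>p\<in>supp x. h p (un p * x))"

lemma
  assumes h: "\<And>p. p \<in> carrier G \<Longrightarrow> clinear (h p)"
  shows clinear_glue: "clinear (glue h)"
    and glue_component: "p \<in> carrier G \<Longrightarrow> x \<in> A p \<Longrightarrow> glue h x = h p x"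
proof -
  have sum: "glue h x = (\<Sum>p\<in>F. h p (un p * x))"
    if "finite F" "F \<subseteq> carrier G" "supp x \<subseteq> F" for F x
    unfolding glue_def using that clinear_0[OF h]
    by (intro sum.mono_neutral_left) (auto simp: supp_def)
  have "glue h (x + y) = glue h x + glue h y" for x y
  proof -
    let ?F = "supp x \<union> supp y"
    have F: "finite ?F" "?F \<subseteq> carrier G" "supp x \<subseteq> ?F" "supp y \<subseteq> ?F" "supp (x + y) \<subseteq> ?F"
      using finite_supp supp_carrier by (auto simp: supp_def distrib_left)
    have "h p (un p * (x + y)) = h p (un p * x) + h p (un p * y)" if "p \<in> ?F" for p
      using subsetD[OF F(2) that] by (simp add: clinear_add[OF h] distrib_left)
    then show ?thesis using F by (simp add: sum[of ?F] sum.distrib)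
  qed
  moreover have "glue h (c *\<^sub>C x) = c *\<^sub>C glue h x" for c x
  proof -
    have F: "finite (supp x)" "supp x \<subseteq> carrier G" "supp (c *\<^sub>C x) \<subseteq> supp x"
      using finite_supp supp_carrier by (auto simp: supp_def scaleC_mult_right)
    have "h p (un p * (c *\<^sub>C x)) = c *\<^sub>C h p (un p * x)" if "p \<in> supp x" for p
      using subsetD[OF F(2) that] by (simp add: clinear_scale[OF h] scaleC_mult_right)
    then show ?thesis using F by (simp add: sum[of "supp x"] complex_vector.scale_sum_right)
  qed
  ultimately show "clinear (glue h)" by (simp add: clinear_iff)
  assume p: "p \<in> carrier G" and x: "x \<in> A p"
  have "supp x \<subseteq> {p}" using p x un_left_other by (auto simp: supp_def)
  then show "glue h x = h p x" using sum[of "{p}" x] p x by (simp add: un_left)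
qed

subsection \<open>The components of the coproduct\<close>

text \<open>Letting the multiplier \<Delta>(a) act on the identity 1_p \<otimes> 1_q of A_p
  \<otimes> A_q yields its (p,q)-component as a tensor. It is formed for all \<open>a\<close>, so
  that \<open>cop p q\<close> is linear on the whole algebra.\<close>

definition cop :: "'g \<Rightarrow> 'g \<Rightarrow> 'a \<Rightarrow> ('a, 'a) tensor"
  where "cop p q a = lact (\<Delta> a) (un p \<otimes>\<^sub>T un q)"

lemma clinear_cop: "clinear (cop p q)"
  using comult_linear by (simp add: cop_def clinear_iff)

lemma lact_comult:
  assumes "p \<in> carrier G" "q \<in> carrier G" "t \<in> A p \<otimes>\<^sub>S A q"
  shows "lact (\<Delta> a) t = cop p q a * t"
  using lact_mult[of "\<Delta> a" "un p \<otimes>\<^sub>T un q" t]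
  by (simp only: tensor_span_restrict(2)[OF assms] cop_def)

context
  fixes p q assumes pq [simp]: "p \<in> carrier G" "q \<in> carrier G"
begin

lemma un_tens_idem: "(un p \<otimes>\<^sub>T un q) * (un p \<otimes>\<^sub>T un q) = un p \<otimes>\<^sub>T un q"
  by (simp add: times_tensor_tens un_idem)

lemma cop_mult_un: "cop p q a * (un p \<otimes>\<^sub>T un q) = cop p q a"
  by (simp add: cop_def lact_mult[symmetric] un_tens_idem)

lemma un_mult_cop: "(un p \<otimes>\<^sub>T un q) * cop p q a = cop p q a"
  using cop_mult_un un_tens_central by simp

lemma cop_in: "cop p q a \<in> A p \<otimes>\<^sub>S A q"
  using cop_mult_un by (simp add: tensor_span_iff)

text \<open>Centrality of 1_p \<otimes> 1_q together with the multiplier law x(my) = (xm)y makes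
  cutting from the left and from the right agree.\<close>

lemma ract_un: "ract (un p \<otimes>\<^sub>T un q) (\<Delta> a) = cop p q a"
proof -
  let ?e = "un p \<otimes>\<^sub>T un q"
  have "ract ?e (\<Delta> a) = ?e * ract ?e (\<Delta> a)" by (metis ract_mult un_tens_idem)
  also have "\<dots> = ract ?e (\<Delta> a) * ?e" by (simp add: un_tens_central)
  also have "\<dots> = cop p q a" by (simp add: mult_lact[symmetric] cop_def[symmetric] un_mult_cop)
  finally show ?thesis .
qed

lemma ract_comult: "t \<in> A p \<otimes>\<^sub>S A q \<Longrightarrow> ract t (\<Delta> a) = t * cop p q a"
  using tensor_span_restrict(1)[OF pq, of t] ract_mult[of t "un p \<otimes>\<^sub>T un q" "\<Delta> a"] by (simp add: ract_un)

lemma cop_times: "cop p q (a * b) = cop p q a * cop p q b"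
proof -
  have "cop p q (a * b) = lact (\<Delta> a) (cop p q b)" by (simp add: cop_def comult_mult)
  then show ?thesis using lact_comult[OF pq cop_in] by simp
qed

lemma right_cov_restrict: "right_cov \<Delta> a b * (un p \<otimes>\<^sub>T un q) = cop p q a * (un p \<otimes>\<^sub>T b)"
proof -
  obtain t where t: "\<Delta> a * (1 \<otimes>\<^sub>M mult_of b) = mult_of t" using right_cov[of a b] by blast
  then have "right_cov \<Delta> a b = t" by (simp add: right_cov_def)
  then have "right_cov \<Delta> a b * (un p \<otimes>\<^sub>T un q) = lact (\<Delta> a * (1 \<otimes>\<^sub>M mult_of b)) (un p \<otimes>\<^sub>T un q)"
    by (simp add: t)
  also have "\<dots> = lact (\<Delta> a) ((un p \<otimes>\<^sub>T un q) * (un p \<otimes>\<^sub>T b))"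
    by (simp add: lact_multiplier_tens times_tensor_tens un_idem un_central[OF pq(2), of b])
  finally show ?thesis by (simp only: lact_mult cop_def)
qed

lemma left_cov_restrict: "left_cov \<Delta> a b * (un p \<otimes>\<^sub>T un q) = (a \<otimes>\<^sub>T un q) * cop p q b"
proof -
  obtain t where t: "(mult_of a \<otimes>\<^sub>M 1) * \<Delta> b = mult_of t" using left_cov[of a b] by blast
  then have "left_cov \<Delta> a b = t" by (simp add: left_cov_def)
  then have "left_cov \<Delta> a b * (un p \<otimes>\<^sub>T un q) = lact ((mult_of a \<otimes>\<^sub>M 1) * \<Delta> b) (un p \<otimes>\<^sub>T un q)"
    by (simp add: t)
  also have "\<dots> = lact (mult_of a \<otimes>\<^sub>M 1) ((un p \<otimes>\<^sub>T un q) * cop p q b)"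
    by (simp add: cop_def[symmetric] un_mult_cop)
  also have "\<dots> = ((a * un p) \<otimes>\<^sub>T un q) * cop p q b"
    by (simp add: lact_mult lact_multiplier_tens)
  also have "((a * un p) \<otimes>\<^sub>T un q) = (a \<otimes>\<^sub>T un q) * (un p \<otimes>\<^sub>T un q)" by (simp add: times_tensor_tens un_idem)
  finally show ?thesis by (simp add: mult.assoc un_mult_cop)
qed

lemma right_cov_in: "a \<in> A (p \<otimes> q) \<Longrightarrow> b \<in> A q \<Longrightarrow> right_cov \<Delta> a b \<in> A p \<otimes>\<^sub>S A q"
  unfolding right_cov_component[OF pq, symmetric] by (rule complex_vector.span_base) blast

lemma left_cov_in: "a \<in> A p \<Longrightarrow> b \<in> A (p \<otimes> q) \<Longrightarrow> left_cov \<Delta> a b \<in> A p \<otimes>\<^sub>S A q"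
  unfolding left_cov_component[OF pq, symmetric] by (rule complex_vector.span_base) blast

lemma right_cov_eq: "a \<in> A (p \<otimes> q) \<Longrightarrow> b \<in> A q \<Longrightarrow> right_cov \<Delta> a b = cop p q a * (un p \<otimes>\<^sub>T b)"
  using right_cov_in[of a b] tensor_span_restrict(1)[OF pq, of "right_cov \<Delta> a b"] right_cov_restrict[of a b] by argo

lemma left_cov_eq: "a \<in> A p \<Longrightarrow> b \<in> A (p \<otimes> q) \<Longrightarrow> left_cov \<Delta> a b = (a \<otimes>\<^sub>T un q) * cop p q b"
  using left_cov_in[of a b] tensor_span_restrict(1)[OF pq, of "left_cov \<Delta> a b"] left_cov_restrict[of a b] by argo

end

context
  fixes p q assumes pq [simp]: "p \<in> carrier G" "q \<in> carrier G"
begin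

text \<open>The cograding places \<open>right_cov \<Delta> a (un q)\<close> in the component with
  first index r q^-1, and this index differs from p.\<close>

lemma cop_other:
  assumes "r \<in> carrier G" "a \<in> A r" "r \<noteq> p \<otimes> q"
  shows "cop p q a = 0"
proof -
  have 1: "r = (r \<otimes> inv q) \<otimes> q" using assms by (simp add: m_assoc)
  then have 2: "p \<noteq> r \<otimes> inv q" using assms(3) by blast
  have "right_cov \<Delta> a (un q) \<in> A (r \<otimes> inv q) \<otimes>\<^sub>S A q"
    using right_cov_in[of "r \<otimes> inv q" q a "un q"] 1 assms(1,2) un_in by simp
  then have "right_cov \<Delta> a (un q) * (un p \<otimes>\<^sub>T un q) = 0"
    using tensor_span_restrict_other[of "r \<otimes> inv q" q p q] 2 assms(1) by simp
  then show ?thesis by (simp add: right_cov_restrict cop_mult_un)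
qed

text \<open>By multiplicativity, \<Delta>_{p,q}(1_{pq}) fixes every \<Delta>(a)(1 \<otimes> b) with
  a in A_{pq} and b in A_q; these span A_p \<otimes> A_q, which contains 1_p \<otimes> 1_q.\<close>

lemma cop_un: "cop p q (un (p \<otimes> q)) = un p \<otimes>\<^sub>T un q"
proof -
  have r: "p \<otimes> q \<in> carrier G" by simp
  have 1: "cop p q (un (p \<otimes> q)) * t = t" if "t \<in> A p \<otimes>\<^sub>S A q" for t
  proof (rule complex_vector.linear_eq_on[of "\<lambda>t. cop p q (un (p \<otimes> q)) * t" "\<lambda>t. t"])
    show "t \<in> cspan {right_cov \<Delta> a b |a b. a \<in> A (p \<otimes> q) \<and> b \<in> A q}"
      using that right_cov_component[OF pq] by simp
    fix s assume "s \<in> {right_cov \<Delta> a b |a b. a \<in> A (p \<otimes> q) \<and> b \<in> A q}"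
    then obtain a b where ab: "a \<in> A (p \<otimes> q)" "b \<in> A q" "s = right_cov \<Delta> a b" by blast
    have "cop p q (un (p \<otimes> q)) * s = cop p q (un (p \<otimes> q) * a) * (un p \<otimes>\<^sub>T b)"
      using ab by (simp add: right_cov_eq[OF pq] mult.assoc[symmetric] cop_times[OF pq])
    then show "cop p q (un (p \<otimes> q)) * s = s" using ab by (simp add: right_cov_eq[OF pq] un_left[OF r])
  qed (simp_all add: clinear_iff distrib_left scaleC_mult_right)
  show ?thesis
    using 1[OF tensor_span_I[OF un_in[OF pq(1)] un_in[OF pq(2)]]] by (simp only: cop_mult_un[OF pq])
qed

lemma cop_restrict: "cop p q (a * un (p \<otimes> q)) = cop p q a"
  by (simp add: cop_times cop_un cop_mult_un)

end

text \<open>The coassociativity axiom is taken with outer arguments 1_p and 1_r, which turns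
  \<open>right_cov\<close> and \<open>left_cov\<close> into components of the coproduct. Both
  multipliers are then evaluated at 1_p \<otimes> 1_q \<otimes> 1_r.\<close>

lemma cop_coassoc:
  assumes [simp]: "p \<in> carrier G" "q \<in> carrier G" "r \<in> carrier G"
  shows "tensor_assoc (tsum (cop (p \<otimes> q) r a) (\<lambda>w z. cop p q w \<otimes>\<^sub>T z))
    = tsum (cop p (q \<otimes> r) a) (\<lambda>x w. x \<otimes>\<^sub>T cop q r w)"
proof -
  \<comment> \<open>Both sides depend only on the component of \<open>a\<close> in A_{pqr}, and for
    this component \<open>right_cov\<close> and \<open>left_cov\<close> reduce to a single component
    of the coproduct.\<close>
  define a' where "a' = a * un (p \<otimes> q \<otimes> r)"
  have a': "a' \<in> A (p \<otimes> q \<otimes> r)" "a' \<in> A (p \<otimes> (q \<otimes> r))"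
    by (simp_all add: a'_def un_central un_mult_in m_assoc)
  have cop: "cop (p \<otimes> q) r a' = cop (p \<otimes> q) r a" "cop p (q \<otimes> r) a' = cop p (q \<otimes> r) a"
    unfolding a'_def using cop_restrict[of "p \<otimes> q" r a] cop_restrict[of p "q \<otimes> r" a]
    by (simp_all add: m_assoc)
  have rc: "right_cov \<Delta> a' (un r) = cop (p \<otimes> q) r a"
    using right_cov_eq[OF _ _ a'(1) un_in[of r]] by (simp add: cop_mult_un cop)
  have lc: "left_cov \<Delta> (un p) a' = cop p (q \<otimes> r) a"
    using left_cov_eq[OF _ _ un_in[of p] a'(2)] by (simp add: un_mult_cop cop)
  let ?u = "(un p \<otimes>\<^sub>T un q) \<otimes>\<^sub>T un r"
  have bm: "(m + m') \<otimes>\<^sub>M n = m \<otimes>\<^sub>M n + m' \<otimes>\<^sub>M n" "m \<otimes>\<^sub>M (n + n') = m \<otimes>\<^sub>M n + m \<otimes>\<^sub>M n'"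
    "(c *\<^sub>C m) \<otimes>\<^sub>M n = c *\<^sub>C (m \<otimes>\<^sub>M n)" "m \<otimes>\<^sub>M (c *\<^sub>C n) = c *\<^sub>C (m \<otimes>\<^sub>M n)"
    for m m' :: "'x::complex_algebra multiplier" and n n' :: "'y::complex_algebra multiplier" and c
    by (simp_all add: bilinear_multiplier_tens[unfolded bilinear_iff])
  have b1: "bilinear (\<lambda>x (y::'a). \<Delta> x \<otimes>\<^sub>M mult_of y)" "bilinear (\<lambda>(x::'a) y. mult_of x \<otimes>\<^sub>M \<Delta> y)"
    using comult_linear clinear_mult_of[where 'a='a] by (simp_all add: bilinear_iff clinear_iff bm)
  have b2: "bilinear (\<lambda>w z. cop p q w \<otimes>\<^sub>T z)" "bilinear (\<lambda>w z. z \<otimes>\<^sub>T cop q r w)"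
     "bilinear (\<lambda>z w. z \<otimes>\<^sub>T cop q r w)"
    by (simp_all add: bilinear_iff clinear_simps[OF clinear_cop] tens_linear_simps)
  have "lact (transport_multiplier tensor_assoc
         (((mult_of (un p) \<otimes>\<^sub>M 1) \<otimes>\<^sub>M 1) * tensor_lift (\<lambda>x y. \<Delta> x \<otimes>\<^sub>M mult_of y) (right_cov \<Delta> a' (un r)))) (tensor_assoc ?u)
    = tensor_assoc (lact ((mult_of (un p) \<otimes>\<^sub>M 1) \<otimes>\<^sub>M 1)
        (lact (tsum (cop (p \<otimes> q) r a) (\<lambda>x y. \<Delta> x \<otimes>\<^sub>M mult_of y)) ?u))"
    by (simp add: transport_multiplier(1)[OF clinear_tensor_assoc bij_tensor_assoc tensor_assoc_mult]
        rc tsum_eq_lift[OF b1(1)])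
  also have "\<dots> = tensor_assoc (tsum (cop (p \<otimes> q) r a)
      (\<lambda>w z. lact (mult_of (un p) \<otimes>\<^sub>M 1) (cop p q w) \<otimes>\<^sub>T (z * un r)))"
    by (simp add: tsum_linear[OF clinear_lact_left] tsum_linear[OF lact_linear] lact_multiplier_tens cop_def)
  also have "\<dots> = tensor_assoc (tsum (cop (p \<otimes> q) r a) (\<lambda>w z. cop p q w \<otimes>\<^sub>T (z * un r)))"
  proof -
    have "lact (mult_of (un p) \<otimes>\<^sub>M 1) (cop p q w) = cop p q w" for w
      using lact_mult[of "mult_of (un p) \<otimes>\<^sub>M 1" "un p \<otimes>\<^sub>T un q" "cop p q w"]
      by (simp add: un_mult_cop lact_multiplier_tens un_idem)
    then show ?thesis by simp
  qed
  also have "\<dots> = tensor_assoc (tsum (cop (p \<otimes> q) r a * (un (p \<otimes> q) \<otimes>\<^sub>T un r)) (\<lambda>w z. cop p q w \<otimes>\<^sub>T z))"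
  proof -
    have "tsum (un (p \<otimes> q) \<otimes>\<^sub>T un r) (\<lambda>u v. cop p q (x * u) \<otimes>\<^sub>T (y * v)) = cop p q x \<otimes>\<^sub>T (y * un r)" for x y
      by (subst tsum_of_tens)
       (simp_all add: bilinear_iff distrib_left scaleC_mult_right clinear_simps[OF clinear_cop] tens_linear_simps cop_restrict)
    then show ?thesis by (simp add: tsum_times[OF b2(1)])
  qed
  also have "\<dots> = tensor_assoc (tsum (cop (p \<otimes> q) r a) (\<lambda>w z. cop p q w \<otimes>\<^sub>T z))"
    by (simp add: cop_mult_un)
  finally have L: "lact (transport_multiplier tensor_assoc
         (((mult_of (un p) \<otimes>\<^sub>M 1) \<otimes>\<^sub>M 1) * tensor_lift (\<lambda>x y. \<Delta> x \<otimes>\<^sub>M mult_of y) (right_cov \<Delta> a' (un r)))) (tensor_assoc ?u)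
    = tensor_assoc (tsum (cop (p \<otimes> q) r a) (\<lambda>w z. cop p q w \<otimes>\<^sub>T z))" .
  have "lact (tensor_lift (\<lambda>x y. mult_of x \<otimes>\<^sub>M \<Delta> y) (left_cov \<Delta> (un p) a') * (1 \<otimes>\<^sub>M (1 \<otimes>\<^sub>M mult_of (un r)))) (tensor_assoc ?u)
    = lact (tsum (cop p (q \<otimes> r) a) (\<lambda>x y. mult_of x \<otimes>\<^sub>M \<Delta> y)) (un p \<otimes>\<^sub>T (un q \<otimes>\<^sub>T un r))"
    by (simp add: lc tsum_eq_lift[OF b1(2)] tensor_assoc_tens lact_multiplier_tens un_idem)
  also have "\<dots> = tsum (cop p (q \<otimes> r) a) (\<lambda>x w. (x * un p) \<otimes>\<^sub>T cop q r w)"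
    by (simp add: tsum_linear[OF clinear_lact_left] lact_multiplier_tens cop_def)
  also have "\<dots> = tsum (cop p (q \<otimes> r) a * (un p \<otimes>\<^sub>T un (q \<otimes> r))) (\<lambda>x w. x \<otimes>\<^sub>T cop q r w)"
  proof -
    have "tsum (un p \<otimes>\<^sub>T un (q \<otimes> r)) (\<lambda>u v. (x * u) \<otimes>\<^sub>T cop q r (y * v)) = (x * un p) \<otimes>\<^sub>T cop q r y" for x y
      by (subst tsum_of_tens)
       (simp_all add: bilinear_iff distrib_left scaleC_mult_right clinear_simps[OF clinear_cop] tens_linear_simps cop_restrict)
    then show ?thesis by (simp add: tsum_times[OF b2(3)])
  qed
  also have "\<dots> = tsum (cop p (q \<otimes> r) a) (\<lambda>x w. x \<otimes>\<^sub>T cop q r w)"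
    by (simp add: cop_mult_un)
  finally show ?thesis using L coassoc[of "un p" a' "un r"] by simp
qed

text \<open>\<open>sw p q a f\<close> is \<open>\<Sum> f(a\<^sub>1, a\<^sub>2)\<close>, where \<open>a\<^sub>1 \<otimes> a\<^sub>2\<close> stands for \<open>\<Delta>\<^sub>p\<^sub>,\<^sub>q(a)\<close>. It is zero on all
  components other than \<open>A\<^sub>p\<^sub>q\<close>.\<close>

abbreviation sw :: "'g \<Rightarrow> 'g \<Rightarrow> 'a \<Rightarrow> ('a \<Rightarrow> 'a \<Rightarrow> 'b::complex_vector) \<Rightarrow> 'b"
  where "sw p q a \<equiv> tsum (cop p q a)"

lemmas cop_add = clinear_add[OF clinear_cop] and cop_scale = clinear_scale[OF clinear_cop]

lemma
  assumes "bilinear f"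
  shows sw_add: "sw p q (a + b) f = sw p q a f + sw p q b f"
    and sw_scale: "sw p q (c *\<^sub>C a) f = c *\<^sub>C sw p q a f"
  using assms by (simp_all add: cop_add cop_scale tsum_plus_tensor tsum_scale_tensor)

lemmas sw_linear = sw_add sw_scale

lemma clinear_tsum: "bilinear f \<Longrightarrow> clinear (\<lambda>t. tsum t f)"
  by (simp add: clinear_iff tsum_plus_tensor tsum_scale_tensor)

text \<open>The chosen representation of \<open>t\<close> may use factors outside \<open>V\<close>
  and \<open>W\<close>. Bilinearity of both \<open>f\<close> and \<open>g\<close> is what permits
  passing to one whose factors lie inside.\<close>

lemma tsum_cong:
  assumes "t \<in> V \<otimes>\<^sub>S W" "bilinear f" "bilinear g" "\<And>x y. x \<in> V \<Longrightarrow> y \<in> W \<Longrightarrow> f x y = g x y"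
  shows "tsum t f = tsum t g"
  by (rule linear_eq_on_tensor_span[OF clinear_tsum clinear_tsum _ assms(1)])
    (simp_all add: assms tsum_of_tens)

lemma sw_cong:
  assumes "p \<in> carrier G" "q \<in> carrier G" "bilinear f" "bilinear g"
    "\<And>x y. x \<in> A p \<Longrightarrow> y \<in> A q \<Longrightarrow> f x y = g x y"
  shows "sw p q a f = sw p q a g"
  by (rule tsum_cong[OF cop_in[OF assms(1,2)] assms(3-5)])

lemma sw_times:
  assumes "p \<in> carrier G" "q \<in> carrier G" "bilinear f"
  shows "sw p q (a * b) f =
    sw p q a (\<lambda>x y. sw p q b (\<lambda>u v. f (x * u) (y * v)))"
  using assms by (simp add: cop_times tsum_times)

lemma sw_un:
  assumes "p \<in> carrier G" "q \<in> carrier G" "bilinear f"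
  shows "sw p q (un (p \<otimes> q)) f = f (un p) (un q)"
  using assms by (simp add: cop_un tsum_of_tens)

lemma sw_coassoc:
  assumes "p \<in> carrier G" "q \<in> carrier G" "r \<in> carrier G" and f: "trilinear f"
  shows "sw (p \<otimes> q) r a (\<lambda>w z. sw p q w (\<lambda>x y. f x y z))
    = sw p (q \<otimes> r) a (\<lambda>x w. sw q r w (\<lambda>y z. f x y z))"
proof -
  note fb = f[unfolded trilinear_iff]
  have f1: "f (x + x') = (\<lambda>y z. f x y z + f x' y z)" "f (c *\<^sub>C x) = (\<lambda>y z. c *\<^sub>C f x y z)" for x x' c
    by (simp_all add: fun_eq_iff fb)
  have b: "bilinear (f x)" "bilinear (\<lambda>x y. f x y z)" for x z
    using f by (auto simp: trilinear_def)
  have b2: "bilinear (\<lambda>x s. tsum s (f x))"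
    by (simp add: bilinear_iff f1 tsum_linear_tensor[OF b(1)])
  let ?H = "\<lambda>t. tsum t (\<lambda>x s. tsum s (f x))"
  have H: "clinear ?H" by (rule clinear_tsum[OF b2])
  have assoc: "tensor_assoc (s \<otimes>\<^sub>T z) = tsum s (\<lambda>x y. x \<otimes>\<^sub>T (y \<otimes>\<^sub>T z))" for s :: "('a, 'a) tensor" and z :: 'a
  proof -
    have "s \<otimes>\<^sub>T z = tsum s (\<lambda>x y. (x \<otimes>\<^sub>T y) \<otimes>\<^sub>T z)"
      using tsum_linear[of "\<lambda>s. s \<otimes>\<^sub>T z" s "(\<otimes>\<^sub>T)"] by (simp add: tsum_tens clinear_iff tens_linear_simps)
    then show ?thesis by (simp add: tsum_linear[OF clinear_tensor_assoc] tensor_assoc_tens)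
  qed
  have "?H (tensor_assoc (sw (p \<otimes> q) r a (\<lambda>w z. cop p q w \<otimes>\<^sub>T z)))
    = sw (p \<otimes> q) r a (\<lambda>w z. sw p q w (\<lambda>x y. f x y z))"
    by (simp add: tsum_linear[OF clinear_tensor_assoc] assoc tsum_linear[OF H] tsum_of_tens[OF b2] tsum_of_tens[OF b(1)])
  moreover have "?H (sw p (q \<otimes> r) a (\<lambda>x w. x \<otimes>\<^sub>T cop q r w))
    = sw p (q \<otimes> r) a (\<lambda>x w. sw q r w (\<lambda>y z. f x y z))"
    by (simp add: tsum_linear[OF H] tsum_of_tens[OF b2])
  ultimately show ?thesis using cop_coassoc[OF assms(1-3), of a] by simp
qed

lemma bilinear_right_cov: "bilinear (right_cov \<Delta>)"
  unfolding bilinear_iff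
  by (intro conjI allI; rule tensor_eqI)
    (simp_all add: distrib_left distrib_right scaleC_mult_left scaleC_mult_right right_cov_restrict cop_add cop_scale tens_linear_simps)

lemma bilinear_left_cov: "bilinear (left_cov \<Delta>)"
  unfolding bilinear_iff
  by (intro conjI allI; rule tensor_eqI)
    (simp_all add: distrib_left distrib_right scaleC_mult_left scaleC_mult_right left_cov_restrict cop_add cop_scale tens_linear_simps)

section \<open>The Galois map T: a \<otimes> b \<mapsto> \<Delta>(a)(1 \<otimes> b) and its
  inverse\<close>

definition galois :: "('a, 'a) tensor \<Rightarrow> ('a, 'a) tensor"
  where "galois = tensor_lift (right_cov \<Delta>)"

definition galois_inv :: "('a, 'a) tensor \<Rightarrow> ('a, 'a) tensor"
  where "galois_inv = inv_into UNIV galois"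

lemma galois_tens: "galois (a \<otimes>\<^sub>T b) = right_cov \<Delta> a b"
  by (simp add: galois_def tensor_lift bilinear_right_cov)

lemma clinear_galois: "clinear galois"
  unfolding galois_def by (rule clinear_tensor_lift[OF bilinear_right_cov])

lemma galois_inv_galois [simp]: "galois_inv (galois t) = t"
  and galois_galois_inv [simp]: "galois (galois_inv t) = t"
  using bij_right_cov unfolding galois_inv_def galois_def
  by (simp_all add: bij_is_inj bij_is_surj surj_f_inv_f)

lemma clinear_galois_inv: "clinear galois_inv"
proof -
  have "galois_inv (s + t) = galois_inv s + galois_inv t" for s t
    using galois_inv_galois[of "galois_inv s + galois_inv t"] by (simp add: clinear_add[OF clinear_galois])
  moreover have "galois_inv (c *\<^sub>C t) = c *\<^sub>C galois_inv t" for c t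
    using galois_inv_galois[of "c *\<^sub>C galois_inv t"] by (simp add: clinear_scale[OF clinear_galois])
  ultimately show ?thesis by (simp add: clinear_iff)
qed

text \<open>By the cograding, T maps A_{pq} \<otimes> A_q onto A_p \<otimes> A_q; being injective,
  it can be inverted component by component.\<close>

lemma galois_inv_in:
  assumes "p \<in> carrier G" "q \<in> carrier G" "t \<in> A p \<otimes>\<^sub>S A q"
  shows "galois_inv t \<in> A (p \<otimes> q) \<otimes>\<^sub>S A q"
proof -
  have "galois_inv ` (A p \<otimes>\<^sub>S A q) = cspan (galois_inv ` {right_cov \<Delta> a b |a b. a \<in> A (p \<otimes> q) \<and> b \<in> A q})"
    using complex_vector.linear_span_image[OF clinear_galois_inv] right_cov_component[OF assms(1,2)] by simp
  also have "{right_cov \<Delta> a b |a b. a \<in> A (p \<otimes> q) \<and> b \<in> A q} = galois ` {x \<otimes>\<^sub>T y |x y. x \<in> A (p \<otimes> q) \<and> y \<in> A q}"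
    by (auto simp: galois_tens[symmetric])
  also have "galois_inv ` \<dots> = {x \<otimes>\<^sub>T y |x y. x \<in> A (p \<otimes> q) \<and> y \<in> A q}"
    by (simp add: image_image)
  finally show ?thesis using assms(3) unfolding tensor_span_def by blast
qed

lemma sw_mult_right:
  assumes "p \<in> carrier G" "q \<in> carrier G"
  shows "sw p q a (\<lambda>x y. x \<otimes>\<^sub>T (y * b)) = cop p q a * (un p \<otimes>\<^sub>T b)"
proof -
  have "cop p q a * (un p \<otimes>\<^sub>T b) = sw p q a (\<lambda>x y. (x * un p) \<otimes>\<^sub>T (y * b))"
    using tsum_linear[where h = "\<lambda>t. t * (un p \<otimes>\<^sub>T b)" and t = "cop p q a" and f = "(\<otimes>\<^sub>T)", OF clinear_mult_right]
    by (simp add: tsum_tens times_tensor_tens)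
  also have "\<dots> = sw p q a (\<lambda>x y. x \<otimes>\<^sub>T (y * b))"
    using assms by (intro sw_cong) (simp_all add: bilinear_iff tens_linear_simps distrib_left distrib_right
        scaleC_mult_left scaleC_mult_right un_right)
  finally show ?thesis by simp
qed

lemmas mult_linear_simps = distrib_left distrib_right scaleC_mult_left scaleC_mult_right

text \<open>The inverse of the Galois map is compatible with the coproduct in the first leg. This form of
  coassociativity yields both the counit and the antipode.\<close>

lemma galois_inv_coassoc:
  assumes [simp]: "p \<in> carrier G" "q \<in> carrier G" "r \<in> carrier G" and a: "a \<in> A (p \<otimes> q)" and b: "b \<in> A r"
  shows "sw p q a (\<lambda>x y. x \<otimes>\<^sub>T galois_inv (y \<otimes>\<^sub>T b)) =
    tsum (galois_inv (a \<otimes>\<^sub>T b)) (\<lambda>a' b'. sw p (q \<otimes> r) a' (\<lambda>x w. x \<otimes>\<^sub>T (w \<otimes>\<^sub>T b')))"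
proof -
  note lin = clinear_simps[OF clinear_galois_inv] tens_linear_simps
    mult_linear_simps
  have b1: "bilinear (\<lambda>x y. x \<otimes>\<^sub>T galois_inv (y \<otimes>\<^sub>T z))" for z
    by (simp add: bilinear_iff lin)
  have b2: "bilinear (\<lambda>w z. sw p q w (\<lambda>x y. x \<otimes>\<^sub>T galois_inv (y \<otimes>\<^sub>T z)))"
    unfolding bilinear_iff by (simp add: sw_linear[OF b1] lin)
  have b3: "bilinear (\<lambda>x w. x \<otimes>\<^sub>T (w \<otimes>\<^sub>T z))" for z :: 'a
    by (simp add: bilinear_iff lin)
  have b4: "bilinear (\<lambda>a' (b' :: 'a). sw p (q \<otimes> r) a' (\<lambda>x w. x \<otimes>\<^sub>T (w \<otimes>\<^sub>T b')))"
    unfolding bilinear_iff by (simp add: sw_linear[OF b3] lin)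
  \<comment> \<open>\<open>?Q\<close> is (\<iota> \<otimes> T^-1)(\<Delta> \<otimes> \<iota>). On a
    value T(a' \<otimes> b') coassociativity gives (\<Delta> \<otimes> \<iota>)T = (\<iota>
    \<otimes> T)(\<Delta> \<otimes> \<iota>), so T^-1 cancels.\<close>
  let ?Q = "\<lambda>t. tsum t (\<lambda>w z. sw p q w (\<lambda>x y. x \<otimes>\<^sub>T galois_inv (y \<otimes>\<^sub>T z)))"
  have Q: "clinear ?Q" by (rule clinear_tsum[OF b2])
  have QT: "clinear (\<lambda>t. ?Q (galois t))"
    using Q clinear_galois by (auto simp: clinear_iff)
  let ?s = "galois_inv (a \<otimes>\<^sub>T b)"
  have s: "?s \<in> A (p \<otimes> q \<otimes> r) \<otimes>\<^sub>S A r"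
    using a b by (intro galois_inv_in) (simp_all add: tensor_span_I)
  have "?Q (galois ?s) = tsum ?s (\<lambda>a' b'. sw p (q \<otimes> r) a' (\<lambda>x w. x \<otimes>\<^sub>T (w \<otimes>\<^sub>T b')))"
  proof (rule linear_eq_on_tensor_span[OF QT clinear_tsum[OF b4] _ s])
    fix a' b' assume a': "a' \<in> A (p \<otimes> q \<otimes> r)" and b': "b' \<in> A r"
    have "?Q (galois (a' \<otimes>\<^sub>T b')) = ?Q (sw (p \<otimes> q) r a' (\<lambda>x y. x \<otimes>\<^sub>T (y * b')))"
      using right_cov_eq[OF _ _ a' b'] by (simp add: galois_tens sw_mult_right)
    also have "\<dots> = sw (p \<otimes> q) r a' (\<lambda>w z. sw p q w (\<lambda>x y. x \<otimes>\<^sub>T galois_inv (y \<otimes>\<^sub>T (z * b'))))"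
      by (simp add: tsum_tsum[OF b2])
    also have "\<dots> = sw p (q \<otimes> r) a' (\<lambda>x w. sw q r w (\<lambda>y z. x \<otimes>\<^sub>T galois_inv (y \<otimes>\<^sub>T (z * b'))))"
      by (rule sw_coassoc) (simp_all add: trilinear_iff lin)
    also have "\<dots> = sw p (q \<otimes> r) a' (\<lambda>x w. x \<otimes>\<^sub>T galois_inv (cop q r w * (un q \<otimes>\<^sub>T b')))"
    proof -
      have l: "clinear (\<lambda>t. x \<otimes>\<^sub>T galois_inv t)" for x :: 'a by (simp add: clinear_iff lin)
      show ?thesis by (simp add: tsum_linear[OF l, symmetric] sw_mult_right)
    qed
    also have "\<dots> = sw p (q \<otimes> r) a' (\<lambda>x w. x \<otimes>\<^sub>T (w \<otimes>\<^sub>T b'))"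
    proof (rule sw_cong)
      fix x w assume w: "w \<in> A (q \<otimes> r)"
      have "galois_inv (cop q r w * (un q \<otimes>\<^sub>T b')) = w \<otimes>\<^sub>T b'"
        using galois_inv_galois[of "w \<otimes>\<^sub>T b'"] right_cov_eq[OF _ _ w b'] by (simp add: galois_tens)
      then show "x \<otimes>\<^sub>T galois_inv (cop q r w * (un q \<otimes>\<^sub>T b')) = x \<otimes>\<^sub>T (w \<otimes>\<^sub>T b')" by simp
    qed (simp_all add: bilinear_iff lin cop_add cop_scale)
    also have "\<dots> = tsum (a' \<otimes>\<^sub>T b') (\<lambda>a' b'. sw p (q \<otimes> r) a' (\<lambda>x w. x \<otimes>\<^sub>T (w \<otimes>\<^sub>T b')))"
      by (simp add: tsum_of_tens[OF b4])
    finally show "?Q (galois (a' \<otimes>\<^sub>T b')) = \<dots>" .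
  qed
  then show ?thesis by (simp add: tsum_of_tens[OF b2])
qed

subsection \<open>The counit\<close>

text \<open>Formally T^-1(a \<otimes> b) = a_1 \<otimes> S(a_2) b, whose legs multiply to
  \<epsilon>(a) b. The counit is obtained by showing that the result is indeed a scalar multiple of
  \<open>b\<close>.\<close>

definition mult_galois_inv :: "'a \<Rightarrow> 'a \<Rightarrow> 'a"
  where "mult_galois_inv a b = tensor_lift (*) (galois_inv (a \<otimes>\<^sub>T b))"

lemma bilinear_mult: "bilinear ((*) :: 'a \<Rightarrow> 'a \<Rightarrow> 'a)"
  by (simp add: bilinear_iff mult_linear_simps)

lemma clinear_mult_galois_inv_tensor: "clinear (\<lambda>t. tensor_lift (*) (galois_inv t))"
  using clinear_galois_inv clinear_tensor_lift[OF bilinear_mult] by (auto simp: clinear_iff)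

lemma bilinear_mult_galois_inv: "bilinear mult_galois_inv"
  by (simp add: bilinear_iff mult_galois_inv_def tens_linear_simps
      clinear_simps[OF clinear_mult_galois_inv_tensor])

text \<open>Multiplying the last two legs in \<open>galois_inv_coassoc\<close> turns its right-hand
  side into T(T^-1(a \<otimes> b)).\<close>

lemma sw_mult_galois_inv:
  assumes [simp]: "p \<in> carrier G" "r \<in> carrier G" and a: "a \<in> A p" and b: "b \<in> A r"
  shows "sw p \<one> a (\<lambda>x y. x \<otimes>\<^sub>T mult_galois_inv y b) = a \<otimes>\<^sub>T b"
proof -
  note m = clinear_tensor_lift[OF bilinear_mult]
  have b1: "bilinear (\<lambda>x (s :: ('a, 'a) tensor). x \<otimes>\<^sub>T tensor_lift (*) s)"
    by (simp add: bilinear_iff tens_linear_simps clinear_simps[OF m])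
  have b2: "bilinear (\<lambda>x w. x \<otimes>\<^sub>T (w * z))" for z :: 'a
    by (simp add: bilinear_iff mult_linear_simps tens_linear_simps)
  have b3: "bilinear (\<lambda>a' b'. sw p r a' (\<lambda>x w. x \<otimes>\<^sub>T (w * b')))"
    unfolding bilinear_iff by (simp add: sw_linear[OF b2] mult_linear_simps tens_linear_simps)
  let ?s = "galois_inv (a \<otimes>\<^sub>T b)"
  have s: "?s \<in> A (p \<otimes> r) \<otimes>\<^sub>S A r"
    using a b by (intro galois_inv_in) (simp_all add: tensor_span_I)
  have "sw p \<one> a (\<lambda>x y. x \<otimes>\<^sub>T mult_galois_inv y b)
    = tsum (sw p \<one> a (\<lambda>x y. x \<otimes>\<^sub>T galois_inv (y \<otimes>\<^sub>T b))) (\<lambda>x s. x \<otimes>\<^sub>T tensor_lift (*) s)"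
    by (simp add: tsum_tsum[OF b1] mult_galois_inv_def)
  also have "\<dots> = tsum (tsum ?s (\<lambda>a' b'. sw p r a' (\<lambda>x w. x \<otimes>\<^sub>T (w \<otimes>\<^sub>T b')))) (\<lambda>x s. x \<otimes>\<^sub>T tensor_lift (*) s)"
    using galois_inv_coassoc[of p \<one> r a b] a b by simp
  also have "\<dots> = tsum ?s (\<lambda>a' b'. sw p r a' (\<lambda>x w. x \<otimes>\<^sub>T (w * b')))"
    by (simp add: tsum_tsum_tensor[OF b1] tsum_of_tens[OF b1] tensor_lift[OF bilinear_mult])
  also have "\<dots> = galois ?s"
    by (rule linear_eq_on_tensor_span[OF clinear_tsum[OF b3] clinear_galois _ s])
      (simp only: tsum_of_tens[OF b3], simp add: galois_tens right_cov_eq[of p r] sw_mult_right)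
  finally show ?thesis by simp
qed

text \<open>T^-1(y \<otimes> b) lies in A_{pr} \<otimes> A_r for b in A_r, and these two components
  are orthogonal unless p is the identity of the group.\<close>

lemma mult_galois_inv_other:
  assumes "p \<in> carrier G" "p \<noteq> \<one>" "y \<in> A p"
  shows "mult_galois_inv y b = 0"
proof (induct b rule: component_induct)
  case (component r b)
  have "galois_inv (y \<otimes>\<^sub>T b) \<in> A (p \<otimes> r) \<otimes>\<^sub>S A r"
    using assms component by (intro galois_inv_in tensor_span_I) auto
  moreover have "p \<otimes> r \<noteq> r" using assms component by simp
  then have "u * v = 0" if "u \<in> A (p \<otimes> r)" "v \<in> A r" for u v
    using component_orthogonal[of "p \<otimes> r" r u v] that assms(1) component(1) by simp
  ultimately show ?case
    unfolding mult_galois_inv_def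
    by (intro linear_eq_on_tensor_span[where g = "\<lambda>t. 0" and t = "galois_inv (y \<otimes>\<^sub>T b)",
          OF clinear_tensor_lift[OF bilinear_mult]])
      (simp_all add: clinear_iff tensor_lift[OF bilinear_mult])
next
  case (add x y)
  then show ?case using bilinear_mult_galois_inv by (simp add: bilinear_iff)
qed

text \<open>For y in A_e, the tensor 1_e \<otimes> y is a combination of tensors (c \<otimes>
  1)\<Delta>(d), and each of them contributes cd \<otimes> b by \<open>sw_mult_galois_inv\<close>.
  Hence 1_e tensored with \<open>mult_galois_inv y b\<close> equals z \<otimes> b with z fixed
  before b, and a functional that is 1 at 1_e extracts a scalar independent of b.\<close>

lemma mult_galois_inv_scalar: "\<exists>c. \<forall>b. mult_galois_inv y b = c *\<^sub>C b"
proof (induct y rule: component_induct)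
  case (add y z)
  then obtain c d where "\<forall>b. mult_galois_inv y b = c *\<^sub>C b" "\<forall>b. mult_galois_inv z b = d *\<^sub>C b" by blast
  then show ?case using bilinear_mult_galois_inv
    by (intro exI[of _ "c + d"]) (simp add: bilinear_iff scaleC_add_left)
next
  case (component p y)
  show ?case
  proof (cases "p = \<one>")
    case False
    then show ?thesis using mult_galois_inv_other component by (intro exI[of _ 0]) auto
  next
    case True
    note bl = bilinear_mult_galois_inv[unfolded bilinear_iff]
    have b1: "bilinear (\<lambda>x y. x \<otimes>\<^sub>T mult_galois_inv y b)" for b
      using bl by (simp add: bilinear_iff tens_linear_simps)
    have *: "\<exists>c. \<forall>r\<in>carrier G. \<forall>b\<in>A r. tsum t (\<lambda>x y. x \<otimes>\<^sub>T mult_galois_inv y b) = c \<otimes>\<^sub>T b"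
      if "t \<in> cspan {left_cov \<Delta> a b |a b. a \<in> A \<one> \<and> b \<in> A (\<one> \<otimes> \<one>)}" for t
      using that
    proof (induct rule: complex_vector.span_induct_alt)
      case base
      show ?case by (intro exI[of _ 0]) (simp add: tsum_zero_tensor[OF b1])
    next
      case (step k s t)
      then obtain c d e where c: "c \<in> A \<one>" and d: "d \<in> A \<one>" and s: "s = left_cov \<Delta> c d"
        and e: "\<forall>r\<in>carrier G. \<forall>b\<in>A r. tsum t (\<lambda>x y. x \<otimes>\<^sub>T mult_galois_inv y b) = e \<otimes>\<^sub>T b"
        by auto
      have "tsum s (\<lambda>x y. x \<otimes>\<^sub>T mult_galois_inv y b) = (c * d) \<otimes>\<^sub>T b" if "r \<in> carrier G" "b \<in> A r" for r b
      proof -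
        have "s = (c \<otimes>\<^sub>T un \<one>) * cop \<one> \<one> d"
          using c d unfolding s by (intro left_cov_eq) auto
        then have "tsum s (\<lambda>x y. x \<otimes>\<^sub>T mult_galois_inv y b)
          = sw \<one> \<one> d (\<lambda>u v. (c * u) \<otimes>\<^sub>T mult_galois_inv (un \<one> * v) b)"
          using bl by (simp add: tsum_times[OF b1])
            (subst tsum_of_tens, simp_all add: bilinear_iff mult_linear_simps tens_linear_simps)
        also have "\<dots> = sw \<one> \<one> d (\<lambda>u v. (c * u) \<otimes>\<^sub>T mult_galois_inv v b)"
          using bl un_left by (intro sw_cong) (simp_all add: bilinear_iff mult_linear_simps tens_linear_simps)
        also have "\<dots> = lact (mult_of c \<otimes>\<^sub>M 1) (sw \<one> \<one> d (\<lambda>u v. u \<otimes>\<^sub>T mult_galois_inv v b))"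
          by (simp add: tsum_linear[OF lact_linear] lact_multiplier_tens)
        also have "\<dots> = (c * d) \<otimes>\<^sub>T b"
          using sw_mult_galois_inv[of \<one> r d b] that d by (simp add: lact_multiplier_tens)
        finally show ?thesis .
      qed
      with e show ?case
        by (intro exI[of _ "k *\<^sub>C (c * d) + e"])
          (auto simp: tsum_linear_tensor[OF b1] tens_linear_simps)
    qed
    have "un \<one> \<otimes>\<^sub>T y \<in> A \<one> \<otimes>\<^sub>S A \<one>" using component True by (intro tensor_span_I un_in) auto
    then have "un \<one> \<otimes>\<^sub>T y \<in> cspan {left_cov \<Delta> a b |a b. a \<in> A \<one> \<and> b \<in> A (\<one> \<otimes> \<one>)}"
      using left_cov_component[of \<one> \<one>] by simp
    from *[OF this] obtain c where c: "\<And>r b. r \<in> carrier G \<Longrightarrow> b \<in> A r \<Longrightarrow> un \<one> \<otimes>\<^sub>T mult_galois_inv y b = c \<otimes>\<^sub>T b"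
      by (auto simp: tsum_of_tens[OF b1])
    obtain f :: "'a \<Rightarrow> complex" where f: "clinear f" "f (un \<one>) = 1"
      using linear_functional_exists[OF un_nonzero[OF one_closed]] by blast
    have fb: "bilinear (\<lambda>x y. f x *\<^sub>C y)"
      using f(1) by (auto simp: bilinear_iff clinear_iff scaleC_add_left scaleC_add_right scaleC_scaleC mult.commute)
    have "mult_galois_inv y b = f c *\<^sub>C b" if "r \<in> carrier G" "b \<in> A r" for r b
      using arg_cong[OF c[OF that], of "\<lambda>t. lslice f t"]
      by (simp add: tsum_of_tens[OF fb] f(2) scaleC_one)
    then have "mult_galois_inv y b = f c *\<^sub>C b" for b
      using bl by (induct b rule: component_induct) (auto simp: scaleC_add_right)
    then show ?thesis by blast
  qed
qed

definition eps :: "'a \<Rightarrow> complex"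
  where "eps y = (SOME c. \<forall>b. mult_galois_inv y b = c *\<^sub>C b)"

lemma mult_galois_inv_eq: "mult_galois_inv y b = eps y *\<^sub>C b"
  unfolding eps_def by (rule spec[OF someI_ex[OF mult_galois_inv_scalar[of y]]])

lemma scaleC_cancel: "c *\<^sub>C x = d *\<^sub>C x \<Longrightarrow> x \<noteq> 0 \<Longrightarrow> c = d" for x :: "'x::complex_vector"
  by (simp add: complex_vector.scale_cancel_right)

lemma clinear_eps: "clinear eps"
proof -
  have "eps (x + y) *\<^sub>C un \<one> = (eps x + eps y) *\<^sub>C un \<one>" "eps (c *\<^sub>C x) *\<^sub>C un \<one> = (c * eps x) *\<^sub>C un \<one>" for c x y
    using bilinear_mult_galois_inv unfolding bilinear_iff mult_galois_inv_eq
    by (simp_all only: scaleC_add_left scaleC_scaleC)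
  then show ?thesis using scaleC_cancel un_nonzero[OF one_closed] by (auto simp: clinear_iff)
qed

lemmas eps_add = clinear_add[OF clinear_eps] and eps_scale = clinear_scale[OF clinear_eps]

lemma eps_other: "p \<in> carrier G \<Longrightarrow> p \<noteq> \<one> \<Longrightarrow> y \<in> A p \<Longrightarrow> eps y = 0"
  using mult_galois_inv_other[of p y "un \<one>"] un_nonzero[OF one_closed] by (simp add: mult_galois_inv_eq)

lemma eps_scaleC: "eps a *\<^sub>C b = tensor_lift (*) (galois_inv (a \<otimes>\<^sub>T b))"
  using mult_galois_inv_eq by (simp add: mult_galois_inv_def)

lemma bilinear_eps_left: "bilinear (\<lambda>x y. eps x *\<^sub>C (y :: 'a))"
  and bilinear_eps_right: "bilinear (\<lambda>x y. eps y *\<^sub>C (x :: 'a))"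
  by (simp_all add: bilinear_iff eps_add eps_scale scaleC_add_left scaleC_add_right scaleC_scaleC mult.commute)

text \<open>By its construction, \<open>eps\<close> sliced over the first leg is multiplication
  after T^-1, and here T^-1 meets a value of T.\<close>

lemma eps_right_cov: "lslice eps (right_cov \<Delta> a b) = a * b"
proof -
  have "lslice eps (right_cov \<Delta> a b) = tensor_lift (*) (galois_inv (right_cov \<Delta> a b))"
    using tsum_linear[OF clinear_mult_galois_inv_tensor, of "right_cov \<Delta> a b" "(\<otimes>\<^sub>T)"]
    by (simp add: eps_scaleC tsum_tens)
  then show ?thesis by (simp add: galois_tens[symmetric] tensor_lift[OF bilinear_mult])
qed

lemma sw_eps_left:
  assumes "p \<in> carrier G"
  shows "lslice eps (cop \<one> p a) = a * un p"
proof -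
  have "right_cov \<Delta> (a * un p) (un p) = cop \<one> p (a * un p)"
    using assms right_cov_eq[of \<one> p "a * un p" "un p"] un_in un_mult_in by (simp add: un_central cop_mult_un)
  also have "\<dots> = cop \<one> p a" using cop_restrict[of \<one> p a] assms by simp
  finally show ?thesis using eps_right_cov[of "a * un p" "un p"] assms by (simp add: mult.assoc un_idem)
qed

lemma sw_eps_right:
  assumes "p \<in> carrier G"
  shows "rslice eps (cop p \<one> a) = a * un p"
proof -
  have "sw p \<one> (a * un p) (\<lambda>x y. x \<otimes>\<^sub>T (eps y *\<^sub>C un \<one>)) = (a * un p) \<otimes>\<^sub>T un \<one>"
    using sw_mult_galois_inv[of p \<one> "a * un p" "un \<one>"] assms un_in un_mult_in
    by (simp add: mult_galois_inv_eq un_central)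
  then have "sw p \<one> a (\<lambda>x y. (eps y *\<^sub>C x) \<otimes>\<^sub>T un \<one>) = (a * un p) \<otimes>\<^sub>T un \<one>"
    using cop_restrict[of p \<one> a] assms by (simp add: tens_linear_simps)
  then have "rslice eps (cop p \<one> a) \<otimes>\<^sub>T un \<one> = (a * un p) \<otimes>\<^sub>T un \<one>"
    by (subst tsum_linear[of "\<lambda>t. t \<otimes>\<^sub>T un \<one>"]) (simp_all add: clinear_iff tens_linear_simps)
  then show ?thesis using tens_right_cancel un_nonzero by blast
qed

lemma sw_eps_left_apply:
  assumes "p \<in> carrier G" "clinear h"
  shows "sw \<one> p a (\<lambda>x y. eps x *\<^sub>C h y) = h (a * un p)"
  using tsum_linear[OF assms(2), of "cop \<one> p a" "\<lambda>x y. eps x *\<^sub>C y"] sw_eps_left[OF assms(1)]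
  by (simp add: clinear_scale[OF assms(2)])

lemma sw_eps_right_apply:
  assumes "p \<in> carrier G" "clinear h"
  shows "sw p \<one> a (\<lambda>x y. eps y *\<^sub>C h x) = h (a * un p)"
  using tsum_linear[OF assms(2), of "cop p \<one> a" "\<lambda>x y. eps y *\<^sub>C x"] sw_eps_right[OF assms(1)]
  by (simp add: clinear_scale[OF assms(2)])

lemmas lin_simps = bilinear_iff trilinear_iff tens_linear_simps mult_linear_simps
  scaleC_add_left scaleC_add_right scaleC_scaleC eps_add eps_scale mult.commute mult.left_commute tsum_scale_mult

lemma sw_left_cov:
  assumes "p \<in> carrier G" "q \<in> carrier G" "c \<in> A p" "d \<in> A (p \<otimes> q)" "bilinear f"
  shows "tsum (left_cov \<Delta> c d) f = sw p q d (\<lambda>u v. f (c * u) v)"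
proof -
  note f = assms(5)[unfolded bilinear_iff]
  have "tsum (left_cov \<Delta> c d) f = sw p q d (\<lambda>u v. f (c * u) (un q * v))"
    by (subst left_cov_eq[OF assms(1-4)], subst tsum_times[OF assms(5)], subst tsum_of_tens)
      (simp_all add: bilinear_iff mult_linear_simps f)
  also have "\<dots> = sw p q d (\<lambda>u v. f (c * u) v)"
    using assms by (intro sw_cong) (simp_all add: bilinear_iff mult_linear_simps f un_left)
  finally show ?thesis .
qed

text \<open>The tensors (c \<otimes> 1)\<Delta>(d) span A_p \<otimes> A_q. Testing on them replaces
  an arbitrary second leg by d_2, to which the counit identities apply.\<close>

lemma left_cov_linear_eq:
  assumes "p \<in> carrier G" "q \<in> carrier G" "t \<in> A p \<otimes>\<^sub>S A q" "clinear f" "clinear g"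
    "\<And>c d. c \<in> A p \<Longrightarrow> d \<in> A (p \<otimes> q) \<Longrightarrow> f (left_cov \<Delta> c d) = g (left_cov \<Delta> c d)"
  shows "f t = g t"
  by (rule complex_vector.linear_eq_on[OF assms(4,5) assms(3)[folded left_cov_component[OF assms(1,2)]]])
    (use assms(6) in blast)

lemma eps_restrict: "eps (a * un \<one>) = eps a"
proof (induct a rule: component_induct)
  case (component p a)
  show ?case
  proof (cases "p = \<one>")
    case True
    with component show ?thesis by (simp add: un_right)
  next
    case False
    with component show ?thesis using eps_other[of p a] un_right_other[of \<one> p a] clinear_0[OF clinear_eps] by simp
  qed
qed (simp add: distrib_right eps_add)

text \<open>With (c \<otimes> 1)\<Delta>(d) in place of 1_e \<otimes> y both sides come down to c d
  b, by the counit identities for db and for d.\<close>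

lemma sw_eps_mult:
  assumes y: "y \<in> A \<one>" and b: "b \<in> A \<one>"
  shows "sw \<one> \<one> b (\<lambda>u v. eps (y * v) *\<^sub>C u) = eps y *\<^sub>C b"
proof -
  let ?f = "\<lambda>x y. sw \<one> \<one> b (\<lambda>u v. eps (y * v) *\<^sub>C (x * u))"
  have f: "bilinear ?f" by (simp add: lin_simps)
  have g: "clinear (\<lambda>t. rslice eps t * b)"
    by (simp add: clinear_iff mult_linear_simps clinear_simps[OF clinear_tsum[OF bilinear_eps_right]])
  have "tsum (un \<one> \<otimes>\<^sub>T y) ?f = rslice eps (un \<one> \<otimes>\<^sub>T y) * b"
  proof (rule left_cov_linear_eq[OF one_closed one_closed tensor_span_I[OF un_in y] clinear_tsum[OF f] g])
    fix c d assume c: "c \<in> A \<one>" and d: "d \<in> A (\<one> \<otimes> \<one>)"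
    have d': "d \<in> A \<one>" using d by simp
    have "tsum (left_cov \<Delta> c d) ?f = sw \<one> \<one> d (\<lambda>x y. ?f (c * x) y)"
      using c d f by (intro sw_left_cov) auto
    also have "\<dots> = c * rslice eps (cop \<one> \<one> (d * b))"
      by (simp add: sw_times[OF _ _ bilinear_eps_right] tsum_linear[OF clinear_mult_left] scaleC_mult_right mult.assoc)
    also have "\<dots> = c * d * b" using b by (simp add: sw_eps_right mult.assoc un_right)
    also have "c * d = c * rslice eps (cop \<one> \<one> d)"
      using d' by (simp add: sw_eps_right un_right)
    also have "\<dots> = rslice eps (left_cov \<Delta> c d)"
      by (simp add: sw_left_cov[OF one_closed one_closed c d bilinear_eps_right]
          tsum_linear[OF clinear_mult_left] scaleC_mult_right)
    finally show "tsum (left_cov \<Delta> c d) ?f = rslice eps (left_cov \<Delta> c d) * b" .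
  qed simp
  then have "sw \<one> \<one> b (\<lambda>u v. eps (y * v) *\<^sub>C (un \<one> * u)) = eps y *\<^sub>C b"
    using b by (simp add: tsum_of_tens[OF f] tsum_of_tens[OF bilinear_eps_right] scaleC_mult_left un_left)
  moreover have "sw \<one> \<one> b (\<lambda>u v. eps (y * v) *\<^sub>C (un \<one> * u)) = sw \<one> \<one> b (\<lambda>u v. eps (y * v) *\<^sub>C u)"
    by (rule sw_cong) (simp_all add: lin_simps un_left)
  ultimately show ?thesis by simp
qed

text \<open>The expansion used for \<open>sw_eps_mult\<close> is repeated for the right-hand factor,
  with that lemma taking the place of the counit identity. Both factors can be cut down to A_e,
  where \<open>eps\<close> is concentrated.\<close>

lemma eps_mult: "eps (a * b) = eps a * eps b"
proof -
  have *: "eps (y * v) = eps y * eps v" if y: "y \<in> A \<one>" and v: "v \<in> A \<one>" for y v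
  proof -
    let ?f = "\<lambda>u v. eps (y * v) *\<^sub>C u"
    have f: "bilinear ?f" by (simp add: lin_simps)
    have g: "clinear (\<lambda>t. eps y *\<^sub>C tsum t (\<lambda>x y. eps y *\<^sub>C (x :: 'a)))"
      by (simp add: clinear_iff scaleC_add_right scaleC_scaleC clinear_simps[OF clinear_tsum[OF bilinear_eps_right]] mult.commute)
    have "tsum (un \<one> \<otimes>\<^sub>T v) ?f = eps y *\<^sub>C rslice eps (un \<one> \<otimes>\<^sub>T v)"
    proof (rule left_cov_linear_eq[OF one_closed one_closed tensor_span_I[OF un_in v] clinear_tsum[OF f] g])
      fix c d assume c: "c \<in> A \<one>" and d: "d \<in> A (\<one> \<otimes> \<one>)"
      have d': "d \<in> A \<one>" using d by simp
      have "tsum (left_cov \<Delta> c d) ?f = c * sw \<one> \<one> d ?f"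
        by (simp add: sw_left_cov[OF one_closed one_closed c d f] tsum_linear[OF clinear_mult_left] scaleC_mult_right)
      also have "\<dots> = eps y *\<^sub>C (c * d)" using y d' by (simp add: sw_eps_mult scaleC_mult_right)
      also have "c * d = c * rslice eps (cop \<one> \<one> d)"
        using d' by (simp add: sw_eps_right un_right)
      also have "\<dots> = rslice eps (left_cov \<Delta> c d)"
        by (simp add: sw_left_cov[OF one_closed one_closed c d bilinear_eps_right]
            tsum_linear[OF clinear_mult_left] scaleC_mult_right)
      finally show "tsum (left_cov \<Delta> c d) ?f = eps y *\<^sub>C rslice eps (left_cov \<Delta> c d)" .
    qed simp
    then show ?thesis
      using scaleC_cancel[OF _ un_nonzero[OF one_closed]]
      by (simp add: tsum_of_tens[OF f] tsum_of_tens[OF bilinear_eps_right] scaleC_scaleC)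
  qed
  have "eps (a * b) = eps (a * b * (un \<one> * un \<one>))" by (simp add: eps_restrict un_idem)
  also have "a * b * (un \<one> * un \<one>) = (a * un \<one>) * (b * un \<one>)"
    by (metis mult.assoc un_central one_closed)
  also have "eps \<dots> = eps a * eps b"
  proof -
    have "x * un \<one> \<in> A \<one>" for x by (simp add: un_central un_mult_in)
    from *[OF this this] show ?thesis by (simp add: eps_restrict)
  qed
  finally show ?thesis .
qed

lemma eps_un: "eps (un \<one>) = 1"
proof -
  have "eps (un \<one>) *\<^sub>C un \<one> = 1 *\<^sub>C un \<one>"
    using sw_eps_left[of \<one> "un (\<one> \<otimes> \<one>)"] sw_un[OF one_closed one_closed bilinear_eps_left]
    by (simp add: un_idem scaleC_one)
  then show ?thesis using scaleC_cancel[OF _ un_nonzero[OF one_closed]] by blast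
qed

lemma left_cov_components:
  assumes "p \<in> carrier G" "q \<in> carrier G" "c \<in> A p" "d \<in> A q" "bilinear f"
  shows "tsum (left_cov \<Delta> c d) f = sw p (inv p \<otimes> q) d (\<lambda>u v. f (c * u) v)"
  using assms by (intro sw_left_cov) (simp_all add: m_assoc[symmetric])

lemma eps_left_cov: "rslice eps (left_cov \<Delta> a b) = a * b"
proof (induct a rule: component_induct)
  case (component p a)
  note a = this
  show ?case
  proof (induct b rule: component_induct)
    case (component q b)
    note b = this
    have l: "rslice eps (left_cov \<Delta> a b) = a * sw p (inv p \<otimes> q) b (\<lambda>u v. eps v *\<^sub>C u)"
      using left_cov_components[OF a(1) b(1) a(2) b(2) bilinear_eps_right]
      by (simp add: tsum_linear[OF clinear_mult_left] scaleC_mult_right)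
    show ?case
    proof (cases "p = q")
      case True
      then show ?thesis using l a b by (simp add: sw_eps_right un_right)
    next
      case False
      have ne: "inv p \<otimes> q \<noteq> \<one>" using False a(1) b(1) by (metis inv_equality inv_inv inv_closed)
      have "sw p (inv p \<otimes> q) b (\<lambda>u v. eps v *\<^sub>C u) = sw p (inv p \<otimes> q) b (\<lambda>u v. 0)"
      proof (rule sw_cong)
        fix x y assume "y \<in> A (inv p \<otimes> q)"
        then have "eps y = 0" using eps_other[OF _ ne] a(1) b(1) by simp
        then show "eps y *\<^sub>C x = 0" by simp
      qed (use a b in \<open>simp_all add: lin_simps\<close>)
      then show ?thesis using l component_orthogonal[OF a(1) b(1) False a(2) b(2)] by simp
    qed
  next
    case (add x y)
    then show ?case using bilinear_left_cov
      by (simp add: bilinear_iff tsum_plus_tensor[OF bilinear_eps_right] distrib_left)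
  qed
next
  case (add x y)
  then show ?case using bilinear_left_cov
      by (simp add: bilinear_iff tsum_plus_tensor[OF bilinear_eps_right] distrib_right)
qed

text \<open>For uniqueness, the left counit identity prescribes the slice by \<open>e\<close> on the
  range of T, which is everything.\<close>

lemma counit_eq: "counit \<Delta> = eps"
  unfolding counit_def
proof (rule the_equality)
  show "is_counit \<Delta> eps"
    unfolding is_counit_def
    by (simp add: clinear_eps eps_mult eps_right_cov eps_left_cov tsum_eq_lift[symmetric] bilinear_eps_left bilinear_eps_right)
  fix e assume e: "is_counit \<Delta> e"
  then have lin: "clinear e" by (simp add: is_counit_def)
  have b: "bilinear (\<lambda>x y. e x *\<^sub>C (y::'a))"
    by (simp add: bilinear_iff clinear_simps[OF lin] scaleC_add_left scaleC_add_right
        scaleC_scaleC mult.commute)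
  have "(\<lambda>t. tensor_lift (\<lambda>x y. e x *\<^sub>C y) (galois t)) = (\<lambda>t. tensor_lift (\<lambda>x y. eps x *\<^sub>C (y::'a)) (galois t))"
    using clinear_tensor_lift[OF b] clinear_tensor_lift[OF bilinear_eps_left] clinear_galois e
    by (intro clinear_tensor_eqI)
      (auto simp: clinear_iff is_counit_def galois_tens eps_right_cov tsum_eq_lift[symmetric] bilinear_eps_left)
  then have "tensor_lift (\<lambda>x y. e x *\<^sub>C y) t = tensor_lift (\<lambda>x y. eps x *\<^sub>C (y::'a)) t" for t
    by (metis galois_galois_inv)
  from this[of "_ \<otimes>\<^sub>T un \<one>"] have "e x *\<^sub>C un \<one> = eps x *\<^sub>C un \<one>" for x
    by (simp add: tensor_lift[OF b] tensor_lift[OF bilinear_eps_left])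
  then show "e = eps" using scaleC_cancel[OF _ un_nonzero[OF one_closed]] by blast
qed

subsection \<open>The antipode\<close>

text \<open>Formally (\<epsilon> \<otimes> \<iota>)(a_1 \<otimes> S(a_2) b) = S(a) b, so this stands
  for the product S(a) b before S itself is available.\<close>

definition antip :: "'a \<Rightarrow> 'a \<Rightarrow> 'a"
  where "antip a b = lslice eps (galois_inv (a \<otimes>\<^sub>T b))"

text \<open>For a in A_p the value S(a) should lie in A_{p^-1}; it is recovered from the product
  S(a) b by taking b to be the identity of that component.\<close>

definition S :: "'a \<Rightarrow> 'a"
  where "S = glue (\<lambda>p a. antip a (un (inv p)))"

lemma clinear_antip_tensor: "clinear (\<lambda>t. lslice eps (galois_inv t))"
  using clinear_galois_inv clinear_tsum[OF bilinear_eps_left] by (auto simp: clinear_iff)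

lemma bilinear_antip: "bilinear antip"
  by (simp add: bilinear_iff antip_def tens_linear_simps
      clinear_simps[OF clinear_antip_tensor])

lemma tsum_antip: "tsum t antip = lslice eps (galois_inv t)"
  using tsum_linear[OF clinear_antip_tensor, of t "(\<otimes>\<^sub>T)"] by (simp add: antip_def[abs_def] tsum_tens)

lemma clinear_S: "clinear S"
  unfolding S_def by (rule clinear_glue) (use bilinear_antip in \<open>simp add: clinear_iff bilinear_iff\<close>)

lemmas S_add = clinear_add[OF clinear_S] and S_scale = clinear_scale[OF clinear_S]
lemmas lin_simps' = lin_simps S_add S_scale

lemma S_component:
  assumes "p \<in> carrier G" "a \<in> A p"
  shows "S a = antip a (un (inv p))"
  unfolding S_def using assms bilinear_antip
  by (subst glue_component) (simp_all add: clinear_iff bilinear_iff)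

lemma antip_component:
  assumes [simp]: "p \<in> carrier G" "q \<in> carrier G" and "a \<in> A p" "b \<in> A q"
  shows "antip a b \<in> A q" and "q \<noteq> inv p \<Longrightarrow> antip a b = 0"
proof -
  let ?s = "galois_inv (a \<otimes>\<^sub>T b)"
  have s: "?s \<in> A (p \<otimes> q) \<otimes>\<^sub>S A q"
    using assms by (intro galois_inv_in tensor_span_I) auto
  have "antip a b * un q = antip a b"
    unfolding antip_def
    by (subst linear_eq_on_tensor_span[where f = "\<lambda>s. lslice eps s * un q" and g = "\<lambda>s. lslice eps s", OF _ _ _ s])
      (simp_all add: clinear_iff mult_linear_simps tsum_linear_tensor[OF bilinear_eps_left] tsum_of_tens[OF bilinear_eps_left] un_right)
  then show "antip a b \<in> A q" using component_iff un_central by simp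
  assume ne: "q \<noteq> inv p"
  have "p \<otimes> q \<noteq> \<one>" using ne inv_equality[of q p] inv_comm[of p q] by auto
  then show "antip a b = 0"
    unfolding antip_def
    using eps_other[of "p \<otimes> q"]
    by (intro linear_eq_on_tensor_span[where g = "\<lambda>s. 0", OF clinear_tsum[OF bilinear_eps_left] _ _ s])
      (simp_all add: clinear_iff tsum_of_tens[OF bilinear_eps_left])
qed

text \<open>T commutes with right multiplication in the second leg, hence so does T^-1, and slicing
  the first leg preserves this.\<close>

lemma antip_mult:
  assumes [simp]: "p \<in> carrier G" and a: "a \<in> A p" and c: "c \<in> A (inv p)"
  shows "antip a c = antip a (un (inv p)) * c"
proof -
  let ?q = "inv p"
  let ?s = "galois_inv (a \<otimes>\<^sub>T un ?q)"
  have b: "bilinear (\<lambda>x y. x \<otimes>\<^sub>T (y * c))" by (simp add: lin_simps)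
  have s: "?s \<in> A (p \<otimes> ?q) \<otimes>\<^sub>S A ?q"
    using a by (intro galois_inv_in tensor_span_I un_in) auto
  have "galois (tsum ?s (\<lambda>x y. x \<otimes>\<^sub>T (y * c))) = galois ?s * (un p \<otimes>\<^sub>T c)"
  proof (rule linear_eq_on_tensor_span[OF _ _ _ s])
    fix x y assume x: "x \<in> A (p \<otimes> ?q)" and y: "y \<in> A ?q"
    then have yc: "y * c \<in> A ?q" using c component_mult[of ?q] by simp
    show "galois (tsum (x \<otimes>\<^sub>T y) (\<lambda>x y. x \<otimes>\<^sub>T (y * c))) = galois (x \<otimes>\<^sub>T y) * (un p \<otimes>\<^sub>T c)"
      using right_cov_eq[OF assms(1) inv_closed[OF assms(1)] x y] right_cov_eq[OF assms(1) inv_closed[OF assms(1)] x yc]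
      by (simp add: tsum_of_tens[OF b] galois_tens mult.assoc times_tensor_tens un_idem)
  qed (simp_all add: clinear_iff tsum_linear_tensor[OF b] mult_linear_simps
      clinear_simps[OF clinear_galois])
  also have "\<dots> = a \<otimes>\<^sub>T c" using a c by (simp add: times_tensor_tens un_right un_left)
  finally have "galois_inv (a \<otimes>\<^sub>T c) = tsum ?s (\<lambda>x y. x \<otimes>\<^sub>T (y * c))"
    by (metis galois_inv_galois)
  then show ?thesis
    by (simp add: antip_def tsum_tsum[OF bilinear_eps_left] tsum_linear[OF clinear_mult_right] scaleC_mult_left)
qed

lemma S_in: "p \<in> carrier G \<Longrightarrow> a \<in> A p \<Longrightarrow> S a \<in> A (inv p)"
  using antip_component(1)[of p "inv p" a "un (inv p)"] un_in by (simp add: S_component)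

lemma antip_eq: "antip a b = S a * b"
proof (induct a rule: component_induct)
  case (component p a)
  note a = this
  show ?case
  proof (induct b rule: component_induct)
    case (component q b)
    show ?case
    proof (cases "q = inv p")
      case True
      then show ?thesis using antip_mult[of p a b] a component by (simp add: S_component)
    next
      case False
      then show ?thesis
        using antip_component(2)[of p q a b] a component S_in[of p a] component_orthogonal[of "inv p" q "S a" b] by auto
    qed
  qed (use bilinear_antip in \<open>simp add: bilinear_iff distrib_left\<close>)
qed (use bilinear_antip in \<open>simp add: bilinear_iff distrib_right S_add\<close>)

lemma S_right_cov: "tsum (right_cov \<Delta> a b) (\<lambda>x y. S x * y) = eps a *\<^sub>C b"
  using tsum_antip[of "right_cov \<Delta> a b"]
  by (simp add: antip_eq[abs_def] galois_tens[symmetric] tsum_of_tens[OF bilinear_eps_left])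

lemma sw_S_left:
  assumes [simp]: "p \<in> carrier G"
  shows "sw (inv p) p a (\<lambda>x y. S x * y) = eps a *\<^sub>C un p"
proof -
  have "right_cov \<Delta> (a * un \<one>) (un p) = cop (inv p) p (a * un \<one>)"
    using right_cov_eq[of "inv p" p "a * un \<one>" "un p"] un_in un_mult_in by (simp add: un_central cop_mult_un)
  also have "\<dots> = cop (inv p) p a" using cop_restrict[of "inv p" p a] by simp
  finally show ?thesis using S_right_cov[of "a * un \<one>" "un p"] by (simp add: eps_restrict)
qed

lemma S_restrict:
  assumes p: "p \<in> carrier G"
  shows "S (a * un p) = S a * un (inv p)"
proof (induct a rule: component_induct)
  case (component q a)
  show ?case
  proof (cases "p = q")
    case True
    then show ?thesis using component S_in[of q a] by (simp add: un_right)
  next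
    case False
    then have "inv p \<noteq> inv q" using p component by (metis inv_inv)
    then show ?thesis
      using False component p un_right_other[of p q a] un_right_other[of "inv p" "inv q" "S a"] S_in[of q a] clinear_0[OF clinear_S] by simp
  qed
qed (simp add: distrib_right S_add)

text \<open>Apply \<epsilon> to the middle leg of \<open>galois_inv_coassoc\<close> and multiply the
  outer two: the left side becomes a_1 S(a_2), the right side is the product of the legs of T^-1(a
  \<otimes> 1_p), which is \<epsilon>(a) 1_p.\<close>

lemma sw_S_right:
  assumes [simp]: "p \<in> carrier G"
  shows "sw p (inv p) a (\<lambda>x y. x * S y) = eps a *\<^sub>C un p"
proof -
  define a' where "a' = a * un \<one>"
  have a': "a' \<in> A (p \<otimes> inv p)" "a' \<in> A \<one>" by (simp_all add: a'_def un_central un_mult_in)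
  let ?e = "\<lambda>s. tsum s (\<lambda>x y. eps x *\<^sub>C (y::'a))"
  let ?s = "galois_inv (a' \<otimes>\<^sub>T un p)"
  have b1: "bilinear (\<lambda>x s. x * ?e s)"
    by (simp add: bilinear_iff mult_linear_simps tsum_linear_tensor[OF bilinear_eps_left])
  have s: "?s \<in> A p \<otimes>\<^sub>S A p"
    using galois_inv_in[OF one_closed assms tensor_span_I[OF a'(2) un_in[OF assms]]] by simp
  have "sw p (inv p) a' (\<lambda>x y. x * (S y * un p))
      = tsum (sw p (inv p) a' (\<lambda>x y. x \<otimes>\<^sub>T galois_inv (y \<otimes>\<^sub>T un p))) (\<lambda>x s. x * ?e s)"
    by (simp add: tsum_tsum[OF b1] antip_eq[symmetric] antip_def)
  also have "\<dots> = tsum (tsum ?s (\<lambda>a' b'. sw p \<one> a' (\<lambda>x w. x \<otimes>\<^sub>T (w \<otimes>\<^sub>T b')))) (\<lambda>x s. x * ?e s)"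
    using galois_inv_coassoc[of p "inv p" p a' "un p"] a' un_in by simp
  also have "\<dots> = tsum ?s (\<lambda>a' b'. sw p \<one> a' (\<lambda>x w. eps w *\<^sub>C x) * b')"
    by (simp add: tsum_tsum_tensor[OF b1] tsum_of_tens[OF b1] tsum_of_tens[OF bilinear_eps_left]
        tsum_linear[OF clinear_mult_right] mult_linear_simps)
  also have "\<dots> = tsum ?s (\<lambda>a' b'. a' * un p * b')" by (simp add: sw_eps_right)
  also have "\<dots> = tsum ?s (*)"
    by (rule tsum_cong[OF s]) (simp_all add: lin_simps un_right)
  also have "\<dots> = eps a' *\<^sub>C un p" by (simp add: eps_scaleC tsum_eq_lift bilinear_mult)
  finally have 1: "sw p (inv p) a' (\<lambda>x y. x * (S y * un p)) = eps a *\<^sub>C un p" by (simp add: a'_def eps_restrict)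
  have "sw p (inv p) a' (\<lambda>x y. x * (S y * un p)) = sw p (inv p) a' (\<lambda>x y. x * S y)"
  proof (rule sw_cong)
    fix x y assume "y \<in> A (inv p)"
    then show "x * (S y * un p) = x * S y" using S_in[of "inv p" y] by (simp add: un_right)
  qed (simp_all add: lin_simps')
  moreover have "cop p (inv p) a' = cop p (inv p) a"
    using cop_restrict[of p "inv p" a] by (simp add: a'_def)
  ultimately show ?thesis using 1 by simp
qed

lemma sw_S_left_apply:
  assumes "p \<in> carrier G" "clinear h"
  shows "sw (inv p) p a (\<lambda>x y. h (S x * y)) = eps a *\<^sub>C h (un p)"
  using tsum_linear[OF assms(2), of "cop (inv p) p a" "\<lambda>x y. S x * y"] sw_S_left[OF assms(1)]
  by (simp add: clinear_scale[OF assms(2)])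

lemma sw_S_right_apply:
  assumes "p \<in> carrier G" "clinear h"
  shows "sw p (inv p) a (\<lambda>x y. h (x * S y)) = eps a *\<^sub>C h (un p)"
  using tsum_linear[OF assms(2), of "cop p (inv p) a" "\<lambda>x y. x * S y"] sw_S_right[OF assms(1)]
  by (simp add: clinear_scale[OF assms(2)])

text \<open>Both sides are obtained from \<open>S(a\<^sub>1 b\<^sub>1) a\<^sub>2 b\<^sub>2 S(b\<^sub>3) S(a\<^sub>3)\<close>.\<close>

lemma S_mult: "S (a * b) = S b * S a"
proof -
  have *: "S (a * b) = S b * S a"
    if p [simp]: "p \<in> carrier G" and a: "a \<in> A p" and b: "b \<in> A p" for p a b
  proof -
    let ?r = "inv p"
    define M where "M = sw \<one> p a (\<lambda>w a3. sw p ?r w (\<lambda>a1 a2.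
      sw \<one> p b (\<lambda>v b3. sw p ?r v (\<lambda>b1 b2. S (a1 * b1) * (a2 * (b2 * S b3) * S a3)))))"
    have "sw \<one> p b (\<lambda>v b3. sw p ?r v (\<lambda>b1 b2. S (a1 * b1) * (a2 * (b2 * S b3) * S a3)))
      = S (a1 * b) * (a2 * un ?r * S a3)" for a1 a2 a3
    proof -
      have "sw \<one> p b (\<lambda>v b3. sw p ?r v (\<lambda>b1 b2. S (a1 * b1) * (a2 * (b2 * S b3) * S a3)))
        = sw p \<one> b (\<lambda>b1 v. sw ?r p v (\<lambda>b2 b3. S (a1 * b1) * (a2 * (b2 * S b3) * S a3)))"
        using sw_coassoc[of p ?r p "\<lambda>b1 b2 b3. S (a1 * b1) * (a2 * (b2 * S b3) * S a3)" b]
        by (simp add: lin_simps')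
      also have "\<dots> = sw p \<one> b (\<lambda>b1 v. eps v *\<^sub>C (S (a1 * b1) * (a2 * un ?r * S a3)))"
        using sw_S_right_apply[of ?r "\<lambda>z. S (a1 * b1) * (a2 * z * S a3)" for b1]
        by (simp add: clinear_iff lin_simps')
      also have "\<dots> = S (a1 * b) * (a2 * un ?r * S a3)"
        using sw_eps_right_apply[of p "\<lambda>b1. S (a1 * b1) * (a2 * un ?r * S a3)" b] b
        by (simp add: clinear_iff lin_simps' un_right)
      finally show ?thesis .
    qed
    then have "M = sw \<one> p a (\<lambda>w a3. sw p ?r w (\<lambda>a1 a2. S (a1 * b) * (a2 * un ?r * S a3)))"
      by (simp only: M_def)
    also have "\<dots> = sw p \<one> a (\<lambda>a1 w. sw ?r p w (\<lambda>a2 a3. S (a1 * b) * (a2 * un ?r * S a3)))"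
      using sw_coassoc[of p ?r p "\<lambda>a1 a2 a3. S (a1 * b) * (a2 * un ?r * S a3)" a]
      by (simp add: lin_simps')
    also have "\<dots> = sw p \<one> a (\<lambda>a1 w. sw ?r p w (\<lambda>a2 a3. S (a1 * b) * (a2 * S a3)))"
      using sw_cong[of ?r p "\<lambda>a2 a3. S (a1 * b) * (a2 * un ?r * S a3)" "\<lambda>a2 a3. S (a1 * b) * (a2 * S a3)" for a1]
      by (simp add: lin_simps' un_right)
    also have "\<dots> = sw p \<one> a (\<lambda>a1 w. eps w *\<^sub>C (S (a1 * b) * un ?r))"
      using sw_S_right_apply[of ?r "\<lambda>z. S (a1 * b) * z" for a1]
      by (simp add: clinear_iff lin_simps')
    also have "\<dots> = S (a * b) * un ?r"
      using sw_eps_right_apply[of p "\<lambda>a1. S (a1 * b) * un ?r" a] a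
      by (simp add: clinear_iff lin_simps' un_right)
    also have "\<dots> = S (a * b)"
      using S_restrict[OF p, of "a * b"] b by (simp add: mult.assoc un_right)
    finally have 1: "M = S (a * b)" .
    \<comment> \<open>Second evaluation: the two inner coproducts merge into \<Delta>(wv), and
      S((wv)_1)(wv)_2 collapses to \<epsilon>(wv) = \<epsilon>(w)\<epsilon>(v).\<close>
    have "sw p ?r w (\<lambda>a1 a2. sw \<one> p b (\<lambda>v b3. sw p ?r v (\<lambda>b1 b2. S (a1 * b1) * (a2 * (b2 * S b3) * S a3))))
      = eps w *\<^sub>C (un ?r * (S b * S a3))" for w a3
    proof -
      have "sw p ?r w (\<lambda>a1 a2. sw \<one> p b (\<lambda>v b3. sw p ?r v (\<lambda>b1 b2. S (a1 * b1) * (a2 * (b2 * S b3) * S a3))))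
        = sw \<one> p b (\<lambda>v b3. sw p ?r w (\<lambda>a1 a2. sw p ?r v (\<lambda>b1 b2. (S (a1 * b1) * (a2 * b2)) * (S b3 * S a3))))"
        by (simp only: tsum_swap[of "cop p ?r w" "cop \<one> p b"] mult.assoc)
      also have "\<dots> = sw \<one> p b (\<lambda>v b3. sw p ?r (w * v) (\<lambda>x y. (S x * y) * (S b3 * S a3)))"
        by (subst sw_times) (simp_all add: lin_simps')
      also have "\<dots> = sw \<one> p b (\<lambda>v b3. eps v *\<^sub>C (eps w *\<^sub>C (un ?r * (S b3 * S a3))))"
        using sw_S_left_apply[of ?r "\<lambda>z. z * (S b3 * S a3)" for b3]
        by (simp add: clinear_mult_right eps_mult scaleC_scaleC mult.commute)
      also have "\<dots> = eps w *\<^sub>C (un ?r * (S b * S a3))"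
        using sw_eps_left_apply[of p "\<lambda>b3. eps w *\<^sub>C (un ?r * (S b3 * S a3))" b] b
        by (simp add: clinear_iff lin_simps' un_right)
      finally show ?thesis .
    qed
    then have "M = sw \<one> p a (\<lambda>w a3. eps w *\<^sub>C (un ?r * (S b * S a3)))" by (simp only: M_def)
    also have "\<dots> = un ?r * (S b * S a)"
      using sw_eps_left_apply[of p "\<lambda>a3. un ?r * (S b * S a3)" a] a
      by (simp add: clinear_iff lin_simps' un_right)
    also have "\<dots> = S b * S a"
      using S_in[OF p b] by (simp add: mult.assoc[symmetric] un_left)
    finally show ?thesis using 1 by simp
  qed
  show ?thesis
  proof (induct a rule: component_induct)
    case (component p a)
    note a = this
    show ?case
    proof (induct b rule: component_induct)
      case (component q b)
      show ?case
      proof (cases "p = q")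
        case True
        then show ?thesis using * a component by simp
      next
        case False
        then have "inv p \<noteq> inv q" using a component by (metis inv_inv)
        then have "S b * S a = 0"
          using component_orthogonal[of "inv q" "inv p" "S b" "S a"] S_in a component by simp
        then show ?thesis
          using component_orthogonal[OF a(1) component(1) False a(2) component(2)] clinear_0[OF clinear_S] by simp
      qed
    qed (simp add: distrib_left distrib_right S_add)
  qed (simp add: distrib_left distrib_right S_add)
qed

text \<open>\<open>\<Delta>(S(a\<^sub>1))(a\<^sub>2 \<otimes> 1) = 1 \<otimes> S(a)\<close>; both sides are obtained from
  \<open>\<Delta>(S(a\<^sub>1)) \<Delta>(a\<^sub>2) (1 \<otimes> S(a\<^sub>3))\<close>.\<close>

lemma sw_cop_S:
  assumes [simp]: "p \<in> carrier G" "q \<in> carrier G" and f: "bilinear f"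
  shows "sw (inv (p \<otimes> q)) p a (\<lambda>a1 a2. sw p q (S a1) (\<lambda>x y. f (x * a2) y))
    = f (un p) (S a * un q)"
proof -
  let ?r = "inv (p \<otimes> q)"
  note fl = f[unfolded bilinear_iff]
  have fe: "f (x + x') = (\<lambda>y. f x y + f x' y)" "f (c *\<^sub>C x) = (\<lambda>y. c *\<^sub>C f x y)" for x x' c
    by (simp_all add: fun_eq_iff fl)
  have g1: "?r \<otimes> (p \<otimes> q) = \<one>" by simp
  have g2: "(p \<otimes> q) \<otimes> inv q = p" by (simp add: m_assoc)
  define M where "M = sw \<one> (inv q) a (\<lambda>w a3. sw ?r (p \<otimes> q) w (\<lambda>u v.
    sw p q (S u) (\<lambda>x y. sw p q v (\<lambda>x' y'. f (x * x') (y * y' * S a3)))))"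
  have "M = sw \<one> (inv q) a (\<lambda>w a3. sw ?r (p \<otimes> q) w (\<lambda>u v.
    sw p q (S u * v) (\<lambda>x y. f x (y * S a3))))"
    unfolding M_def by (subst sw_times) (simp_all add: fl lin_simps')
  also have "\<dots> = sw \<one> (inv q) a (\<lambda>w a3. eps w *\<^sub>C f (un p) (un q * S a3))"
  proof -
    have b: "bilinear (\<lambda>x y. f x (y * S a3))" for a3 by (simp add: fl lin_simps')
    have "clinear (\<lambda>z. sw p q z (\<lambda>x y. f x (y * S a3)))" for a3
      by (simp add: clinear_iff sw_linear[OF b])
    from sw_S_left_apply[of "p \<otimes> q", OF _ this] show ?thesis
      by (simp add: sw_un[OF _ _ b])
  qed
  also have "\<dots> = f (un p) (un q * S (a * un (inv q)))"
    by (rule sw_eps_left_apply) (simp_all add: clinear_iff fl lin_simps')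
  also have "\<dots> = f (un p) (S a * un q)"
  proof -
    have "un q * (S a * un q) = S a * un q" using un_central[of q "S a"] un_idem[of q] by (metis mult.assoc assms(2))
    then show ?thesis by (simp add: S_restrict)
  qed
  finally have 1: "M = f (un p) (S a * un q)" .
  \<comment> \<open>Second evaluation: regrouped so that \<open>v\<close> and \<open>a3\<close> come
    from one element \<open>w\<close>; then the second leg of \<open>v\<close> cancels against
    S(a3).\<close>
  have "M = sw (?r \<otimes> (p \<otimes> q)) (inv q) a (\<lambda>w a3. sw ?r (p \<otimes> q) w (\<lambda>u v.
    sw p q (S u) (\<lambda>x y. sw p q v (\<lambda>x' y'. f (x * x') (y * y' * S a3)))))"
    unfolding M_def g1 ..
  also have "\<dots> = sw ?r ((p \<otimes> q) \<otimes> inv q) a (\<lambda>u w. sw (p \<otimes> q) (inv q) w (\<lambda>v a3.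
    sw p q (S u) (\<lambda>x y. sw p q v (\<lambda>x' y'. f (x * x') (y * y' * S a3)))))"
  proof (rule sw_coassoc)
    have b1: "bilinear (\<lambda>x' y'. f (x * x') (y * y' * S z))" for x y z by (simp add: fl lin_simps')
    have b2: "bilinear (\<lambda>x y. sw p q v (\<lambda>x' y'. f (x * x') (y * y' * S z)))" for v z
      by (simp add: fl lin_simps')
    show "trilinear (\<lambda>u v a3. sw p q (S u) (\<lambda>x y. sw p q v (\<lambda>x' y'. f (x * x') (y * y' * S a3))))"
      unfolding trilinear_iff
      by (simp add: sw_linear[OF b2] sw_linear[OF b1] S_add S_scale fl mult_linear_simps)
  qed simp_all
  also have "\<dots> = sw ?r p a (\<lambda>u w. sw p q (S u) (\<lambda>x y.
      sw (p \<otimes> q) (inv q) w (\<lambda>v a3. sw p q v (\<lambda>x' y'. f (x * x') (y * y' * S a3)))))"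
    unfolding g2 by (simp only: tsum_swap[of "cop (p \<otimes> q) (inv q) _" "cop p q (S _)"])
  also have "\<dots> = sw ?r p a (\<lambda>u w. sw p q (S u) (\<lambda>x y. f (x * (w * un p)) (y * un q)))"
  proof -
    have "sw (p \<otimes> q) (inv q) w (\<lambda>v a3. sw p q v (\<lambda>x' y'. f (x * x') (y * y' * S a3)))
      = f (x * (w * un p)) (y * un q)" for x y w
    proof -
      have "sw (p \<otimes> q) (inv q) w (\<lambda>v a3. sw p q v (\<lambda>x' y'. f (x * x') (y * y' * S a3)))
        = sw p (q \<otimes> inv q) w (\<lambda>x' z. sw q (inv q) z (\<lambda>y' a3. f (x * x') (y * y' * S a3)))"
        by (rule sw_coassoc) (simp_all add: fl lin_simps')
      also have "\<dots> = sw p \<one> w (\<lambda>x' z. eps z *\<^sub>C f (x * x') (y * un q))"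
        using sw_S_right_apply[of q "\<lambda>z. f (x * x') (y * z)" for x']
        by (simp add: clinear_iff fl mult_linear_simps mult.assoc)
      also have "\<dots> = f (x * (w * un p)) (y * un q)"
        by (rule sw_eps_right_apply) (simp_all add: clinear_iff fl mult_linear_simps)
      finally show ?thesis .
    qed
    then show ?thesis by simp
  qed
  also have "\<dots> = sw ?r p a (\<lambda>u w. sw p q (S u) (\<lambda>x y. f (x * w) y))"
  proof (rule sw_cong)
    have b: "bilinear (\<lambda>x y. f (x * w) (y * u))" "bilinear (\<lambda>x y. f (x * w) y)" for w u
      by (simp_all add: fl lin_simps')
    show "bilinear (\<lambda>u w. sw p q (S u) (\<lambda>x y. f (x * (w * un p)) (y * un q)))"
      "bilinear (\<lambda>u w. sw p q (S u) (\<lambda>x y. f (x * w) y))"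
      by (simp_all add: bilinear_iff sw_linear[OF b(1)] sw_linear[OF b(2)] S_add S_scale fe mult_linear_simps)
    fix u w assume "w \<in> A p"
    then show "sw p q (S u) (\<lambda>x y. f (x * (w * un p)) (y * un q)) = sw p q (S u) (\<lambda>x y. f (x * w) y)"
      using b by (intro sw_cong) (simp_all add: un_right)
  qed simp_all
  finally show ?thesis using 1 by simp
qed

text \<open>Multiply the identity of \<open>sw_cop_S\<close> by S(a_3) \<otimes> 1 on the right.
  Collapsing a_2 S(a_3) leaves \<Delta>(S(a)), while \<open>sw_cop_S\<close> itself yields S(a_2)
  \<otimes> S(a_1).\<close>

lemma sw_S:
  assumes [simp]: "p \<in> carrier G" "q \<in> carrier G" and f: "bilinear f"
  shows "sw p q (S a) f = sw (inv q) (inv p) a (\<lambda>x y. f (S y) (S x))"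
proof -
  let ?r = "inv (p \<otimes> q)"
  note fl = f[unfolded bilinear_iff]
  have fe: "f (x + x') = (\<lambda>y. f x y + f x' y)" "f (c *\<^sub>C x) = (\<lambda>y. c *\<^sub>C f x y)" for x x' c
    by (simp_all add: fun_eq_iff fl)
  have g: "?r \<otimes> p = inv q" by (simp add: inv_mult_group m_assoc)
  have b1: "bilinear (\<lambda>x y. f (x * u) y)" for u by (simp add: fl lin_simps')
  have b2: "bilinear (\<lambda>u v. f (u * w) v)" for w by (simp add: fl lin_simps')
  define M where "M = sw (inv q) (inv p) a (\<lambda>w a3. sw ?r p w (\<lambda>a1 a2.
    sw p q (S a1) (\<lambda>x y. f (x * a2 * S a3) y)))"
  have "M = sw (inv q) (inv p) a (\<lambda>w a3. f (un p * S a3) (S w * un q))"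
    unfolding M_def using sw_cop_S[of p q "\<lambda>u v. f (u * S z) v" for z] by (simp add: b2)
  also have "\<dots> = sw (inv q) (inv p) a (\<lambda>x y. f (S y) (S x))"
  proof (rule sw_cong)
    fix x y assume "x \<in> A (inv q)" "y \<in> A (inv p)"
    then show "f (un p * S y) (S x * un q) = f (S y) (S x)"
      using S_in[of "inv q" x] S_in[of "inv p" y] by (simp add: un_left un_right)
  qed (simp_all add: fl lin_simps')
  finally have 1: "M = \<dots>" .
  have "M = sw (?r \<otimes> p) (inv p) a (\<lambda>w a3. sw ?r p w (\<lambda>a1 a2.
    sw p q (S a1) (\<lambda>x y. f (x * a2 * S a3) y)))"
    unfolding M_def g ..
  also have "\<dots> = sw ?r (p \<otimes> inv p) a (\<lambda>a1 w. sw p (inv p) w (\<lambda>a2 a3.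
    sw p q (S a1) (\<lambda>x y. f (x * a2 * S a3) y)))"
  proof (rule sw_coassoc)
    have b: "bilinear (\<lambda>x y. f (x * u * w) y)" for u w by (simp add: fl lin_simps')
    show "trilinear (\<lambda>a1 a2 a3. sw p q (S a1) (\<lambda>x y. f (x * a2 * S a3) y))"
      unfolding trilinear_iff
      by (simp add: sw_linear[OF b] S_add S_scale fe mult_linear_simps)
  qed simp_all
  also have "\<dots> = sw ?r \<one> a (\<lambda>a1 w. sw p q (S a1) (\<lambda>x y.
    sw p (inv p) w (\<lambda>a2 a3. f (x * (a2 * S a3)) y)))"
    by (simp add: tsum_swap[of "cop p (inv p) _" "cop p q (S _)"] mult.assoc)
  also have "\<dots> = sw ?r \<one> a (\<lambda>a1 w. eps w *\<^sub>C sw p q (S a1) (\<lambda>x y. f (x * un p) y))"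
    using sw_S_right_apply[of p "\<lambda>z. f (x * z) y" for x y]
    by (simp add: clinear_iff fl mult_linear_simps)
  also have "\<dots> = sw p q (S (a * un ?r)) (\<lambda>x y. f (x * un p) y)"
    by (rule sw_eps_right_apply) (simp_all add: clinear_iff sw_linear[OF b1] S_add S_scale)
  also have "\<dots> = sw p q (S a) (\<lambda>x y. f (x * un p) y)"
    by (simp add: S_restrict cop_restrict)
  also have "\<dots> = sw p q (S a) f"
    by (rule sw_cong) (simp_all add: f b1 un_right)
  finally show ?thesis using 1 by simp
qed

text \<open>This is \<open>sw_cop_S\<close> at S(a), with \<Delta>(S(a)) rewritten by
  \<open>sw_S\<close>. In this form S^2 enters the invariance of the trace.\<close>

lemma sw_cop_SS:
  assumes [simp]: "p \<in> carrier G" "q \<in> carrier G" and f: "bilinear f"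
  shows "sw (inv p) (p \<otimes> q) a (\<lambda>u v. sw p q (S (S v)) (\<lambda>x y. f (x * S u) y))
    = f (un p) (S (S a) * un q)"
proof -
  note fl = f[unfolded bilinear_iff]
  have fe: "f (x + x') = (\<lambda>y. f x y + f x' y)" "f (c *\<^sub>C x) = (\<lambda>y. c *\<^sub>C f x y)" for x x' c
    by (simp_all add: fun_eq_iff fl)
  have b: "bilinear (\<lambda>x y. f (x * u) y)" for u by (simp add: fl lin_simps')
  have "bilinear (\<lambda>a1 a2. sw p q (S a1) (\<lambda>x y. f (x * a2) y))"
    unfolding bilinear_iff by (simp add: sw_linear[OF b] S_add S_scale fe mult_linear_simps)
  from sw_S[OF _ _ this, of "inv (p \<otimes> q)" p a] show ?thesis
    using sw_cop_S[of p q f "S a"] f by simp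
qed

text \<open>For uniqueness, one antipode identity prescribes the left action of S'(a) on the range
  of T, the other its right action on the range of a \<otimes> b \<mapsto> (a \<otimes>
  1)\<Delta>(b); both maps are onto.\<close>

lemma antipode_eq: "antipode \<Delta> = (\<lambda>a. mult_of (S a))"
  unfolding antipode_def
proof (rule the_equality)
  have b: "bilinear (\<lambda>x y. S x * y)" "bilinear (\<lambda>x y. x * S y)" by (simp_all add: lin_simps')
  have L: "tsum (left_cov \<Delta> b a) (\<lambda>x y. x * S y) = eps a *\<^sub>C b" for a b
  proof (induct b rule: component_induct)
    case (component p b)
    note b' = this
    show ?case
    proof (induct a rule: component_induct)
      case (component q a)
      have l: "tsum (left_cov \<Delta> b a) (\<lambda>x y. x * S y) = b * sw p (inv p \<otimes> q) a (\<lambda>u v. u * S v)"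
        using left_cov_components[OF b'(1) component(1) b'(2) component(2) b(2)]
        by (simp add: tsum_linear[OF clinear_mult_left] mult.assoc)
      show ?case
      proof (cases "q = \<one>")
        case True
        then show ?thesis using l b' by (simp add: sw_S_right scaleC_mult_right un_right)
      next
        case False
        have ne: "p \<noteq> inv (inv p \<otimes> q)"
        proof
          assume "p = inv (inv p \<otimes> q)"
          then have "p = inv q \<otimes> p" using b'(1) component(1) by (simp add: inv_mult_group)
          then have "inv q = \<one>" using b'(1) component(1) by (metis inv_closed r_cancel_one')
          then show False using False component(1) by (metis inv_inv inv_one)
        qed
        have "sw p (inv p \<otimes> q) a (\<lambda>u v. u * S v) = sw p (inv p \<otimes> q) a (\<lambda>u v. 0)"
        proof (rule sw_cong)
          fix x y assume "x \<in> A p" "y \<in> A (inv p \<otimes> q)"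
          then show "x * S y = 0"
            using component_orthogonal[OF b'(1) _ ne] S_in[of "inv p \<otimes> q" y] b'(1) component(1) by simp
        qed (use b'(1) component(1) in \<open>simp_all add: lin_simps'\<close>)
        then show ?thesis using l eps_other[OF component(1) False component(2)] by simp
      qed
    next
      case (add x y)
      then show ?case using bilinear_left_cov
        by (simp add: bilinear_iff tsum_plus_tensor[OF b(2)] eps_add scaleC_add_left)
    qed
  next
    case (add x y)
    then show ?case using bilinear_left_cov
      by (simp add: bilinear_iff tsum_plus_tensor[OF b(2)] scaleC_add_right)
  qed
  have mult: "mult_of (x * y) = mult_of x * mult_of y" for x y :: 'a
    by (rule multiplier_eqI) (simp_all add: mult.assoc)
  have lin: "clinear (\<lambda>a. mult_of (S a))"
    using clinear_mult_of[where 'a='a] clinear_S by (simp add: clinear_iff)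
  show "is_antipode \<Delta> (\<lambda>a. mult_of (S a))"
    unfolding is_antipode_def counit_eq
    by (simp add: lin S_mult mult lact_mult_of[abs_def] S_right_cov L tsum_eq_lift[symmetric] b)
  fix S' assume S': "is_antipode \<Delta> S'"
  then have lin': "clinear S'" by (simp add: is_antipode_def)
  note mlin = clinear_simps[OF lact_linear] clinear_simps[OF ract_linear]
  have b': "bilinear (\<lambda>x y. lact (S' x) y)" "bilinear (\<lambda>x y. ract x (S' y))"
    by (simp_all add: bilinear_iff clinear_simps[OF lin'] mlin)
  have "(\<lambda>t. tensor_lift (\<lambda>x y. lact (S' x) y) (galois t)) = (\<lambda>t. tensor_lift (\<lambda>x y. S x * y) (galois t))"
    using clinear_tensor_lift[OF b'(1)] clinear_tensor_lift[OF b(1)] clinear_galois S'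
    by (intro clinear_tensor_eqI)
      (auto simp: clinear_iff is_antipode_def galois_tens S_right_cov tsum_eq_lift[symmetric] b counit_eq)
  then have 1: "tensor_lift (\<lambda>x y. lact (S' x) y) t = tensor_lift (\<lambda>x y. S x * y) t" for t
    by (metis galois_galois_inv)
  have *: "(\<lambda>t. tensor_lift (\<lambda>x y. ract x (S' y)) (tensor_lift (left_cov \<Delta>) t))
      = (\<lambda>t. tensor_lift (\<lambda>x y. x * S y) (tensor_lift (left_cov \<Delta>) t))"
    using clinear_tensor_lift[OF b'(2)] clinear_tensor_lift[OF b(2)] clinear_tensor_lift[OF bilinear_left_cov] S'
    by (intro clinear_tensor_eqI)
      (auto simp: clinear_iff is_antipode_def tensor_lift[OF bilinear_left_cov] L tsum_eq_lift[symmetric] b counit_eq)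
  have 2: "tensor_lift (\<lambda>x y. ract x (S' y)) t = tensor_lift (\<lambda>x y. x * S y) t" for t
  proof -
    obtain s where "t = tensor_lift (left_cov \<Delta>) s" using bij_is_surj[OF bij_left_cov] by blast
    then show ?thesis using fun_cong[OF *, of s] by simp
  qed
  show "S' = (\<lambda>a. mult_of (S a))"
  proof (rule ext, rule multiplier_eqI)
    show "lact (S' a) x = lact (mult_of (S a)) x" for a x
      using 1[of "a \<otimes>\<^sub>T x"] by (simp add: tensor_lift[OF b'(1)] tensor_lift[OF b(1)])
    show "ract x (S' a) = ract x (mult_of (S a))" for a x
      using 2[of "x \<otimes>\<^sub>T a"] by (simp add: tensor_lift[OF b'(2)] tensor_lift[OF b(2)])
  qed
qed

section \<open>Integrals\<close>

text \<open>Left invariance stated without multipliers; \<open>left_integral_iff\<close> relates it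
  to the slices in M(A).\<close>

definition left_invariant :: "('a \<Rightarrow> complex) \<Rightarrow> bool"
  where "left_invariant \<phi> \<longleftrightarrow> clinear \<phi> \<and> (\<forall>p\<in>carrier G. \<forall>q\<in>carrier G. \<forall>a\<in>A (p \<otimes> q).
    rslice \<phi> (cop p q a) = \<phi> a *\<^sub>C un p)"

section \<open>From slices in the multiplier algebra to invariance on components\<close>

lemma bilinear_slices:
  assumes "clinear \<phi>"
  shows "bilinear (\<lambda>x y. \<phi> y *\<^sub>C (x::'x::complex_vector))" "bilinear (\<lambda>x y. \<phi> x *\<^sub>C (y::'x))"
  by (simp_all add: bilinear_iff clinear_simps[OF assms] scaleC_add_left
      scaleC_add_right scaleC_scaleC mult.commute)

text \<open>The left action determines the right one, because (tm)e = t(me) for each e = 1_p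
  \<otimes> 1_q.\<close>

lemma multiplier_eq_lact:
  fixes m n :: "('a, 'a) tensor multiplier"
  assumes "\<And>p q x y. p \<in> carrier G \<Longrightarrow> q \<in> carrier G \<Longrightarrow> x \<in> A p \<Longrightarrow> y \<in> A q \<Longrightarrow>
    lact m (x \<otimes>\<^sub>T y) = lact n (x \<otimes>\<^sub>T y)"
  shows "m = n"
proof (rule multiplier_eqI)
  show *: "lact m t = lact n t" for t
    by (induct t rule: tensor_component_induct) (simp_all add: assms clinear_add[OF lact_linear])
  show "ract t m = ract t n" for t
    by (rule tensor_eqI) (simp add: mult_lact[symmetric] *)
qed

lemma multiplier_eq_ract:
  fixes m n :: "('a, 'a) tensor multiplier"
  assumes "\<And>p q x y. p \<in> carrier G \<Longrightarrow> q \<in> carrier G \<Longrightarrow> x \<in> A p \<Longrightarrow> y \<in> A q \<Longrightarrow>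
    ract (x \<otimes>\<^sub>T y) m = ract (x \<otimes>\<^sub>T y) n"
  shows "m = n"
proof (rule multiplier_eqI)
  show *: "ract t m = ract t n" for t
    by (induct t rule: tensor_component_induct) (simp_all add: assms clinear_add[OF ract_linear])
  show "lact m t = lact n t" for t
    by (rule tensor_eqI) (simp add: un_tens_central mult_lact *)
qed

text \<open>The factor \<open>b\<close> lets only components with first index p survive, and
  \<open>a\<close> in A_{pq} then forces the second index to be q; so the multiplier is an element
  of A \<otimes> A.\<close>

lemma comult_left_component:
  assumes p: "p \<in> carrier G" and q: "q \<in> carrier G" and a: "a \<in> A (p \<otimes> q)" and b: "b \<in> A p"
  shows "\<Delta> a * (mult_of b \<otimes>\<^sub>M 1) = mult_of (cop p q a * (b \<otimes>\<^sub>T un q))"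
proof (rule multiplier_eq_lact)
  fix p' q' x y assume p': "p' \<in> carrier G" and q': "q' \<in> carrier G" and x: "x \<in> A p'" and y: "y \<in> A q'"
  have l: "lact (\<Delta> a * (mult_of b \<otimes>\<^sub>M 1)) (x \<otimes>\<^sub>T y) = lact (\<Delta> a) ((b * x) \<otimes>\<^sub>T y)"
    by (simp add: lact_multiplier_tens)
  have r: "lact (mult_of (cop p q a * (b \<otimes>\<^sub>T un q))) (x \<otimes>\<^sub>T y) = cop p q a * ((b * x) \<otimes>\<^sub>T (un q * y))"
    by (simp add: times_tensor_tens mult.assoc)
  show "lact (\<Delta> a * (mult_of b \<otimes>\<^sub>M 1)) (x \<otimes>\<^sub>T y) = lact (mult_of (cop p q a * (b \<otimes>\<^sub>T un q))) (x \<otimes>\<^sub>T y)"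
  proof (cases "p' = p")
    case False
    then show ?thesis unfolding l r using component_orthogonal[OF p p' _ b x] clinear_0[OF lact_linear] by simp
  next
    case True
    then have "lact (\<Delta> a) ((b * x) \<otimes>\<^sub>T y) = cop p q' a * ((b * x) \<otimes>\<^sub>T y)"
      using p q' b x y component_mult by (intro lact_comult tensor_span_I) auto
    then show ?thesis unfolding l r
      using cop_other[OF p q' _ a] un_left_other[OF q q' _ y] un_left[OF q] p q q' y by (cases "q' = q") auto
  qed
qed

lemma comult_right_component:
  assumes p: "p \<in> carrier G" and q: "q \<in> carrier G" and a: "a \<in> A (p \<otimes> q)" and b: "b \<in> A q"
  shows "(1 \<otimes>\<^sub>M mult_of b) * \<Delta> a = mult_of ((un p \<otimes>\<^sub>T b) * cop p q a)"
proof (rule multiplier_eq_ract)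
  fix p' q' x y assume p': "p' \<in> carrier G" and q': "q' \<in> carrier G" and x: "x \<in> A p'" and y: "y \<in> A q'"
  have l: "ract (x \<otimes>\<^sub>T y) ((1 \<otimes>\<^sub>M mult_of b) * \<Delta> a) = ract (x \<otimes>\<^sub>T (y * b)) (\<Delta> a)"
    by (simp add: ract_multiplier_tens)
  have r: "ract (x \<otimes>\<^sub>T y) (mult_of ((un p \<otimes>\<^sub>T b) * cop p q a)) = ((x * un p) \<otimes>\<^sub>T (y * b)) * cop p q a"
    by (simp add: times_tensor_tens mult.assoc[symmetric])
  show "ract (x \<otimes>\<^sub>T y) ((1 \<otimes>\<^sub>M mult_of b) * \<Delta> a) = ract (x \<otimes>\<^sub>T y) (mult_of ((un p \<otimes>\<^sub>T b) * cop p q a))"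
  proof (cases "q' = q")
    case False
    then show ?thesis unfolding l r using component_orthogonal[OF q' q _ y b] clinear_0[OF ract_linear] by simp
  next
    case True
    then have "ract (x \<otimes>\<^sub>T (y * b)) (\<Delta> a) = (x \<otimes>\<^sub>T (y * b)) * cop p' q a"
      using p' q b x y component_mult by (intro ract_comult tensor_span_I) auto
    then show ?thesis unfolding l r
      using cop_other[OF p' q _ a] un_right_other[OF p p' _ x] un_right[OF p] p p' q x by (cases "p' = p") auto
  qed
qed

lemma comult_left_range: "\<Delta> a * (mult_of b \<otimes>\<^sub>M 1) \<in> range mult_of"
proof (induct a rule: component_induct)
  case (component r a)
  note a = this
  show ?case
  proof (induct b rule: component_induct)
    case (component p b)
    then show ?case
      using comult_left_component[of p "inv p \<otimes> r" a b] a by (simp add: m_assoc[symmetric])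
  next
    case (add x y)
    then obtain s t where "\<Delta> a * (mult_of x \<otimes>\<^sub>M 1) = mult_of s" "\<Delta> a * (mult_of y \<otimes>\<^sub>M 1) = mult_of t" by blast
    then have "\<Delta> a * (mult_of (x + y) \<otimes>\<^sub>M 1) = mult_of (s + t)"
      using bilinear_multiplier_tens clinear_mult_of[where 'a = 'a] clinear_mult_of[where 'a = "('a, 'a) tensor"]
      by (simp add: clinear_iff bilinear_multiplier_tens[unfolded bilinear_iff] distrib_left)
    then show ?case by blast
  qed
next
  case (add x y)
  then obtain s t where "\<Delta> x * (mult_of b \<otimes>\<^sub>M 1) = mult_of s" "\<Delta> y * (mult_of b \<otimes>\<^sub>M 1) = mult_of t" by blast
  then have "\<Delta> (x + y) * (mult_of b \<otimes>\<^sub>M 1) = mult_of (s + t)"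
    using comult_linear clinear_mult_of[where 'a = "('a, 'a) tensor"]
    by (simp add: clinear_iff distrib_right)
  then show ?case by blast
qed

definition comult_left :: "'a \<Rightarrow> 'a \<Rightarrow> ('a, 'a) tensor"
  where "comult_left a b = alg_of (\<Delta> a * (mult_of b \<otimes>\<^sub>M 1))"

lemma mult_of_comult_left: "mult_of (comult_left a b) = \<Delta> a * (mult_of b \<otimes>\<^sub>M 1)"
proof -
  obtain t where "\<Delta> a * (mult_of b \<otimes>\<^sub>M 1) = mult_of t" using comult_left_range[of a b] by blast
  then show ?thesis by (simp add: comult_left_def)
qed

lemma bilinear_comult_left: "bilinear comult_left"
proof -
  have eqI: "mult_of s = mult_of t \<Longrightarrow> s = t" for s t :: "('a, 'a) tensor"
    using inj_mult_of_tensor by (rule injD)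
  note lin = clinear_simps[OF clinear_mult_of] clinear_simps[OF comult_linear] bilinear_multiplier_tens[unfolded bilinear_iff]
  show ?thesis
    unfolding bilinear_iff
    by (intro conjI allI eqI) (simp_all add: mult_of_comult_left lin mult_linear_simps)
qed

lemma comult_left_slice:
  assumes p: "p \<in> carrier G" and q: "q \<in> carrier G" and a: "a \<in> A (p \<otimes> q)" and b: "b \<in> A p"
    and \<phi>: "clinear \<phi>"
  shows "rslice \<phi> (comult_left a b) = rslice \<phi> (cop p q a) * b"
    and "rslice \<phi> (left_cov \<Delta> b a) = b * rslice \<phi> (cop p q a)"
proof -
  note lin = clinear_simps[OF \<phi>]
  note bl = bilinear_slices[OF \<phi>, where 'x = 'a]
  have e: "comult_left a b = cop p q a * (b \<otimes>\<^sub>T un q)"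
    by (simp add: comult_left_def comult_left_component[OF assms(1-4)])
  have "rslice \<phi> (comult_left a b) = sw p q a (\<lambda>x y. \<phi> (y * un q) *\<^sub>C (x * b))"
    by (subst e, subst tsum_times[OF bl(1)], subst tsum_of_tens) (simp_all add: lin_simps lin)
  also have "\<dots> = sw p q a (\<lambda>x y. \<phi> y *\<^sub>C (x * b))"
    using p q by (intro sw_cong) (simp_all add: lin_simps lin un_right)
  finally show "rslice \<phi> (comult_left a b) = rslice \<phi> (cop p q a) * b"
    by (simp add: tsum_linear[OF clinear_mult_right] scaleC_mult_left)
  show "rslice \<phi> (left_cov \<Delta> b a) = b * rslice \<phi> (cop p q a)"
    using sw_left_cov[OF p q b a bl(1)] by (simp add: tsum_linear[OF clinear_mult_left] scaleC_mult_right)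
qed

text \<open>For a in A_r the slice acts on each A_p as multiplication by one element
  \<open>w p\<close>. Since infinitely many \<open>w p\<close> may be non-zero, they are assembled
  into a double centralizer instead of an element of the algebra.\<close>

lemma slice_right_exists:
  assumes \<phi>: "clinear \<phi>"
  shows "\<exists>m. \<forall>b. lact m b = rslice \<phi> (comult_left a b) \<and>
    ract b m = rslice \<phi> (left_cov \<Delta> b a)"
proof (induct a rule: component_induct)
  case (component r a)
  note r = component(1) and a = component(2)
  note bl = bilinear_slices[OF \<phi>, where 'x = 'a]
  let ?L = "\<lambda>b. rslice \<phi> (comult_left a b)" and ?R = "\<lambda>b. rslice \<phi> (left_cov \<Delta> b a)"
  have lin: "clinear ?L" "clinear ?R"
    using bilinear_comult_left bilinear_left_cov
    by (simp_all add: clinear_iff bilinear_iff tsum_linear_tensor[OF bl(1)])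
  define w where "w p = rslice \<phi> (cop p (inv p \<otimes> r) a)" for p
  have LR: "?L b = w p * b" "?R b = b * w p" if "p \<in> carrier G" "b \<in> A p" for p b
    using comult_left_slice[of p "inv p \<otimes> r" a b] that r a \<phi> by (simp_all add: w_def m_assoc[symmetric])
  have orth: "x * (w p' * y) = 0" "x * w p * y = 0" "x * y = 0"
    if "p \<in> carrier G" "p' \<in> carrier G" "p \<noteq> p'" "x \<in> A p" "y \<in> A p'" for p p' x y
  proof -
    \<comment> \<open>Centrality of 1_{p'} stands in for a proof that \<open>w p'\<close> lies in
      A_{p'}.\<close>
    have "w p' * y = un p' * (w p' * y)"
      using that by (metis mult.assoc un_central un_left)
    then show "x * (w p' * y) = 0"
      using un_right_other[of p' p x] that by (metis mult.assoc mult_zero_left)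
    have "x * w p = x * w p * un p"
      using that by (metis mult.assoc un_central un_right)
    then show "x * w p * y = 0"
      using un_left_other[of p p' y] that by (metis mult.assoc mult_zero_right)
    show "x * y = 0" using component_orthogonal that by blast
  qed
  note lins = clinear_add[OF lin(1)] clinear_add[OF lin(2)]
  have 1: "?L (x * y) = ?L x * y" for x y
  proof (induct x rule: component_induct)
    case (component p x)
    note x = this
    show ?case
    proof (induct y rule: component_induct)
      case (component p' y)
      then show ?case
        using x LR orth(3)[of p p' x y] clinear_0[OF lin(1)] component_mult
        by (cases "p = p'") (simp_all add: mult.assoc)
    qed (simp add: distrib_left lins)
  qed (simp add: distrib_right lins)
  have 2: "?R (x * y) = x * ?R y" for x y
  proof (induct x rule: component_induct)
    case (component p x)
    note x = this
    show ?case
    proof (induct y rule: component_induct)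
      case (component p' y)
      then show ?case
        using x LR orth(3)[of p p' x y] clinear_0[OF lin(2)] component_mult
        by (cases "p = p'") (simp_all add: mult.assoc[symmetric])
    qed (simp add: distrib_left lins)
  qed (simp add: distrib_right lins)
  have 3: "x * ?L y = ?R x * y" for x y
  proof (induct x rule: component_induct)
    case (component p x)
    note x = this
    show ?case
    proof (induct y rule: component_induct)
      case (component p' y)
      then show ?case
        using x LR orth(1,2)[of p p' x y] by (cases "p = p'") (simp_all add: mult.assoc)
    qed (simp add: distrib_left lins)
  qed (simp add: distrib_right lins)
  have "(?L, ?R) \<in> {(L, R). clinear L \<and> clinear R \<and> (\<forall>(x::'a) y. L (x * y) = L x * y) \<and>
      (\<forall>x y. R (x * y) = x * R y) \<and> (\<forall>x y. x * L y = R x * y)}"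
    using lin 1 2 3 by simp
  then show ?case
    by (intro exI[of _ "Abs_multiplier (?L, ?R)"]) (simp add: lact.rep_eq ract.rep_eq Abs_multiplier_inverse)
next
  case (add x y)
  then obtain m n where m: "\<forall>b. lact m b = rslice \<phi> (comult_left x b) \<and>
      ract b m = rslice \<phi> (left_cov \<Delta> b x)"
    and n: "\<forall>b. lact n b = rslice \<phi> (comult_left y b) \<and>
      ract b n = rslice \<phi> (left_cov \<Delta> b y)" by blast
  note bl = bilinear_slices[OF \<phi>, where 'x = 'a]
  show ?case
    using m n bilinear_comult_left bilinear_left_cov
    by (intro exI[of _ "m + n"]) (simp add: bilinear_iff tsum_plus_tensor[OF bl(1)])
qed

lemma slice_right:
  assumes \<phi>: "clinear \<phi>"
  shows "lact (slice_right \<Delta> \<phi> a) b = rslice \<phi> (comult_left a b) \<and>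
    ract b (slice_right \<Delta> \<phi> a) = rslice \<phi> (left_cov \<Delta> b a)"
proof -
  let ?P = "\<lambda>m. \<forall>b. lact m b = rslice \<phi> (comult_left a b) \<and>
    ract b m = rslice \<phi> (left_cov \<Delta> b a)"
  have "slice_right \<Delta> \<phi> a = (THE m. ?P m)"
    by (simp add: slice_right_def tsum_eq_lift[OF bilinear_slices(1)[OF \<phi>]] comult_left_def left_cov_def)
  moreover have "\<exists>!m. ?P m"
    using slice_right_exists[OF \<phi>, of a] by (auto intro!: multiplier_eqI)
  ultimately show ?thesis using theI'[of ?P] by simp
qed

text \<open>Evaluating the slice at 1_p isolates \<Delta>_{p,q}(a). Conversely,
  \<open>comult_left_slice\<close> computes both actions of the slice on every component.\<close>

lemma left_integral_iff: "left_integral \<Delta> \<phi> \<longleftrightarrow> left_invariant \<phi> \<and> \<phi> \<noteq> (\<lambda>x. 0)"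
proof (cases "clinear \<phi>")
  case False
  then show ?thesis by (simp add: left_integral_def left_invariant_def)
next
  case \<phi>: True
  note bl = bilinear_slices[OF \<phi>, where 'x = 'a]
  have "(\<forall>a. slice_right \<Delta> \<phi> a = \<phi> a *\<^sub>C 1) \<longleftrightarrow> left_invariant \<phi>"
  proof
    assume *: "\<forall>a. slice_right \<Delta> \<phi> a = \<phi> a *\<^sub>C 1"
    have "rslice \<phi> (cop p q a) = \<phi> a *\<^sub>C un p"
      if p: "p \<in> carrier G" and q: "q \<in> carrier G" and a: "a \<in> A (p \<otimes> q)" for p q a
    proof -
      have "left_cov \<Delta> (un p) a = cop p q a"
        using left_cov_eq[OF p q un_in[OF p] a] un_mult_cop[OF p q] by simp
      then show ?thesis using slice_right[OF \<phi>, of a "un p", THEN conjunct2] * by simp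
    qed
    then show "left_invariant \<phi>" using \<phi> by (simp add: left_invariant_def)
  next
    assume *: "left_invariant \<phi>"
    have **: "rslice \<phi> (comult_left a b) = \<phi> a *\<^sub>C b \<and>
      rslice \<phi> (left_cov \<Delta> b a) = \<phi> a *\<^sub>C b" for a b
    proof (induct a rule: component_induct)
      case (component r a)
      note a = this
      show ?case
      proof (induct b rule: component_induct)
        case (component p b)
        have "a \<in> A (p \<otimes> (inv p \<otimes> r))" using a component by (simp add: m_assoc[symmetric])
        then show ?case
          using comult_left_slice[of p "inv p \<otimes> r" a b] \<phi> * component a
          by (simp add: left_invariant_def scaleC_mult_left scaleC_mult_right un_left un_right)
      qed (use bilinear_comult_left bilinear_left_cov in
          \<open>simp add: bilinear_iff tsum_plus_tensor[OF bl(1)] scaleC_add_right\<close>)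
    qed (use bilinear_comult_left bilinear_left_cov in
          \<open>simp add: bilinear_iff tsum_plus_tensor[OF bl(1)] clinear_add[OF \<phi>] scaleC_add_left\<close>)
    show "\<forall>a. slice_right \<Delta> \<phi> a = \<phi> a *\<^sub>C 1"
      using slice_right[OF \<phi>] ** by (auto intro!: multiplier_eqI)
  qed
  then show ?thesis using \<phi> by (auto simp: left_integral_def)
qed

lemma right_integralI:
  assumes \<psi>: "clinear \<psi>" "\<psi> \<noteq> (\<lambda>x. 0)"
    and inv: "\<And>p q a. p \<in> carrier G \<Longrightarrow> q \<in> carrier G \<Longrightarrow> a \<in> A (p \<otimes> q) \<Longrightarrow>
      lslice \<psi> (cop p q a) = \<psi> a *\<^sub>C un q"
  shows "right_integral \<Delta> \<psi>"
proof -
  note bl = bilinear_slices[OF \<psi>(1), where 'x = 'a]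
  note lin = clinear_simps[OF \<psi>(1)]
  \<comment> \<open>\<open>slice_left\<close> reaches (1 \<otimes> b)\<Delta>(a) through
    \<open>alg_of\<close>, so the induction carries an explicit tensor \<open>t\<close> that
    represents this multiplier.\<close>
  have comp: "lslice \<psi> (right_cov \<Delta> a b) = \<psi> a *\<^sub>C b \<and>
      (\<exists>t. (1 \<otimes>\<^sub>M mult_of b) * \<Delta> a = mult_of t \<and> lslice \<psi> t = \<psi> a *\<^sub>C b)" for a b
  proof (induct a rule: component_induct)
    case (component r a)
    note a = this
    show ?case
    proof (induct b rule: component_induct)
      case (component q b)
      let ?p = "r \<otimes> inv q"
      have p: "?p \<in> carrier G" using a component by simp
      have a': "a \<in> A (?p \<otimes> q)" using a component by (simp add: m_assoc)
      have e: "right_cov \<Delta> a b = cop ?p q a * (un ?p \<otimes>\<^sub>T b)" "(1 \<otimes>\<^sub>M mult_of b) * \<Delta> a = mult_of ((un ?p \<otimes>\<^sub>T b) * cop ?p q a)"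
        using right_cov_eq[OF p component(1) a' component(2)] comult_right_component[OF p component(1) a' component(2)] by auto
      have "lslice \<psi> (cop ?p q a * (un ?p \<otimes>\<^sub>T b)) = sw ?p q a (\<lambda>x y. \<psi> (x * un ?p) *\<^sub>C (y * b))"
        by (subst tsum_times[OF bl(2)], subst tsum_of_tens) (simp_all add: lin_simps lin)
      also have "\<dots> = sw ?p q a (\<lambda>x y. \<psi> x *\<^sub>C (y * b))"
        using p component by (intro sw_cong) (simp_all add: lin_simps lin un_right)
      also have "\<dots> = \<psi> a *\<^sub>C b"
        using inv[OF p component(1) a'] tsum_linear[OF clinear_mult_right[of b], of "cop ?p q a" "\<lambda>x y. \<psi> x *\<^sub>C y"] component
        by (simp add: scaleC_mult_left un_left)
      finally have 1: "lslice \<psi> (cop ?p q a * (un ?p \<otimes>\<^sub>T b)) = \<psi> a *\<^sub>C b" .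
      have "lslice \<psi> ((un ?p \<otimes>\<^sub>T b) * cop ?p q a) = sw ?p q a (\<lambda>x y. \<psi> (un ?p * x) *\<^sub>C (b * y))"
        by (subst tsum_times[OF bl(2)], subst tsum_of_tens) (simp_all add: lin_simps lin)
      also have "\<dots> = sw ?p q a (\<lambda>x y. \<psi> x *\<^sub>C (b * y))"
        using p component by (intro sw_cong) (simp_all add: lin_simps lin un_left)
      also have "\<dots> = \<psi> a *\<^sub>C b"
        using inv[OF p component(1) a'] tsum_linear[OF clinear_mult_left[of b], of "cop ?p q a" "\<lambda>x y. \<psi> x *\<^sub>C y"] component
        by (simp add: scaleC_mult_right un_right)
      finally show ?case using 1 e by auto
    next
      case (add x y)
      then obtain s t where st: "(1 \<otimes>\<^sub>M mult_of x) * \<Delta> a = mult_of s" "lslice \<psi> s = \<psi> a *\<^sub>C x"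
        "(1 \<otimes>\<^sub>M mult_of y) * \<Delta> a = mult_of t" "lslice \<psi> t = \<psi> a *\<^sub>C y" by blast
      have "(1 \<otimes>\<^sub>M mult_of (x + y)) * \<Delta> a = mult_of (s + t)"
        by (simp add: clinear_add[OF clinear_mult_of] bilinear_multiplier_tens[unfolded bilinear_iff] distrib_right st)
      then show ?case using add st bilinear_right_cov
        by (auto simp: bilinear_iff tsum_plus_tensor[OF bl(2)] scaleC_add_right intro!: exI[of _ "s + t"])
    qed
  next
    case (add x y)
    then obtain s t where st: "(1 \<otimes>\<^sub>M mult_of b) * \<Delta> x = mult_of s" "lslice \<psi> s = \<psi> x *\<^sub>C b"
      "(1 \<otimes>\<^sub>M mult_of b) * \<Delta> y = mult_of t" "lslice \<psi> t = \<psi> y *\<^sub>C b" by blast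
    have "(1 \<otimes>\<^sub>M mult_of b) * \<Delta> (x + y) = mult_of (s + t)"
      by (simp add: clinear_add[OF clinear_mult_of] clinear_add[OF comult_linear] distrib_left st)
    then show ?case using add st bilinear_right_cov
      by (auto simp: bilinear_iff tsum_plus_tensor[OF bl(2)] scaleC_add_left lin intro!: exI[of _ "s + t"])
  qed
  have "slice_left \<Delta> \<psi> a = \<psi> a *\<^sub>C 1" for a
    unfolding slice_left_def
  proof (rule the_equality)
    have *: "lact (\<psi> a *\<^sub>C 1) b = tensor_lift (\<lambda>x y. \<psi> x *\<^sub>C y) (alg_of (\<Delta> a * (1 \<otimes>\<^sub>M mult_of b))) \<and>
      ract b (\<psi> a *\<^sub>C 1) = tensor_lift (\<lambda>x y. \<psi> x *\<^sub>C y) (alg_of ((1 \<otimes>\<^sub>M mult_of b) * \<Delta> a))" for b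
      using comp[of a b] by (auto simp: tsum_eq_lift[OF bl(2)] right_cov_def)
    then show "\<forall>b. lact (\<psi> a *\<^sub>C 1) b = tensor_lift (\<lambda>x y. \<psi> x *\<^sub>C y) (alg_of (\<Delta> a * (1 \<otimes>\<^sub>M mult_of b))) \<and>
      ract b (\<psi> a *\<^sub>C 1) = tensor_lift (\<lambda>x y. \<psi> x *\<^sub>C y) (alg_of ((1 \<otimes>\<^sub>M mult_of b) * \<Delta> a))" by blast
    fix m assume m: "\<forall>b. lact m b = tensor_lift (\<lambda>x y. \<psi> x *\<^sub>C y) (alg_of (\<Delta> a * (1 \<otimes>\<^sub>M mult_of b))) \<and>
      ract b m = tensor_lift (\<lambda>x y. \<psi> x *\<^sub>C y) (alg_of ((1 \<otimes>\<^sub>M mult_of b) * \<Delta> a))"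
    show "m = \<psi> a *\<^sub>C 1"
    proof (rule multiplier_eqI)
      show "lact m b = lact (\<psi> a *\<^sub>C 1) b" for b
        by (rule trans[OF conjunct1[OF spec[OF m]] conjunct1[OF *, symmetric]])
      show "ract b m = ract b (\<psi> a *\<^sub>C 1)" for b
        by (rule trans[OF conjunct2[OF spec[OF m]] conjunct2[OF *, symmetric]])
    qed
  qed
  then show ?thesis using \<psi> by (simp add: right_integral_def)
qed

section \<open>The left integral as a trace\<close>

lemma S_un: "p \<in> carrier G \<Longrightarrow> S (un p) = un (inv p)"
proof -
  assume p [simp]: "p \<in> carrier G"
  have b: "bilinear (\<lambda>x y. S x * y)" by (simp add: lin_simps')
  have "S (un p) * un (inv p) = un (inv p)"
    using sw_S_left[of "inv p" "un (p \<otimes> inv p)"] sw_un[OF _ _ b, of p "inv p"]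
    by (simp add: eps_un scaleC_one)
  then show ?thesis using S_in[OF p un_in[OF p]] by (simp add: un_right)
qed

text \<open>The restriction to \<^term>\<open>A q\<close> of the left integral \<open>x \<mapsto> Tr (a \<mapsto> x S\<^sup>2(a\<^sub>1) f(a\<^sub>2))\<close>.\<close>

definition trace_integral ::
  "('a \<Rightarrow> complex) \<Rightarrow> 'a set \<Rightarrow> ('a \<Rightarrow> 'a \<Rightarrow> complex) \<Rightarrow> 'g \<Rightarrow> 'a \<Rightarrow> complex"
  where "trace_integral f B d q x =
    (\<Sum>i\<in>B. d i (sw q \<one> i (\<lambda>u v. f v *\<^sub>C (x * S (S u)))))"

lemma dual_basisD:
  assumes "dual_basis V B d"
  shows "finite B" "b \<in> B \<Longrightarrow> b \<in> V" "clinear (d b)"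
    "x \<in> V \<Longrightarrow> (\<Sum>b\<in>B. d b x *\<^sub>C b) = x"
    "b \<in> B \<Longrightarrow> c \<in> B \<Longrightarrow> d b c = (if b = c then 1 else 0)"
  using assms unfolding dual_basis_def by auto

text \<open>Cyclicity of the trace takes the form of an expansion over the basis \<open>C\<close> of
  A_{pq} followed by a summation over the basis \<open>B\<close> of A_q.\<close>

lemma trace_integral_invariant:
  assumes p [simp]: "p \<in> carrier G" and q [simp]: "q \<in> carrier G" and a: "a \<in> A (p \<otimes> q)"
    and f: "clinear f" and B: "dual_basis (A q) B d" and C: "dual_basis (A (p \<otimes> q)) C c"
  shows "sw p q a (\<lambda>x y. trace_integral f B d q y *\<^sub>C x) = trace_integral f C c (p \<otimes> q) a *\<^sub>C un p"
proof -
  note fl = clinear_simps[OF f]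
  note dl = clinear_simps[OF dual_basisD(3)[OF B]]
  note cl = clinear_simps[OF dual_basisD(3)[OF C]]
  have g: "inv p \<otimes> (p \<otimes> q) = q" by (simp add: m_assoc[symmetric])
  define G1 where "G1 i u1 = (\<lambda>x y. d i y *\<^sub>C (x * S u1))" for i u1
  have G1: "bilinear (G1 i u1)" for i u1 by (simp add: G1_def lin_simps' dl)
  \<comment> \<open>The trace of \<open>K\<close> on A_{pq} is the value of the integral at
    \<open>a\<close>.\<close>
  define K where "K w = sw (p \<otimes> q) \<one> w (\<lambda>u v. f v *\<^sub>C (a * S (S u)))" for w
  have bK: "bilinear (\<lambda>u v. f v *\<^sub>C (a * S (S u)))" by (simp add: lin_simps' fl)
  have K: "clinear K" by (simp add: clinear_iff K_def sw_linear[OF bK])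
  have K_in: "K w \<in> A (p \<otimes> q)" for w
  proof -
    have "un (p \<otimes> q) * K w = K w"
      unfolding K_def by (simp add: tsum_linear[OF clinear_mult_left] scaleC_mult_right mult.assoc[symmetric] un_left a)
    then show ?thesis by (metis un_mult_in m_closed p q)
  qed
  \<comment> \<open>\<Delta>(a)(1 \<otimes> S^2(u)) = \<Delta>(a S^2(u_2))(S(u_1) \<otimes> 1) by
    \<open>sw_cop_SS\<close>, with \<open>d i\<close> applied to the second leg.\<close>
  have inner: "sw p q a (\<lambda>x y. d i (y * S (S u)) *\<^sub>C x)
    = sw (inv p) (p \<otimes> q) u (\<lambda>u1 u2. sw p q (a * S (S u2)) (G1 i u1))" for i u
  proof -
    have "sw p q a (\<lambda>x y. d i (y * S (S u)) *\<^sub>C x)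
      = sw p q a (\<lambda>x y. d i (y * (S (S u) * un q)) *\<^sub>C (x * un p))"
    proof (rule sw_cong)
      fix x y assume "x \<in> A p" "y \<in> A q"
      then show "d i (y * S (S u)) *\<^sub>C x = d i (y * (S (S u) * un q)) *\<^sub>C (x * un p)"
        by (simp add: un_right) (metis mult.assoc un_central un_right q)
    qed (simp_all add: lin_simps' dl)
    also have "\<dots> = sw p q a (\<lambda>x y. sw (inv p) (p \<otimes> q) u (\<lambda>u1 u2.
        sw p q (S (S u2)) (\<lambda>s t. d i (y * t) *\<^sub>C (x * (s * S u1)))))"
      using sw_cop_SS[OF p q, of "\<lambda>s t. d i (y * t) *\<^sub>C (x * s)" u for x y]
      by (simp add: lin_simps' dl)
    also have "\<dots> = sw (inv p) (p \<otimes> q) u (\<lambda>u1 u2. sw p q a (\<lambda>x y.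
        sw p q (S (S u2)) (\<lambda>s t. d i (y * t) *\<^sub>C (x * s * S u1))))"
      by (simp only: tsum_swap[of "cop p q a" "cop (inv p) (p \<otimes> q) u"] mult.assoc)
    also have "\<dots> = sw (inv p) (p \<otimes> q) u (\<lambda>u1 u2. sw p q (a * S (S u2)) (G1 i u1))"
      by (simp add: sw_times[OF p q G1]) (simp add: G1_def)
    finally show ?thesis .
  qed
  have step: "sw q \<one> i (\<lambda>u v. f v *\<^sub>C sw p q a (\<lambda>x y. d i (y * S (S u)) *\<^sub>C x))
    = sw (inv p) (p \<otimes> q) i (\<lambda>u1 w. sw p q (K w) (G1 i u1))" for i
  proof -
    have G1': "G1 i (x + y) = (\<lambda>s t. G1 i x s t + G1 i y s t)" "G1 i (k *\<^sub>C x) = (\<lambda>s t. k *\<^sub>C G1 i x s t)" for x y k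
      by (simp_all add: G1_def lin_simps' fun_eq_iff)
    have "sw q \<one> i (\<lambda>u v. f v *\<^sub>C sw p q a (\<lambda>x y. d i (y * S (S u)) *\<^sub>C x))
      = sw (inv p \<otimes> (p \<otimes> q)) \<one> i (\<lambda>u v. sw (inv p) (p \<otimes> q) u (\<lambda>u1 u2.
          f v *\<^sub>C sw p q (a * S (S u2)) (G1 i u1)))"
      unfolding g by (simp add: inner)
    also have "\<dots> = sw (inv p) ((p \<otimes> q) \<otimes> \<one>) i (\<lambda>u1 w. sw (p \<otimes> q) \<one> w (\<lambda>u2 v.
          f v *\<^sub>C sw p q (a * S (S u2)) (G1 i u1)))"
    proof (rule sw_coassoc)
      show "trilinear (\<lambda>u1 u2 v. f v *\<^sub>C sw p q (a * S (S u2)) (G1 i u1))"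
        unfolding trilinear_iff
        by (simp add: G1' sw_linear[OF G1] S_add S_scale mult_linear_simps fl
            scaleC_add_left scaleC_add_right scaleC_scaleC mult.commute)
    qed simp_all
    also have "\<dots> = sw (inv p) (p \<otimes> q) i (\<lambda>u1 w. sw p q (K w) (G1 i u1))"
    proof -
      have l: "clinear (\<lambda>z. sw p q z (G1 i u1))" for u1
        by (simp add: clinear_iff sw_linear[OF G1])
      show ?thesis by (simp add: K_def tsum_linear[OF l] sw_scale[OF G1])
    qed
    finally show ?thesis .
  qed
  \<comment> \<open>Expanding K(w) in the basis \<open>C\<close> turns it into the scalars
    c_j(K(w)), so that the coproduct acts on the basis vectors \<open>j\<close> only.\<close>
  have expand: "sw p q (K w) (G1 i u1) = (\<Sum>j\<in>C. sw p q j (\<lambda>x y. d i y *\<^sub>C (c j (K w) *\<^sub>C (x * S u1))))" for i u1 w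
  proof -
    have l: "clinear (\<lambda>z. sw p q z (G1 i u1))"
      by (simp add: clinear_iff sw_linear[OF G1])
    show ?thesis
      by (subst dual_basis_expand[OF C l K_in])
        (simp add: G1_def tsum_scale[symmetric] scaleC_scaleC mult.commute del: tsum_scale)
  qed
  have "sw p q a (\<lambda>x y. trace_integral f B d q y *\<^sub>C x)
    = (\<Sum>i\<in>B. sw q \<one> i (\<lambda>u v. f v *\<^sub>C sw p q a (\<lambda>x y. d i (y * S (S u)) *\<^sub>C x)))"
  proof -
    have "sw p q a (\<lambda>x y. trace_integral f B d q y *\<^sub>C x)
      = (\<Sum>i\<in>B. sw p q a (\<lambda>x y. sw q \<one> i (\<lambda>u v. f v *\<^sub>C (d i (y * S (S u)) *\<^sub>C x))))"
      by (simp add: trace_integral_def tsum_linear[OF dual_basisD(3)[OF B]] complex_vector.scale_sum_left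
          tsum_sum tsum_linear[OF clinear_scaleC_left] dl scaleC_scaleC)
    then show ?thesis
      by (simp add: tsum_swap[of "cop p q a" "cop q \<one> _"] tsum_scale_mult(1))
  qed
  also have "\<dots> = (\<Sum>i\<in>B. \<Sum>j\<in>C. sw p q j (\<lambda>x y. d i y *\<^sub>C
      sw (inv p) (p \<otimes> q) i (\<lambda>u1 w. c j (K w) *\<^sub>C (x * S u1))))"
    by (simp add: step expand tsum_sum tsum_swap[of "cop (inv p) (p \<otimes> q) _" "cop p q _"] tsum_scale_mult(1))
  also have "\<dots> = (\<Sum>j\<in>C. sw p q j (\<lambda>x y. \<Sum>i\<in>B. d i y *\<^sub>C
      sw (inv p) (p \<otimes> q) i (\<lambda>u1 w. c j (K w) *\<^sub>C (x * S u1))))"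
    by (subst sum.swap) (simp add: tsum_sum)
  \<comment> \<open>The sum over \<open>B\<close> is the expansion of the second leg
    \<open>y\<close> of \<open>j\<close>; it disappears, and \<open>y\<close> takes the place of
    \<open>i\<close>.\<close>
  also have "\<dots> = (\<Sum>j\<in>C. sw p q j (\<lambda>x y.
      sw (inv p) (p \<otimes> q) y (\<lambda>u1 w. c j (K w) *\<^sub>C (x * S u1))))"
  proof (rule sum.cong[OF refl], rule sw_cong)
    fix j
    have b: "bilinear (\<lambda>u1 w. c j (K w) *\<^sub>C (x * S u1))" for x
      by (simp add: lin_simps' cl clinear_simps[OF K])
    note swb = sw_linear[OF b]
    show "bilinear (\<lambda>x y. sw (inv p) (p \<otimes> q) y (\<lambda>u1 w. c j (K w) *\<^sub>C (x * S u1)))"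
      by (simp add: bilinear_iff swb mult_linear_simps scaleC_add_right scaleC_scaleC mult.commute tsum_scale_mult)
    show "bilinear (\<lambda>x y. \<Sum>i\<in>B. d i y *\<^sub>C sw (inv p) (p \<otimes> q) i (\<lambda>u1 w. c j (K w) *\<^sub>C (x * S u1)))"
      by (simp add: bilinear_iff swb mult_linear_simps dl scaleC_add_left scaleC_add_right scaleC_scaleC
        mult.commute tsum_scale_mult sum.distrib complex_vector.scale_sum_right)
    fix x y assume y: "y \<in> A q"
    have "clinear (\<lambda>y. sw (inv p) (p \<otimes> q) y (\<lambda>u1 w. c j (K w) *\<^sub>C (x * S u1)))"
      by (simp add: clinear_iff swb)
    from dual_basis_expand[OF B this y]
    show "(\<Sum>i\<in>B. d i y *\<^sub>C sw (inv p) (p \<otimes> q) i (\<lambda>u1 w. c j (K w) *\<^sub>C (x * S u1)))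
      = sw (inv p) (p \<otimes> q) y (\<lambda>u1 w. c j (K w) *\<^sub>C (x * S u1))" by simp
  qed simp_all
  \<comment> \<open>What remains is c_j(K(j_3)) j_1 S(j_2), where j_1 S(j_2) collapses and leaves
    the trace of \<open>K\<close>.\<close>
  also have "\<dots> = (\<Sum>j\<in>C. c j (K j) *\<^sub>C un p)"
  proof (rule sum.cong[OF refl])
    fix j assume j: "j \<in> C"
    have "sw p q j (\<lambda>x y. sw (inv p) (p \<otimes> q) y (\<lambda>u1 w. c j (K w) *\<^sub>C (x * S u1)))
      = sw (p \<otimes> inv p) (p \<otimes> q) j (\<lambda>z w. sw p (inv p) z (\<lambda>x u1. c j (K w) *\<^sub>C (x * S u1)))"
      using sw_coassoc[of p "inv p" "p \<otimes> q" "\<lambda>x u1 w. c j (K w) *\<^sub>C (x * S u1)" j]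
      by (simp add: g lin_simps' cl clinear_simps[OF K])
    also have "\<dots> = sw \<one> (p \<otimes> q) j (\<lambda>z w. eps z *\<^sub>C (c j (K w) *\<^sub>C un p))"
      by (simp add: sw_S_right scaleC_scaleC mult.commute)
    also have "\<dots> = c j (K (j * un (p \<otimes> q))) *\<^sub>C un p"
      by (rule sw_eps_left_apply)
        (simp_all add: clinear_iff cl clinear_simps[OF K] scaleC_add_left scaleC_scaleC)
    finally show "sw p q j (\<lambda>x y. sw (inv p) (p \<otimes> q) y (\<lambda>u1 w. c j (K w) *\<^sub>C (x * S u1)))
      = c j (K j) *\<^sub>C un p"
      using dual_basisD(2)[OF C j] by (simp add: un_right)
  qed
  finally show ?thesis
    by (simp add: trace_integral_def K_def complex_vector.scale_sum_left)
qed

text \<open>If \<open>\<Sum>\<^sub>i e\<^sup>i(x S\<^sup>2(e\<^sub>i\<^sub>1)) e\<^sub>i\<^sub>2 = 0\<close> for all \<open>x\<close> and dual bases \<open>e\<^sub>i\<close>, \<open>e\<^sup>i\<close>, then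
  \<open>x = \<Sum>\<^sub>i e\<^sup>i(x S(e\<^sub>i\<^sub>2) S\<^sup>2(e\<^sub>i\<^sub>1)) e\<^sub>i\<^sub>3\<close> vanishes.\<close>

lemma trace_integral_nonzero:
  assumes B: "dual_basis (A \<one>) B d"
  shows "\<exists>f x. clinear f \<and> x \<in> A \<one> \<and> trace_integral f B d \<one> x \<noteq> 0"
proof (rule ccontr)
  assume "\<not> ?thesis"
  then have 0: "trace_integral f B d \<one> x = 0" if "clinear f" "x \<in> A \<one>" for f x using that by blast
  note dl = clinear_simps[OF dual_basisD(3)[OF B]]
  \<comment> \<open>\<open>f (Z x)\<close> is the trace integral for \<open>f\<close> at
    \<open>x\<close>; its vanishing for all \<open>f\<close> forces \<open>Z x\<close> to
    vanish.\<close>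
  define Z where "Z x = (\<Sum>i\<in>B. sw \<one> \<one> i (\<lambda>u v. d i (x * S (S u)) *\<^sub>C v))" for x
  have Z: "Z x = 0" if x: "x \<in> A \<one>" for x
  proof (rule ccontr)
    assume "Z x \<noteq> 0"
    then obtain f :: "'a \<Rightarrow> complex" where f: "clinear f" "f (Z x) = 1" using linear_functional_exists by blast
    have "f (Z x) = trace_integral f B d \<one> x"
      by (simp add: Z_def trace_integral_def clinear_sum[OF f(1)] tsum_linear[OF f(1)]
          tsum_linear[OF dual_basisD(3)[OF B]] clinear_scale[OF f(1)] dl mult.commute)
    then show False using 0[OF f(1) x] f(2) by simp
  qed
  let ?x = "un \<one>"
  have x: "?x \<in> A \<one>" using un_in by simp
  have "?x = (\<Sum>i\<in>B. d i ?x *\<^sub>C i)" using dual_basisD(4)[OF B x] by simp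
  also have "\<dots> = (\<Sum>i\<in>B. sw \<one> \<one> i (\<lambda>w v. sw \<one> \<one> w (\<lambda>u s. d i (?x * S (S u * s)) *\<^sub>C v)))"
  proof (rule sum.cong[OF refl])
    fix i assume i: "i \<in> B"
    have l: "clinear (\<lambda>z. d i (?x * S z) *\<^sub>C v)" for v :: 'a
      by (simp add: clinear_iff S_add S_scale mult_linear_simps dl scaleC_add_left scaleC_scaleC)
    have "sw \<one> \<one> i (\<lambda>w v. sw \<one> \<one> w (\<lambda>u s. d i (?x * S (S u * s)) *\<^sub>C v))
      = sw \<one> \<one> i (\<lambda>w v. eps w *\<^sub>C (d i ?x *\<^sub>C v))"
      using sw_S_left_apply[of \<one>, OF one_closed l] by (simp add: S_un un_idem)
    also have "\<dots> = d i ?x *\<^sub>C (i * un \<one>)"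
      by (rule sw_eps_left_apply) (simp_all add: clinear_scaleC)
    also have "i * un \<one> = i" using dual_basisD(2)[OF B i] by (simp add: un_right)
    finally show "d i ?x *\<^sub>C i = sw \<one> \<one> i (\<lambda>w v. sw \<one> \<one> w (\<lambda>u s. d i (?x * S (S u * s)) *\<^sub>C v))" by simp
  qed
  also have "\<dots> = (\<Sum>i\<in>B. sw \<one> \<one> i (\<lambda>u w. sw \<one> \<one> w (\<lambda>s v. d i (?x * S s * S (S u)) *\<^sub>C v)))"
    using sw_coassoc[OF one_closed one_closed one_closed, of "\<lambda>u s v. d i (?x * S (S u * s)) *\<^sub>C v" for i]
    by (simp add: lin_simps' dl S_mult mult.assoc)
  \<comment> \<open>Expanding \<open>s\<close> in the basis separates S(s) from the sum over
    \<open>i\<close>, which then becomes \<Delta> of Z(1_e S(j)).\<close>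
  also have "\<dots> = (\<Sum>i\<in>B. sw \<one> \<one> i (\<lambda>u w. \<Sum>j\<in>B. d i (?x * S j * S (S u)) *\<^sub>C sw \<one> \<one> w (\<lambda>s v. d j s *\<^sub>C v)))"
  proof (intro sum.cong refl arg_cong[where f = "tsum _"] ext)
    fix i u w
    have "sw \<one> \<one> w (\<lambda>s v. d i (?x * S s * S (S u)) *\<^sub>C v)
      = sw \<one> \<one> w (\<lambda>s v. \<Sum>j\<in>B. d i (?x * S j * S (S u)) *\<^sub>C (d j s *\<^sub>C v))"
    proof (rule sw_cong)
      fix s v assume s: "s \<in> A \<one>"
      have "clinear (\<lambda>s. d i (?x * S s * S (S u)) *\<^sub>C v)"
        by (simp add: clinear_iff S_add S_scale mult_linear_simps dl scaleC_add_left scaleC_scaleC)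
      from dual_basis_expand[OF B this s]
      show "d i (?x * S s * S (S u)) *\<^sub>C v = (\<Sum>j\<in>B. d i (?x * S j * S (S u)) *\<^sub>C (d j s *\<^sub>C v))"
        by (simp add: scaleC_scaleC mult.commute)
    qed (simp_all add: lin_simps' dl sum.distrib complex_vector.scale_sum_right mult.assoc)
    then show "sw \<one> \<one> w (\<lambda>s v. d i (?x * S s * S (S u)) *\<^sub>C v)
      = (\<Sum>j\<in>B. d i (?x * S j * S (S u)) *\<^sub>C sw \<one> \<one> w (\<lambda>s v. d j s *\<^sub>C v))"
      by (simp add: tsum_sum tsum_scale_mult(1))
  qed
  also have "\<dots> = (\<Sum>j\<in>B. \<Sum>i\<in>B. sw \<one> \<one> i (\<lambda>u w. d i (?x * S j * S (S u)) *\<^sub>C sw \<one> \<one> w (\<lambda>s v. d j s *\<^sub>C v)))"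
    by (subst sum.swap) (simp add: tsum_sum)
  also have "\<dots> = (\<Sum>j\<in>B. sw \<one> \<one> (Z (?x * S j)) (\<lambda>s v. d j s *\<^sub>C v))"
  proof (rule sum.cong[OF refl])
    fix j
    have b: "bilinear (\<lambda>s v. d j s *\<^sub>C (v :: 'a))" by (rule bilinear_slices(2)[OF dual_basisD(3)[OF B]])
    have l: "clinear (\<lambda>z. sw \<one> \<one> z (\<lambda>s v. d j s *\<^sub>C v))"
      by (simp add: clinear_iff sw_linear[OF b])
    show "(\<Sum>i\<in>B. sw \<one> \<one> i (\<lambda>u w. d i (?x * S j * S (S u)) *\<^sub>C sw \<one> \<one> w (\<lambda>s v. d j s *\<^sub>C v)))
      = sw \<one> \<one> (Z (?x * S j)) (\<lambda>s v. d j s *\<^sub>C v)"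
      by (simp add: Z_def clinear_sum[OF l] tsum_linear[OF l] sw_scale[OF b])
  qed
  also have "\<dots> = 0"
  proof (rule sum.neutral, rule ballI)
    fix j assume "j \<in> B"
    have b: "bilinear (\<lambda>s v. d j s *\<^sub>C (v :: 'a))" by (rule bilinear_slices(2)[OF dual_basisD(3)[OF B]])
    have "Z (?x * S j) = 0" by (rule Z) (simp add: un_mult_in)
    then show "sw \<one> \<one> (Z (?x * S j)) (\<lambda>s v. d j s *\<^sub>C v) = 0"
      using sw_scale[OF b, of _ _ 0 0] by simp
  qed
  finally show False using un_nonzero[OF one_closed] by simp
qed

text \<open>The same \<open>f\<close> is used in all components; with it,
  \<open>trace_integral_invariant\<close> links the trace over A_q to the one over A_{pq}, whatever
  dual bases are chosen.\<close>

lemma left_integral_exists: "\<exists>\<phi>. left_integral \<Delta> \<phi>"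
proof -
  have "\<forall>q\<in>carrier G. \<exists>B d. dual_basis (A q) B d"
    using dual_basis_exists component_finite by blast
  then obtain B d where B: "\<And>q. q \<in> carrier G \<Longrightarrow> dual_basis (A q) (B q) (d q)" by metis
  obtain f x where f: "clinear f" and x: "x \<in> A \<one>" "trace_integral f (B \<one>) (d \<one>) \<one> x \<noteq> 0"
    using trace_integral_nonzero[OF B[OF one_closed]] by blast
  define \<phi> where "\<phi> = glue (\<lambda>q. trace_integral f (B q) (d q) q)"
  have lin: "clinear (trace_integral f (B q) (d q) q)" if "q \<in> carrier G" for q
    using dual_basisD(3)[OF B[OF that]]
    by (simp add: clinear_iff trace_integral_def mult_linear_simps scaleC_add_right sum.distrib
        scaleC_scaleC sum_distrib_left mult.commute tsum_scale_mult)
  have comp: "\<phi> y = trace_integral f (B q) (d q) q y" if "q \<in> carrier G" "y \<in> A q" for q y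
    unfolding \<phi>_def by (rule glue_component[OF lin that])
  have \<phi>: "clinear \<phi>" unfolding \<phi>_def by (rule clinear_glue[OF lin])
  have "left_invariant \<phi>"
    unfolding left_invariant_def
  proof (intro conjI ballI \<phi>)
    fix p q a assume p: "p \<in> carrier G" and q: "q \<in> carrier G" and a: "a \<in> A (p \<otimes> q)"
    have "rslice \<phi> (cop p q a) = sw p q a (\<lambda>x y. trace_integral f (B q) (d q) q y *\<^sub>C x)"
      using comp q by (intro sw_cong[OF p q] bilinear_slices(1) \<phi> lin) auto
    also have "\<dots> = trace_integral f (B (p \<otimes> q)) (d (p \<otimes> q)) (p \<otimes> q) a *\<^sub>C un p"
      using p q a f B by (intro trace_integral_invariant) auto
    finally show "rslice \<phi> (cop p q a) = \<phi> a *\<^sub>C un p"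
      using comp[of "p \<otimes> q" a] p q a by simp
  qed
  moreover have "\<phi> \<noteq> (\<lambda>x. 0)" using comp[OF one_closed x(1)] x(2) by auto
  ultimately show ?thesis by (auto simp: left_integral_iff)
qed

section \<open>Faithfulness of left integrals, bijectivity of the antipode, right integrals\<close>

lemma left_invariant_linear: "left_invariant \<phi> \<Longrightarrow> clinear \<phi>"
  by (simp add: left_invariant_def)

lemma sw_left_invariant:
  assumes "left_invariant \<phi>" "p \<in> carrier G" "q \<in> carrier G" "a \<in> A (p \<otimes> q)"
  shows "rslice \<phi> (cop p q a) = \<phi> a *\<^sub>C un p"
  using assms by (simp add: left_invariant_def)

text \<open>\<open>\<phi>(x S(a\<^sub>1)) a\<^sub>2\<close> is the slice of \<open>\<Delta>(x S(a\<^sub>1))(a\<^sub>2 \<otimes> 1) = \<Delta>(x)(1 \<otimes> S(a))\<close>.\<close>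

lemma left_invariant_faithful_step:
  assumes \<phi>: "left_invariant \<phi>" and s [simp]: "s \<in> carrier G" and t [simp]: "t \<in> carrier G"
    and 0: "\<And>x. x \<in> A (inv t) \<Longrightarrow> \<phi> (x * S a) = 0" and a: "a \<in> A t" and x: "x \<in> A s"
  shows "sw (inv s) (s \<otimes> t) a (\<lambda>a1 a2. \<phi> (x * S a1) *\<^sub>C a2) = 0"
proof -
  let ?p = "s \<otimes> t" and ?q = "inv t"
  have pq: "?p \<otimes> ?q = s" by (simp add: m_assoc)
  note fl = clinear_simps[OF left_invariant_linear[OF \<phi>]]
  have b: "bilinear (\<lambda>u v. \<phi> v *\<^sub>C (u * a2))" for a2 :: 'a by (simp add: lin_simps' fl)
  have "sw (inv s) ?p a (\<lambda>a1 a2. \<phi> (x * S a1) *\<^sub>C a2)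
    = sw (inv s) ?p a (\<lambda>a1 a2. sw ?p ?q (x * S a1) (\<lambda>u v. \<phi> v *\<^sub>C (u * a2)))"
  proof (rule sw_cong)
    fix a1 a2 assume a1: "a1 \<in> A (inv s)" and a2: "a2 \<in> A ?p"
    have "x * S a1 \<in> A (?p \<otimes> ?q)"
      using S_in[OF _ a1] x component_mult[OF s] by (simp add: pq)
    then have "sw ?p ?q (x * S a1) (\<lambda>u v. \<phi> v *\<^sub>C u) * a2 = \<phi> (x * S a1) *\<^sub>C a2"
      using a2 \<phi> by (simp add: sw_left_invariant scaleC_mult_left un_left)
    then show "\<phi> (x * S a1) *\<^sub>C a2 = sw ?p ?q (x * S a1) (\<lambda>u v. \<phi> v *\<^sub>C (u * a2))"
      by (simp add: tsum_linear[OF clinear_mult_right] scaleC_mult_left)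
  next
    show "bilinear (\<lambda>a1 a2. sw ?p ?q (x * S a1) (\<lambda>u v. \<phi> v *\<^sub>C (u * a2)))"
      by (simp add: bilinear_iff S_add S_scale mult_linear_simps sw_linear[OF b] scaleC_add_right
        scaleC_scaleC mult.commute tsum_scale_mult)
  qed (simp_all add: lin_simps' fl)
  also have "\<dots> = sw (inv s) ?p a (\<lambda>a1 a2. sw ?p ?q x (\<lambda>x1 x2.
      sw ?p ?q (S a1) (\<lambda>u v. \<phi> (x2 * v) *\<^sub>C (x1 * u * a2))))"
    by (simp add: sw_times[OF _ _ b])
  also have "\<dots> = sw ?p ?q x (\<lambda>x1 x2. sw (inv s) ?p a (\<lambda>a1 a2.
      sw ?p ?q (S a1) (\<lambda>u v. \<phi> (x2 * v) *\<^sub>C (x1 * (u * a2)))))"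
    by (simp only: tsum_swap[of "cop (inv s) ?p a"] mult.assoc)
  also have "\<dots> = sw ?p ?q x (\<lambda>x1 x2. \<phi> (x2 * (S a * un ?q)) *\<^sub>C (x1 * un ?p))"
    using sw_cop_S[of ?p ?q "\<lambda>u v. \<phi> (x2 * v) *\<^sub>C (x1 * u)" a for x1 x2]
    by (simp add: pq lin_simps' fl)
  also have "\<dots> = sw ?p ?q x (\<lambda>x1 x2. 0)"
  proof (rule sw_cong)
    fix x1 x2 assume "x2 \<in> A ?q"
    moreover have "S a * un ?q = S a" using S_in[OF t a] by (simp add: un_right)
    ultimately show "\<phi> (x2 * (S a * un ?q)) *\<^sub>C (x1 * un ?p) = 0" using 0 by simp
  qed (simp_all add: lin_simps' fl)
  finally show ?thesis by simp
qed

lemma left_invariant_faithful: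
  assumes \<phi>: "left_invariant \<phi>" "\<phi> \<noteq> (\<lambda>x. 0)" and t [simp]: "t \<in> carrier G"
    and 0: "\<And>x. x \<in> A (inv t) \<Longrightarrow> \<phi> (x * S a) = 0" and a: "a \<in> A t"
  shows "a = 0"
proof -
  note fl = clinear_simps[OF left_invariant_linear[OF \<phi>(1)]]
  have "\<exists>s\<in>carrier G. \<exists>y\<in>A s. \<phi> y \<noteq> 0"
  proof (rule ccontr)
    assume c: "\<not> ?thesis"
    have "\<phi> y = 0" for y by (induct y rule: component_induct) (use c in \<open>auto simp: fl\<close>)
    then show False using \<phi>(2) by auto
  qed
  then obtain s y where s [simp]: "s \<in> carrier G" and y: "y \<in> A s" "\<phi> y \<noteq> 0" by blast
  obtain B d where B: "dual_basis (A s) B d" using dual_basis_exists component_finite[OF s] by blast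
  note dl = clinear_simps[OF dual_basisD(3)[OF B]]
  define P where "P j w = sw s t w (\<lambda>a2 a3. d j (y * S (S a2)) *\<^sub>C a3)" for j w
  have b: "bilinear (\<lambda>a2 a3. d j (y * S (S a2)) *\<^sub>C (a3 :: 'a))" for j
    by (simp add: lin_simps' dl)
  have P: "clinear (P j)" for j by (simp add: clinear_iff P_def sw_linear[OF b])
  \<comment> \<open>Collapsing a_1 S(a_2) shows that \<open>M\<close> is \<phi>(y) a; writing S(a_1
    S(a_2)) as S^2(a_2) S(a_1) will show that it is 0.\<close>
  define M where "M = sw \<one> t a (\<lambda>w a3. sw (inv s) s w (\<lambda>a1 a2. \<phi> (y * S (a1 * S a2)) *\<^sub>C a3))"
  have l: "clinear (\<lambda>z. \<phi> (y * S z) *\<^sub>C a3)" for a3 :: 'a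
    by (simp add: clinear_iff S_add S_scale mult_linear_simps fl scaleC_add_left scaleC_scaleC)
  have "M = sw \<one> t a (\<lambda>w a3. eps w *\<^sub>C (\<phi> y *\<^sub>C a3))"
    using sw_S_right_apply[of "inv s", OF _ l] y by (simp add: M_def S_un un_right)
  also have "\<dots> = \<phi> y *\<^sub>C a"
    using a by (subst sw_eps_left_apply) (simp_all add: clinear_scaleC un_right)
  finally have 1: "M = \<phi> y *\<^sub>C a" .
  have "M = sw (inv s) (s \<otimes> t) a (\<lambda>a1 w. sw s t w (\<lambda>a2 a3. \<phi> (y * S (a1 * S a2)) *\<^sub>C a3))"
    unfolding M_def using sw_coassoc[of "inv s" s t "\<lambda>a1 a2 a3. \<phi> (y * S (a1 * S a2)) *\<^sub>C a3" a]
    by (simp add: lin_simps' fl)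
  \<comment> \<open>Expanding y S^2(a_2) in a basis of A_s detaches it from a_1, and each term
    contains a sum that \<open>left_invariant_faithful_step\<close> annihilates.\<close>
  also have "\<dots> = sw (inv s) (s \<otimes> t) a (\<lambda>a1 w. \<Sum>j\<in>B. \<phi> (j * S a1) *\<^sub>C P j w)"
  proof (intro arg_cong[where f = "tsum _"] ext)
    fix a1 w
    have "sw s t w (\<lambda>a2 a3. \<phi> (y * S (a1 * S a2)) *\<^sub>C a3)
      = sw s t w (\<lambda>a2 a3. \<Sum>j\<in>B. \<phi> (j * S a1) *\<^sub>C (d j (y * S (S a2)) *\<^sub>C a3))"
    proof (rule sw_cong)
      fix a2 a3 assume "a2 \<in> A s"
      then have "y * S (S a2) \<in> A s" using S_in[of s a2] S_in[of "inv s" "S a2"] y component_mult by simp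
      from dual_basis_expand[OF B _ this, of "\<lambda>z. \<phi> (z * S a1) *\<^sub>C a3"]
      show "\<phi> (y * S (a1 * S a2)) *\<^sub>C a3 = (\<Sum>j\<in>B. \<phi> (j * S a1) *\<^sub>C (d j (y * S (S a2)) *\<^sub>C a3))"
        by (simp add: clinear_iff lin_simps' fl S_mult mult.assoc)
    qed (simp_all add: lin_simps' fl dl sum.distrib complex_vector.scale_sum_right mult.assoc)
    then show "sw s t w (\<lambda>a2 a3. \<phi> (y * S (a1 * S a2)) *\<^sub>C a3) = (\<Sum>j\<in>B. \<phi> (j * S a1) *\<^sub>C P j w)"
      by (simp add: tsum_sum P_def tsum_scale_mult(1))
  qed
  also have "\<dots> = (\<Sum>j\<in>B. P j (sw (inv s) (s \<otimes> t) a (\<lambda>a1 w. \<phi> (j * S a1) *\<^sub>C w)))"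
    by (simp add: tsum_sum tsum_linear[OF P] clinear_scale[OF P])
  also have "\<dots> = 0"
    using left_invariant_faithful_step[OF \<phi>(1) s t 0 a] dual_basisD(2)[OF B] clinear_0[OF P] by simp
  finally show ?thesis using 1 y(2) by simp
qed

text \<open>If S(a) = 0, the assumption of \<open>left_invariant_faithful\<close> holds trivially
  for any left integral.\<close>

lemma S_eq_0_imp: "p \<in> carrier G \<Longrightarrow> a \<in> A p \<Longrightarrow> S a = 0 \<Longrightarrow> a = 0"
  using left_integral_exists left_invariant_faithful[of _ p a] clinear_0[OF left_invariant_linear]
  by (auto simp: left_integral_iff)

text \<open>S itself changes the component, so the dimension argument is applied to S^2, an
  injective endomorphism of A_p.\<close>

lemma S_surj:
  assumes p [simp]: "p \<in> carrier G" and b: "b \<in> A p"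
  shows "\<exists>a\<in>A (inv p). b = S a"
proof -
  have "(\<lambda>x. S (S x)) ` A p = A p"
  proof (rule injective_on_finite_dim_imp_surjective[OF component_finite[OF p]])
    show "(\<lambda>x. S (S x)) ` A p \<subseteq> A p" using S_in[of p] S_in[of "inv p"] by auto
    fix x assume "x \<in> A p" "S (S x) = 0"
    then show "x = 0" using S_eq_0_imp[of p x] S_eq_0_imp[of "inv p" "S x"] S_in[of p x] by simp
  qed (simp add: clinear_iff S_add S_scale)
  then show ?thesis using b S_in[OF p] by blast
qed

lemma right_integral_exists: "\<exists>\<psi>. right_integral \<Delta> \<psi>"
proof -
  obtain \<phi> where \<phi>: "left_invariant \<phi>" "\<phi> \<noteq> (\<lambda>x. 0)" using left_integral_exists by (auto simp: left_integral_iff)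
  note fl = clinear_simps[OF left_invariant_linear[OF \<phi>(1)]]
  have "right_integral \<Delta> (\<lambda>a. \<phi> (S a))"
  proof (rule right_integralI)
    show "clinear (\<lambda>a. \<phi> (S a))" by (simp add: clinear_iff S_add S_scale fl)
    show "(\<lambda>a. \<phi> (S a)) \<noteq> (\<lambda>x. 0)"
    proof
      assume 0: "(\<lambda>a. \<phi> (S a)) = (\<lambda>x. 0)"
      have "\<phi> y = 0" for y
        by (induct y rule: component_induct) (use S_surj fun_cong[OF 0] in \<open>auto simp: fl\<close>)
      then show False using \<phi>(2) by auto
    qed
    fix p q a assume p [simp]: "p \<in> carrier G" and q [simp]: "q \<in> carrier G" and a: "a \<in> A (p \<otimes> q)"
    let ?z = "sw p q a (\<lambda>x y. \<phi> (S x) *\<^sub>C y)"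
    have Sa: "S a \<in> A (inv q \<otimes> inv p)" using S_in[OF _ a] by (simp add: inv_mult_group)
    have "S ?z = sw p q a (\<lambda>x y. \<phi> (S x) *\<^sub>C S y)"
      by (simp add: tsum_linear[OF clinear_S] S_scale)
    also have "\<dots> = rslice \<phi> (cop (inv q) (inv p) (S a))"
      using sw_S[of "inv q" "inv p" "\<lambda>x y. \<phi> y *\<^sub>C x" a] by (simp add: lin_simps' fl)
    also have "\<dots> = \<phi> (S a) *\<^sub>C S (un q)"
      using sw_left_invariant[OF \<phi>(1) _ _ Sa] by (simp add: S_un)
    \<comment> \<open>Right invariance of \<phi> \<circ> S is first obtained under S, where it is
      the left invariance of \<phi>. Injectivity of S on A_q removes S, once both terms are known to
      lie in A_q.\<close>
    finally have 1: "S (?z - \<phi> (S a) *\<^sub>C un q) = 0"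
      by (simp add: complex_vector.linear_diff[OF clinear_S] S_scale)
    have "?z * un q = sw p q a (\<lambda>x y. \<phi> (S x) *\<^sub>C (y * un q))"
      by (simp add: tsum_linear[OF clinear_mult_right] scaleC_mult_left)
    also have "\<dots> = ?z"
      by (rule sw_cong) (simp_all add: lin_simps' fl un_right)
    finally have "?z \<in> A q" by (simp add: component_iff un_central)
    then have "?z - \<phi> (S a) *\<^sub>C un q \<in> A q"
      using component_subspace[OF q] un_in[OF q] by (simp add: complex_vector.subspace_diff complex_vector.subspace_scale)
    from S_eq_0_imp[OF q this 1] show "?z = \<phi> (S a) *\<^sub>C un q" by simp
  qed
  then show ?thesis by blast
qed

text \<open>\<open>?h\<close> encodes the functional \<phi>(\<cdot> b) as the element of A_t with
  its values on the basis as coordinates. This makes b \<mapsto> \<phi>(\<cdot> b) an endomorphism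
  of A_t, injective by faithfulness and \<open>S_surj\<close>, hence onto.\<close>

lemma functional_representation:
  assumes \<phi>: "left_invariant \<phi>" "\<phi> \<noteq> (\<lambda>x. 0)" and t [simp]: "t \<in> carrier G" and f: "clinear f"
  shows "\<exists>b\<in>A t. \<forall>x\<in>A t. \<phi> (x * b) = f x"
proof -
  note fl = clinear_simps[OF left_invariant_linear[OF \<phi>(1)]]
  obtain B d where B: "dual_basis (A t) B d" using dual_basis_exists component_finite[OF t] by blast
  have l: "clinear (\<lambda>x. \<phi> (x * b))" for b by (simp add: clinear_iff mult_linear_simps fl)
  have d: "d j (\<Sum>i\<in>B. k i *\<^sub>C i) = k j" if "j \<in> B" for j k
    using that dual_basisD(1)[OF B] dual_basisD(5)[OF B that]
    by (simp add: clinear_sum[OF dual_basisD(3)[OF B]] clinear_scale[OF dual_basisD(3)[OF B]]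
        if_distrib[of "\<lambda>c. k _ * c"] cong: sum.cong if_cong)
  let ?h = "\<lambda>b. \<Sum>i\<in>B. \<phi> (i * b) *\<^sub>C i"
  have "?h ` A t = A t"
  proof (rule injective_on_finite_dim_imp_surjective[OF component_finite[OF t]])
    show "clinear ?h"
      by (simp add: clinear_iff mult_linear_simps fl scaleC_add_left sum.distrib complex_vector.scale_sum_right scaleC_scaleC)
    show "?h ` A t \<subseteq> A t"
      using dual_basisD(2)[OF B] by (auto intro!: component_sum component_scale)
    fix b assume b: "b \<in> A t" and "?h b = 0"
    then have "\<phi> (i * b) = 0" if "i \<in> B" for i
      using d[OF that, of "\<lambda>i. \<phi> (i * b)"] clinear_0[OF dual_basisD(3)[OF B]] by simp
    then have 0: "\<phi> (x * b) = 0" if "x \<in> A t" for x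
      using dual_basis_expand[OF B l that] by simp
    obtain a where a: "a \<in> A (inv t)" "b = S a" using S_surj[OF t b] by blast
    then have "a = 0" using left_invariant_faithful[OF \<phi>, of "inv t" a] 0 by simp
    then show "b = 0" using a(2) clinear_0[OF clinear_S] by simp
  qed
  moreover have "(\<Sum>i\<in>B. f i *\<^sub>C i) \<in> A t"
    using dual_basisD(2)[OF B] by (auto intro!: component_sum component_scale)
  ultimately obtain b where b: "b \<in> A t" "?h b = (\<Sum>i\<in>B. f i *\<^sub>C i)" by (metis (no_types, lifting) imageE)
  have "\<phi> (i * b) = f i" if "i \<in> B" for i
    using d[OF that, of "\<lambda>i. \<phi> (i * b)"] d[OF that, of f] b(2) by simp
  then have "\<phi> (x * b) = f x" if "x \<in> A t" for x
    using dual_basis_expand[OF B l that, of b] dual_basis_expand[OF B f that] by simp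
  then show ?thesis using b(1) by blast
qed

section \<open>The graded dual as a space of functionals\<close>

definition fsupp :: "('a \<Rightarrow> complex) \<Rightarrow> 'g set"
  where "fsupp f = {p \<in> carrier G. \<exists>x\<in>A p. f x \<noteq> 0}"

lemma component_dual_iff:
  "f \<in> component_dual G A p \<longleftrightarrow> clinear f \<and> fsupp f \<subseteq> {p}"
  by (auto simp: component_dual_def fsupp_def)

lemma finite_fsupp_decomposition:
  assumes "clinear f" "finite P" "fsupp f \<subseteq> P" "P \<subseteq> carrier G"
  shows "f = (\<Sum>p\<in>P. (\<lambda>x. f (un p * x)))"
proof
  fix x
  have "f x = (\<Sum>p\<in>P. f (un p * x))"
  proof (induct x rule: component_induct)
    case (component q x)
    have "(\<Sum>p\<in>P. f (un p * x)) = (\<Sum>p\<in>P. if p = q then f x else 0)"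
      using component assms(4) un_left_other[of _ q x] un_left[of q x] clinear_0[OF assms(1)]
      by (intro sum.cong) (auto simp: subset_iff)
    also have "\<dots> = f x" using assms(2,3) component by (auto simp: fsupp_def)
    finally show ?case by simp
  qed (simp add: distrib_left clinear_add[OF assms(1)] sum.distrib)
  then show "f x = (\<Sum>p\<in>P. (\<lambda>x. f (un p * x))) x" by (simp add: sum_apply)
qed

text \<open>Supports grow at most to unions under linear combinations; conversely, a functional of
  finite support is the sum of its pieces x \<mapsto> f(1_p x).\<close>

lemma graded_dual_iff: "f \<in> graded_dual G A \<longleftrightarrow> clinear f \<and> finite (fsupp f)"
proof
  assume "f \<in> graded_dual G A"
  then have "f \<in> cspan (\<Union>p\<in>carrier G. component_dual G A p)" by (simp add: graded_dual_def)
  then show "clinear f \<and> finite (fsupp f)"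
  proof (induct rule: complex_vector.span_induct_alt)
    case base
    show ?case unfolding clinear_iff by (simp add: fsupp_def)
  next
    case (step c g h)
    then have g: "clinear g" "finite (fsupp g)"
      by (auto simp: component_dual_iff intro: finite_subset)
    have "fsupp (c *\<^sub>C g + h) \<subseteq> fsupp g \<union> fsupp h"
      by (auto simp: fsupp_def scaleC_fun_def)
    moreover have h: "clinear h" "finite (fsupp h)" using step by blast+
    moreover have "clinear (c *\<^sub>C g + h)"
      unfolding clinear_iff
      by (simp add: scaleC_fun_def clinear_add[OF g(1)] clinear_add[OF h(1)] clinear_scale[OF g(1)]
          clinear_scale[OF h(1)] algebra_simps)
    ultimately show ?case using g(2) by (blast intro: finite_subset)
  qed
next
  assume f: "clinear f \<and> finite (fsupp f)"
  have s: "fsupp f \<subseteq> carrier G" by (auto simp: fsupp_def)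
  have "(\<lambda>x. f (un p * x)) \<in> component_dual G A p" if "p \<in> fsupp f" for p
    using that s f un_left_other[of p] clinear_0[of f]
    by (auto simp: component_dual_def clinear_iff distrib_left scaleC_mult_right)
  then have "(\<Sum>p\<in>fsupp f. (\<lambda>x. f (un p * x))) \<in> graded_dual G A"
    unfolding graded_dual_def using s
    by (intro complex_vector.span_sum complex_vector.span_base) auto
  then show "f \<in> graded_dual G A"
    using finite_fsupp_decomposition[of f "fsupp f"] f s by simp
qed

lemma fsupp_mult_right:
  assumes "clinear f"
  shows "fsupp (\<lambda>x. f (x * a)) \<subseteq> supp a"
proof
  fix p assume "p \<in> fsupp (\<lambda>x. f (x * a))"
  then obtain x where p: "p \<in> carrier G" "x \<in> A p" "f (x * a) \<noteq> 0" by (auto simp: fsupp_def)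
  have "x * a = x * (un p * a)" using p by (simp add: mult.assoc[symmetric] un_right)
  then have "un p * a \<noteq> 0" using p(3) clinear_0[OF assms] by auto
  then show "p \<in> supp a" using p by (simp add: supp_def)
qed

text \<open>\<phi>(\<cdot> a) is supported where \<open>a\<close> is. A functional on A_p equals
  \<phi>(\<cdot> b) on A_p for some b in A_p, and orthogonality of the components makes the latter
  vanish elsewhere.\<close>

lemma dual_space_eq:
  assumes \<phi>: "left_invariant \<phi>" "\<phi> \<noteq> (\<lambda>x. 0)"
  shows "dual_space \<phi> = graded_dual G A"
proof
  note fl = clinear_simps[OF left_invariant_linear[OF \<phi>(1)]]
  show "dual_space \<phi> \<subseteq> graded_dual G A"
  proof
    fix f assume "f \<in> dual_space \<phi>"
    then obtain a where f: "f = (\<lambda>x. \<phi> (x * a))" by (auto simp: dual_space_def)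
    have "fsupp f \<subseteq> supp a"
      unfolding f by (rule fsupp_mult_right[OF left_invariant_linear[OF \<phi>(1)]])
    then show "f \<in> graded_dual G A"
      using finite_supp[of a] by (auto simp: graded_dual_iff f clinear_iff mult_linear_simps fl intro: finite_subset)
  qed
  have sub: "csubspace (dual_space \<phi>)"
  proof (rule complex_vector.subspaceI)
    show "0 \<in> dual_space \<phi>"
      using clinear_0[OF left_invariant_linear[OF \<phi>(1)]] by (auto simp: dual_space_def fun_eq_iff intro!: exI[of _ 0])
    fix f g c assume "f \<in> dual_space \<phi>"
    then obtain a where f: "f = (\<lambda>x. \<phi> (x * a))" by (auto simp: dual_space_def)
    show "c *\<^sub>C f \<in> dual_space \<phi>"
      by (auto simp: dual_space_def f scaleC_fun_def fun_eq_iff fl mult_linear_simps intro!: exI[of _ "c *\<^sub>C a"])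
    assume "g \<in> dual_space \<phi>"
    then obtain b where g: "g = (\<lambda>x. \<phi> (x * b))" by (auto simp: dual_space_def)
    show "f + g \<in> dual_space \<phi>"
      by (auto simp: dual_space_def f g fun_eq_iff fl mult_linear_simps intro!: exI[of _ "a + b"])
  qed
  show "graded_dual G A \<subseteq> dual_space \<phi>"
    unfolding graded_dual_def
  proof (rule complex_vector.span_minimal[OF _ sub], rule subsetI)
    fix f assume "f \<in> (\<Union>p\<in>carrier G. component_dual G A p)"
    then obtain p where p: "p \<in> carrier G" and f: "clinear f" "\<And>q x. q \<in> carrier G \<Longrightarrow> q \<noteq> p \<Longrightarrow> x \<in> A q \<Longrightarrow> f x = 0"
      by (auto simp: component_dual_def)
    obtain b where b: "b \<in> A p" "\<And>x. x \<in> A p \<Longrightarrow> \<phi> (x * b) = f x"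
      using functional_representation[OF \<phi> p f(1)] by blast
    have "f x = \<phi> (x * b)" for x
    proof (induct x rule: component_induct)
      case (component q x)
      show ?case
      proof (cases "q = p")
        case False
        then show ?thesis
          using f(2) component component_orthogonal[of q p x b] p b(1) clinear_0[OF left_invariant_linear[OF \<phi>(1)]] by simp
      qed (use b component in simp)
    qed (simp add: clinear_add[OF f(1)] fl distrib_right)
    then show "f \<in> dual_space \<phi>" by (auto simp: dual_space_def fun_eq_iff)
  qed
qed

section \<open>The dual Hopf algebra\<close>

abbreviation "V \<equiv> graded_dual G A"
abbreviation "cd \<equiv> component_dual G A"

lemma subspace_V: "csubspace V"
  unfolding graded_dual_def by (rule complex_vector.subspace_span)

lemmas V_0 = complex_vector.subspace_0[OF subspace_V]
  and V_add = complex_vector.subspace_add[OF subspace_V]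
  and V_scale = complex_vector.subspace_scale[OF subspace_V]

lemma V_linear: "f \<in> V \<Longrightarrow> clinear f"
  by (simp only: graded_dual_iff)

lemma cd_linear: "f \<in> cd p \<Longrightarrow> clinear f"
  by (simp only: component_dual_iff)

lemma cd_subset: "p \<in> carrier G \<Longrightarrow> f \<in> cd p \<Longrightarrow> f \<in> V"
  unfolding graded_dual_iff component_dual_iff by (auto intro: finite_subset)

lemma cd_restrict:
  assumes "p \<in> carrier G" "f \<in> cd p"
  shows "f (un p * x) = f x"
proof (induct x rule: component_induct)
  case (component q x)
  then show ?case
    using assms un_left[of p x] un_left_other[of p q x] clinear_0[OF cd_linear[OF assms(2)]]
    by (cases "q = p") (auto simp: component_dual_def)
qed (simp add: distrib_left clinear_add[OF cd_linear[OF assms(2)]])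

lemma cd_restrict_right: "p \<in> carrier G \<Longrightarrow> f \<in> cd p \<Longrightarrow> f (x * un p) = f x"
  by (simp add: un_central cd_restrict)

lemma cd_subspace: "csubspace (cd p)"
proof (rule complex_vector.subspaceI)
  show "0 \<in> cd p" unfolding component_dual_def clinear_iff by simp
  fix f g c assume f: "f \<in> cd p"
  show "c *\<^sub>C f \<in> cd p" using f unfolding component_dual_def clinear_iff
    by (simp add: scaleC_fun_def distrib_left mult.left_commute)
  assume g: "g \<in> cd p"
  show "f + g \<in> cd p" using f g unfolding component_dual_def clinear_iff
    by (simp add: distrib_left)
qed

lemma V_induct [consumes 1, case_names component add]:
  assumes "f \<in> V"
    and comp: "\<And>p f. p \<in> carrier G \<Longrightarrow> f \<in> cd p \<Longrightarrow> P f"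
    and add: "\<And>f g. f \<in> V \<Longrightarrow> g \<in> V \<Longrightarrow> P f \<Longrightarrow> P g \<Longrightarrow> P (f + g)"
  shows "P f"
proof -
  have "f \<in> cspan (\<Union>p\<in>carrier G. cd p)" using assms(1) by (simp only: graded_dual_def)
  then have "f \<in> V \<and> P f"
  proof (induct rule: complex_vector.span_induct_alt)
    case base
    show ?case using V_0 comp[OF one_closed complex_vector.subspace_0[OF cd_subspace]] by blast
  next
    case (step c g h)
    then obtain p where p: "p \<in> carrier G" "c *\<^sub>C g \<in> cd p"
      using complex_vector.subspace_scale[OF cd_subspace] by blast
    show ?case using step(2) add[OF cd_subset[OF p]] comp[OF p] V_add[OF cd_subset[OF p]] by blast
  qed
  then show ?thesis ..
qed

lemma bilinear_functionals:
  assumes "clinear f" "clinear g"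
  shows "bilinear (\<lambda>x y. f x * g y :: complex)"
  unfolding bilinear_iff
  by (simp add: clinear_add[OF assms(1)] clinear_add[OF assms(2)] clinear_scale[OF assms(1)]
      clinear_scale[OF assms(2)] algebra_simps)

lemma tensor_functional_eq: "clinear f \<Longrightarrow> clinear g \<Longrightarrow> tensor_functional f g t = tsum t (\<lambda>x y. f x * g y)"
  unfolding tensor_functional_def by (rule tsum_eq_lift[OF bilinear_functionals, symmetric])

lemma bilinear_0: "bilinear (\<lambda>x y. 0)"
  unfolding bilinear_iff by simp

lemma comult_component_eq:
  assumes p: "p \<in> carrier G" and q: "q \<in> carrier G"
  shows "comult_component \<Delta> A p q a = cop p q a"
  unfolding comult_component_def
proof (rule the_equality)
  show "cop p q a \<in> A p \<otimes>\<^sub>S A q \<and> (\<forall>s\<in>A p \<otimes>\<^sub>S A q. cop p q a * s = lact (\<Delta> a) s \<and> s * cop p q a = ract s (\<Delta> a))"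
    using cop_in[OF p q] lact_comult[OF p q] ract_comult[OF p q] by simp
  fix t assume t: "t \<in> A p \<otimes>\<^sub>S A q \<and> (\<forall>s\<in>A p \<otimes>\<^sub>S A q. t * s = lact (\<Delta> a) s \<and> s * t = ract s (\<Delta> a))"
  have "un p \<otimes>\<^sub>T un q \<in> A p \<otimes>\<^sub>S A q" using p q by (simp add: tensor_span_I un_in)
  then show "t = cop p q a"
    using t tensor_span_restrict(1)[OF p q, of t] by (auto simp: cop_def)
qed

subsection \<open>Convolution\<close>

text \<open>\<Delta>(x) may have infinitely many components, but only those indexed by the two
  supports contribute, so (f \<otimes> g)(\<Delta>(x)) is a finite sum.\<close>

definition conv :: "('a \<Rightarrow> complex) \<Rightarrow> ('a \<Rightarrow> complex) \<Rightarrow> 'a \<Rightarrow> complex"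
  where "conv f g x = (\<Sum>p\<in>fsupp f. \<Sum>q\<in>fsupp g. sw p q x (\<lambda>u v. f u * g v))"

lemma sw_functionals_0:
  assumes "p \<in> carrier G" "q \<in> carrier G" "p \<notin> fsupp f \<or> q \<notin> fsupp g" "clinear f" "clinear g"
  shows "sw p q x (\<lambda>u v. f u * g v) = 0"
proof -
  have "sw p q x (\<lambda>u v. f u * g v) = sw p q x (\<lambda>u v. 0)"
    by (rule sw_cong[OF assms(1,2) bilinear_functionals[OF assms(4,5)] bilinear_0])
      (use assms(1-3) in \<open>auto simp: fsupp_def\<close>)
  then show ?thesis by simp
qed

text \<open>Additivity in \<open>f\<close> and \<open>g\<close> requires common index sets; the
  additional terms vanish because one functional is zero on the component concerned.\<close>

lemma conv_eq:
  assumes "clinear f" "clinear g" "finite P" "finite Q" "P \<subseteq> carrier G" "Q \<subseteq> carrier G" "fsupp f \<subseteq> P" "fsupp g \<subseteq> Q"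
  shows "conv f g x = (\<Sum>p\<in>P. \<Sum>q\<in>Q. sw p q x (\<lambda>u v. f u * g v))"
proof -
  have "(\<Sum>p\<in>P. \<Sum>q\<in>Q. sw p q x (\<lambda>u v. f u * g v))
    = (\<Sum>p\<in>fsupp f. \<Sum>q\<in>Q. sw p q x (\<lambda>u v. f u * g v))"
  proof (rule sum.mono_neutral_right[OF assms(3,7)], rule ballI, rule sum.neutral, rule ballI)
    fix p q assume "p \<in> P - fsupp f" "q \<in> Q"
    then show "sw p q x (\<lambda>u v. f u * g v) = 0"
      using assms(5,6) by (intro sw_functionals_0 assms(1,2)) auto
  qed
  also have "\<dots> = conv f g x"
    unfolding conv_def
  proof (rule sum.cong[OF refl], rule sum.mono_neutral_right[OF assms(4,8)], rule ballI)
    fix p q assume "p \<in> fsupp f" "q \<in> Q - fsupp g"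
    then show "sw p q x (\<lambda>u v. f u * g v) = 0"
      using assms(5-7) by (intro sw_functionals_0 assms(1,2)) auto
  qed
  finally show ?thesis ..
qed

lemma fsupp_carrier: "fsupp f \<subseteq> carrier G"
  by (auto simp: fsupp_def)

lemma V_finite: "f \<in> V \<Longrightarrow> finite (fsupp f)"
  by (simp only: graded_dual_iff)

lemma fsupp_add: "fsupp (f + g) \<subseteq> fsupp f \<union> fsupp g"
  and fsupp_scale: "fsupp (c *\<^sub>C f) \<subseteq> fsupp f"
  by (auto simp: fsupp_def scaleC_fun_def)

lemma conv_cd:
  assumes "p \<in> carrier G" "q \<in> carrier G" "f \<in> cd p" "g \<in> cd q"
  shows "conv f g x = sw p q x (\<lambda>u v. f u * g v)"
  using assms conv_eq[of f g "{p}" "{q}" x] unfolding component_dual_iff by simp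

lemma conv_add_left:
  assumes "f \<in> V" "f' \<in> V" "g \<in> V"
  shows "conv (f + f') g = conv f g + conv f' g"
proof
  fix x
  note l = V_linear[OF assms(1)] V_linear[OF assms(2)] V_linear[OF assms(3)] V_linear[OF V_add[OF assms(1,2)]]
  let ?P = "fsupp f \<union> fsupp f'"
  have "conv h g x = (\<Sum>p\<in>?P. \<Sum>q\<in>fsupp g. sw p q x (\<lambda>u v. h u * g v))"
    if "clinear h" "fsupp h \<subseteq> ?P" for h
    using V_finite assms fsupp_carrier that by (intro conv_eq l(3)) auto
  from this[OF l(1)] this[OF l(2)] this[OF l(4) fsupp_add]
  show "conv (f + f') g x = (conv f g + conv f' g) x"
    by (simp add: distrib_right sum.distrib)
qed

lemma conv_add_right:
  assumes "f \<in> V" "f' \<in> V" "g \<in> V"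
  shows "conv g (f + f') = conv g f + conv g f'"
proof
  fix x
  note l = V_linear[OF assms(1)] V_linear[OF assms(2)] V_linear[OF assms(3)] V_linear[OF V_add[OF assms(1,2)]]
  let ?P = "fsupp f \<union> fsupp f'"
  have "conv g h x = (\<Sum>p\<in>fsupp g. \<Sum>q\<in>?P. sw p q x (\<lambda>u v. g u * h v))"
    if "clinear h" "fsupp h \<subseteq> ?P" for h
    using V_finite assms fsupp_carrier that by (intro conv_eq l(3)) auto
  from this[OF l(1)] this[OF l(2)] this[OF l(4) fsupp_add]
  show "conv g (f + f') x = (conv g f + conv g f') x"
    by (simp add: distrib_left sum.distrib)
qed

lemma tsum_times_complex: "tsum t (\<lambda>x y. c * f x y) = c * (tsum t f :: complex)"
  using tsum_scale[of t c f] by simp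

lemma conv_scale:
  assumes "f \<in> V" "g \<in> V"
  shows "conv (c *\<^sub>C f) g = c *\<^sub>C conv f g" and "conv f (c *\<^sub>C g) = c *\<^sub>C conv f g"
proof -
  note l = V_linear[OF assms(1)] V_linear[OF assms(2)] V_linear[OF V_scale[OF assms(1)]] V_linear[OF V_scale[OF assms(2)]]
  have "conv (c *\<^sub>C f) g x = (\<Sum>p\<in>fsupp f. \<Sum>q\<in>fsupp g. sw p q x (\<lambda>u v. (c *\<^sub>C f) u * g v))" for x
    using V_finite assms fsupp_carrier fsupp_scale by (intro conv_eq l) auto
  then show "conv (c *\<^sub>C f) g = c *\<^sub>C conv f g"
    by (simp add: fun_eq_iff scaleC_fun_def conv_def sum_distrib_left tsum_times_complex mult.assoc)
  have "conv f (c *\<^sub>C g) x = (\<Sum>p\<in>fsupp f. \<Sum>q\<in>fsupp g. sw p q x (\<lambda>u v. f u * (c *\<^sub>C g) v))" for x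
    using V_finite assms fsupp_carrier fsupp_scale by (intro conv_eq l) auto
  then show "conv f (c *\<^sub>C g) = c *\<^sub>C conv f g"
    by (simp add: fun_eq_iff scaleC_fun_def conv_def sum_distrib_left tsum_times_complex mult.left_commute)
qed

lemma conv_cd_in:
  assumes "p \<in> carrier G" "q \<in> carrier G" "f \<in> cd p" "g \<in> cd q"
  shows "conv f g \<in> cd (p \<otimes> q)"
proof -
  have e: "conv f g = (\<lambda>x. sw p q x (\<lambda>u v. f u * g v))"
    using conv_cd[OF assms] by (rule ext)
  note b = bilinear_functionals[OF cd_linear[OF assms(3)] cd_linear[OF assms(4)]]
  have "clinear (conv f g)"
    unfolding e clinear_iff by (simp only: sw_linear[OF b] simp_thms)
  moreover have "conv f g x = 0" if "r \<in> carrier G" "r \<noteq> p \<otimes> q" "x \<in> A r" for r x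
    unfolding e using cop_other[OF assms(1,2) that(1,3,2)] by (simp add: tsum_zero_tensor[OF b])
  ultimately show ?thesis unfolding component_dual_def by blast
qed

lemma conv_in: "f \<in> V \<Longrightarrow> g \<in> V \<Longrightarrow> conv f g \<in> V"
proof (induct f rule: V_induct)
  case (component p f)
  note f = this(1,2)
  from component(3) show ?case
  proof (induct g rule: V_induct)
    case (component q g)
    then show ?case using f conv_cd_in cd_subset[of "p \<otimes> q"] by simp
  next
    case (add g h)
    then show ?case using cd_subset[OF f] by (simp only: conv_add_right V_add)
  qed
next
  case (add f h)
  then show ?case by (simp only: conv_add_left V_add)
qed

lemma conv_assoc:
  assumes "f \<in> V" "g \<in> V" "h \<in> V"
  shows "conv (conv f g) h = conv f (conv g h)"
  using assms
proof (induct f rule: V_induct)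
  case (component p f)
  note p = component(1) and f = component(2) and fV = cd_subset[OF component(1,2)]
  from component(3,4) show ?case
  proof (induct g rule: V_induct)
    case (component q g)
    note q = component(1) and g = component(2) and gV = cd_subset[OF component(1,2)]
    from component(3) show ?case
    proof (induct h rule: V_induct)
      case (component r h)
      note r = component(1) and h = component(2)
      note pq = m_closed[OF p q] and qr = m_closed[OF q r]
      note l = clinear_add[OF cd_linear[OF f]] clinear_add[OF cd_linear[OF g]] clinear_add[OF cd_linear[OF h]]
         clinear_scale[OF cd_linear[OF f]] clinear_scale[OF cd_linear[OF g]] clinear_scale[OF cd_linear[OF h]]
      show ?case
      proof
        fix x
        have "conv (conv f g) h x = sw (p \<otimes> q) r x (\<lambda>w z. sw p q w (\<lambda>x y. h z * (f x * g y)))"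
          by (simp add: conv_cd[OF pq r conv_cd_in[OF p q f g] h] conv_cd[OF p q f g] tsum_times_complex mult.commute)
        also have "\<dots> = sw p (q \<otimes> r) x (\<lambda>x w. sw q r w (\<lambda>y z. h z * (f x * g y)))"
          by (rule sw_coassoc[OF p q r]) (simp add: trilinear_iff l algebra_simps)
        also have "\<dots> = conv f (conv g h) x"
        proof -
          have "(\<lambda>y z. h z * (f x * g y)) = (\<lambda>y z. f x * (g y * h z))" for x by (simp add: fun_eq_iff)
          then show ?thesis
            by (simp add: conv_cd[OF p qr f conv_cd_in[OF q r g h]] conv_cd[OF q r g h] tsum_times_complex)
        qed
        finally show "conv (conv f g) h x = conv f (conv g h) x" .
      qed
    next
      case (add h k)
      then show ?case using fV gV by (simp only: conv_in conv_add_right)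
    qed
  next
    case (add g k)
    then show ?case using fV by (simp only: conv_in conv_add_left conv_add_right)
  qed
next
  case (add f k)
  then show ?case by (simp only: conv_in conv_add_left)
qed

lemma eps_cd: "eps \<in> cd \<one>"
  unfolding component_dual_def using clinear_eps eps_other by blast

lemma eps_V: "eps \<in> V"
  using cd_subset[OF one_closed eps_cd] .

lemma conv_eps:
  assumes "f \<in> V"
  shows "conv eps f = f" "conv f eps = f"
proof -
  have "conv eps f = f \<and> conv f eps = f" using assms
  proof (induct f rule: V_induct)
    case (component p f)
    have "conv eps f x = f x" "conv f eps x = f x" for x
      using sw_eps_left_apply[OF component(1) cd_linear[OF component(2)], of x]
        sw_eps_right_apply[OF component(1) cd_linear[OF component(2)], of x]
        conv_cd[OF one_closed component(1) eps_cd component(2), of x]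
        conv_cd[OF component(1) one_closed component(2) eps_cd, of x] cd_restrict_right[OF component]
      by (simp_all add: mult.commute)
    then show ?case by blast
  next
    case (add f g)
    then show ?case using eps_V by (simp only: conv_add_left conv_add_right)
  qed
  then show "conv eps f = f" "conv f eps = f" by auto
qed

lemma conv_bilinear: "bilinear_on V V conv"
  unfolding bilinear_on_def linear_on_def using conv_add_left conv_add_right conv_scale by blast

subsection \<open>The coproduct of the dual\<close>

definition basis :: "'g \<Rightarrow> 'a set" where "basis p = (SOME B. \<exists>d. dual_basis (A p) B d)"
text \<open>The factor 1_p extends the coordinate functional by zero to the other components and so
  places it in A_p'.\<close>

definition coord :: "'g \<Rightarrow> 'a \<Rightarrow> 'a \<Rightarrow> complex"
  where "coord p b x = (SOME d. dual_basis (A p) (basis p) d) b (un p * x)"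

lemma
  assumes p: "p \<in> carrier G"
  shows basis_in: "b \<in> basis p \<Longrightarrow> b \<in> A p"
    and coord_cd: "coord p b \<in> cd p"
    and coord_expand: "x \<in> A p \<Longrightarrow> clinear h \<Longrightarrow> h x = (\<Sum>b\<in>basis p. coord p b x *\<^sub>C h b)"
proof -
  define d where "d = (SOME d. dual_basis (A p) (basis p) d)"
  have "\<exists>B d. dual_basis (A p) B d" using dual_basis_exists component_finite p by blast
  then have "\<exists>d. dual_basis (A p) (basis p) d" unfolding basis_def by (rule someI_ex)
  then have d: "dual_basis (A p) (basis p) d" unfolding d_def by (rule someI_ex)
  have c: "coord p b x = d b (un p * x)" for b x by (simp add: coord_def d_def)
  show "b \<in> basis p \<Longrightarrow> b \<in> A p" using dual_basisD(2)[OF d] .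
  show "coord p b \<in> cd p"
    unfolding component_dual_def clinear_iff
    using un_left_other[OF p] clinear_0[OF dual_basisD(3)[OF d]]
    by (simp add: c distrib_left scaleC_mult_right clinear_simps[OF dual_basisD(3)[OF d]])
  show "x \<in> A p \<Longrightarrow> clinear h \<Longrightarrow> h x = (\<Sum>b\<in>basis p. coord p b x *\<^sub>C h b)"
    using dual_basis_expand[OF d, of h x] p by (simp add: c un_left)
qed

lemma cd_expand:
  assumes "p \<in> carrier G" "f \<in> cd p"
  shows "(\<Sum>b\<in>basis p. f b *\<^sub>C coord p b) = f"
proof
  fix x
  have "f x = f (un p * x)" using cd_restrict[OF assms] by simp
  also have "\<dots> = (\<Sum>b\<in>basis p. coord p b (un p * x) *\<^sub>C f b)"
    using coord_expand[OF assms(1) un_mult_in[OF assms(1)] cd_linear[OF assms(2)]] .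
  also have "\<dots> = (\<Sum>b\<in>basis p. f b *\<^sub>C coord p b) x"
    by (simp add: sum_apply scaleC_fun_def cd_restrict[OF assms(1) coord_cd[OF assms(1)]] mult.commute)
  finally show "(\<Sum>b\<in>basis p. f b *\<^sub>C coord p b) x = f x" ..
qed

lemma coord_V: "p \<in> carrier G \<Longrightarrow> coord p b \<in> V"
  using cd_subset coord_cd by blast

text \<open>The transpose of the product in dual bases, \<Sum> f(e_i e_j) e^i \<otimes> e^j. It is a
  genuine tensor because every A_p is finite-dimensional and \<open>f\<close> has finite
  support.\<close>

definition dcop :: "('a \<Rightarrow> complex) \<Rightarrow> ('a \<Rightarrow> complex, 'a \<Rightarrow> complex) tensor"
  where "dcop f = (\<Sum>p\<in>fsupp f. \<Sum>i\<in>basis p. \<Sum>j\<in>basis p. f (i * j) *\<^sub>C (coord p i \<otimes>\<^sub>T coord p j))"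

lemma dcop_eq:
  assumes "finite P" "P \<subseteq> carrier G" "fsupp f \<subseteq> P"
  shows "dcop f = (\<Sum>p\<in>P. \<Sum>i\<in>basis p. \<Sum>j\<in>basis p. f (i * j) *\<^sub>C (coord p i \<otimes>\<^sub>T coord p j))"
  unfolding dcop_def
proof (rule sum.mono_neutral_left[OF assms(1,3)], rule ballI)
  fix p assume "p \<in> P - fsupp f"
  then have "f (i * j) = 0" if "i \<in> basis p" "j \<in> basis p" for i j
    using that assms(2) basis_in[of p] component_mult[of p i j] by (auto simp: fsupp_def)
  then show "(\<Sum>i\<in>basis p. \<Sum>j\<in>basis p. f (i * j) *\<^sub>C (coord p i \<otimes>\<^sub>T coord p j)) = 0" by simp
qed

lemma dcop_cd:
  assumes "p \<in> carrier G" "f \<in> cd p"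
  shows "dcop f = (\<Sum>i\<in>basis p. \<Sum>j\<in>basis p. f (i * j) *\<^sub>C (coord p i \<otimes>\<^sub>T coord p j))"
  using assms dcop_eq[of "{p}" f] unfolding component_dual_iff by simp

lemma dcop_add: "f \<in> V \<Longrightarrow> g \<in> V \<Longrightarrow> dcop (f + g) = dcop f + dcop g"
proof -
  assume "f \<in> V" "g \<in> V"
  then have P: "finite (fsupp f \<union> fsupp g)" "fsupp f \<union> fsupp g \<subseteq> carrier G"
    using V_finite fsupp_carrier by auto
  show ?thesis
    using fsupp_add[of f g] by (simp add: dcop_eq[OF P] scaleC_add_left sum.distrib)
qed

lemma dcop_scale: "f \<in> V \<Longrightarrow> dcop (c *\<^sub>C f) = c *\<^sub>C dcop f"
  using dcop_eq[OF V_finite fsupp_carrier fsupp_scale, of f c]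
  by (simp add: dcop_def scaleC_fun_def scaleC_scaleC complex_vector.scale_sum_right)

lemma dcop_linear: "linear_on V dcop"
  unfolding linear_on_def using dcop_add dcop_scale by blast

lemma dcop_cd_in:
  assumes "p \<in> carrier G" "f \<in> cd p"
  shows "dcop f \<in> cd p \<otimes>\<^sub>S cd p"
  unfolding dcop_cd[OF assms] using coord_cd[OF assms(1)]
  by (intro complex_vector.subspace_sum complex_vector.subspace_scale csubspace_tensor_span tensor_span_I)

lemma dcop_in: "f \<in> V \<Longrightarrow> dcop f \<in> V \<otimes>\<^sub>S V"
  unfolding dcop_def using coord_V fsupp_carrier
  by (intro complex_vector.subspace_sum complex_vector.subspace_scale csubspace_tensor_span tensor_span_I) auto

lemma lift_dcop:
  assumes "bilinear_on V V F" "p \<in> carrier G" "f \<in> cd p"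
  shows "tensor_lift_on V V F (dcop f) = (\<Sum>i\<in>basis p. \<Sum>j\<in>basis p. f (i * j) *\<^sub>C F (coord p i) (coord p j))"
  unfolding dcop_cd[OF assms(2,3)]
  by (simp add: tensor_lift_on_linear[OF subspace_V subspace_V assms(1)] tensor_lift_on[OF subspace_V subspace_V assms(1)]
      coord_V[OF assms(2)])

lemma sum_coord_functional:
  assumes "p \<in> carrier G" "f \<in> cd p" "x \<in> A p"
  shows "(\<Sum>i\<in>basis p. f (i * y) * coord p i x) = f (x * y)"
    and "(\<Sum>i\<in>basis p. f (y * i) * coord p i x) = f (y * x)"
proof -
  note l = clinear_simps[OF cd_linear[OF assms(2)]]
  have c: "clinear (\<lambda>x. f (x * y))" "clinear (\<lambda>x. f (y * x))"
    unfolding clinear_iff by (simp_all add: l mult_linear_simps)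
  show "(\<Sum>i\<in>basis p. f (i * y) * coord p i x) = f (x * y)"
    using coord_expand[OF assms(1,3) c(1)] by (simp add: mult.commute)
  show "(\<Sum>i\<in>basis p. f (y * i) * coord p i x) = f (y * x)"
    using coord_expand[OF assms(1,3) c(2)] by (simp add: mult.commute)
qed

lemma sum_coord_functional2:
  assumes "p \<in> carrier G" "f \<in> cd p" "x \<in> A p" "y \<in> A p"
  shows "(\<Sum>i\<in>basis p. \<Sum>j\<in>basis p. f (i * j) * (coord p i x * coord p j y)) = f (x * y)"
proof -
  have "(\<Sum>i\<in>basis p. \<Sum>j\<in>basis p. f (i * j) * (coord p i x * coord p j y))
    = (\<Sum>i\<in>basis p. (\<Sum>j\<in>basis p. f (i * j) * coord p j y) * coord p i x)"
    by (simp add: sum_distrib_left sum_distrib_right mult.commute mult.left_commute)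
  then show ?thesis by (simp add: sum_coord_functional[OF assms(1,2)] assms(3,4))
qed

lemma tensor_eval_dcop: "f \<in> V \<Longrightarrow> tensor_eval (dcop f) x y = f (x * y)"
proof (induct f rule: V_induct)
  case (component p f)
  have b: "bilinear (\<lambda>f g. f x * g y :: complex)" for x y :: 'a
    unfolding bilinear_iff by (simp add: scaleC_fun_def algebra_simps)
  note e = clinear_tensor_lift[OF b]
  have "tensor_eval (dcop f) x y = (\<Sum>i\<in>basis p. \<Sum>j\<in>basis p. f (i * j) * (coord p i x * coord p j y))"
    by (simp add: tensor_eval_def dcop_cd[OF component] clinear_sum[OF e] clinear_scale[OF e] tensor_lift[OF b])
  also have "\<dots> = (\<Sum>i\<in>basis p. \<Sum>j\<in>basis p. f (i * j) * (coord p i (un p * x) * coord p j (un p * y)))"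
    using cd_restrict[OF component(1) coord_cd[OF component(1)]] by simp
  also have "\<dots> = f (un p * x * (un p * y))"
    by (rule sum_coord_functional2) (use component un_mult_in in auto)
  also have "un p * x * (un p * y) = un p * (x * y)"
    by (metis component(1) mult.assoc un_central un_idem)
  finally show ?case using cd_restrict[OF component] by simp
next
  case (add f g)
  have b: "bilinear (\<lambda>f g. f x * g y :: complex)" for x y :: 'a
    unfolding bilinear_iff by (simp add: scaleC_fun_def algebra_simps)
  have "tensor_eval (dcop (f + g)) x y = tensor_eval (dcop f) x y + tensor_eval (dcop g) x y"
    by (simp only: tensor_eval_def dcop_add[OF add(1,2)] clinear_add[OF clinear_tensor_lift[OF b]])
  then show ?case by (simp only: add(3,4) plus_fun_def)
qed

lemma tens_sums: "(\<Sum>m\<in>M. a m *\<^sub>C x m) \<otimes>\<^sub>T (\<Sum>n\<in>N. b n *\<^sub>C y n) = (\<Sum>m\<in>M. \<Sum>n\<in>N. (a m * b n) *\<^sub>C (x m \<otimes>\<^sub>T y n))"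
  unfolding tens_sum_left unfolding tens_sum_right by (simp add: tens_linear_simps scaleC_scaleC mult.commute)

text \<open>Evaluation at the identity of M(A), which is the formal sum of all 1_p; only those p in
  the support of \<open>f\<close> contribute.\<close>

definition dcounit :: "('a \<Rightarrow> complex) \<Rightarrow> complex"
  where "dcounit f = (\<Sum>p\<in>fsupp f. f (un p))"

definition dant :: "('a \<Rightarrow> complex) \<Rightarrow> 'a \<Rightarrow> complex"
  where "dant f = (\<lambda>x. f (S x))"

lemma dcounit_eq:
  assumes "finite P" "P \<subseteq> carrier G" "fsupp f \<subseteq> P"
  shows "dcounit f = (\<Sum>p\<in>P. f (un p))"
  unfolding dcounit_def
proof (rule sum.mono_neutral_left[OF assms(1,3)], rule ballI)
  fix p assume "p \<in> P - fsupp f"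
  then show "f (un p) = 0" using assms(2) un_in[of p] by (auto simp: fsupp_def)
qed

lemma dcounit_cd: "p \<in> carrier G \<Longrightarrow> f \<in> cd p \<Longrightarrow> dcounit f = f (un p)"
  using dcounit_eq[of "{p}" f] unfolding component_dual_iff by simp

lemma dcounit_add: "f \<in> V \<Longrightarrow> g \<in> V \<Longrightarrow> dcounit (f + g) = dcounit f + dcounit g"
proof -
  assume "f \<in> V" "g \<in> V"
  then have P: "finite (fsupp f \<union> fsupp g)" "fsupp f \<union> fsupp g \<subseteq> carrier G"
    using V_finite fsupp_carrier by auto
  show ?thesis
    using dcounit_eq[OF P fsupp_add] dcounit_eq[OF P, of f] dcounit_eq[OF P, of g] by (simp add: sum.distrib)
qed

lemma dcounit_scale: "f \<in> V \<Longrightarrow> dcounit (c *\<^sub>C f) = c * dcounit f"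
  using dcounit_eq[OF V_finite fsupp_carrier fsupp_scale, of f c]
  by (simp add: dcounit_def scaleC_fun_def sum_distrib_left)

lemma dant_cd:
  assumes p: "p \<in> carrier G" and f: "f \<in> cd p"
  shows "dant f \<in> cd (inv p)"
proof -
  have "f (S x) = 0" if "q \<in> carrier G" "q \<noteq> inv p" "x \<in> A q" for q x
  proof -
    have "inv q \<noteq> p" using that p by auto
    then show ?thesis using f S_in[OF that(1,3)] that(1) by (auto simp: component_dual_def)
  qed
  moreover have "clinear (dant f)"
    unfolding clinear_iff dant_def
    by (simp only: S_add S_scale clinear_simps[OF cd_linear[OF f]] simp_thms)
  ultimately show ?thesis unfolding component_dual_def by (simp only: dant_def mem_Collect_eq) blast
qed

lemma dant_add: "dant (f + g) = dant f + dant g" and dant_scale: "dant (c *\<^sub>C f) = c *\<^sub>C dant f"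
  by (simp_all add: dant_def fun_eq_iff scaleC_fun_def)

lemma dant_in: "f \<in> V \<Longrightarrow> dant f \<in> V"
proof (induct f rule: V_induct)
  case (component p f)
  then show ?case using dant_cd cd_subset[of "inv p"] by simp
next
  case (add f g)
  then show ?case by (simp only: dant_add V_add)
qed

section \<open>Verification of the Hopf algebra axioms\<close>

lemma lift_dcop_eq:
  assumes F: "bilinear_on V V F" and f: "f \<in> V"
    and comp: "\<And>p f. p \<in> carrier G \<Longrightarrow> f \<in> cd p \<Longrightarrow>
      (\<Sum>i\<in>basis p. \<Sum>j\<in>basis p. f (i * j) *\<^sub>C F (coord p i) (coord p j)) = R f"
    and add: "\<And>f g. f \<in> V \<Longrightarrow> g \<in> V \<Longrightarrow> R (f + g) = R f + R g"
  shows "tensor_lift_on V V F (dcop f) = R f"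
  using f
proof (induct f rule: V_induct)
  case (component p f)
  then show ?case using lift_dcop[OF F] comp by simp
next
  case (add f g)
  then show ?case by (simp only: assms(4) dcop_add tensor_lift_on_linear[OF subspace_V subspace_V F])
qed

lemma bilinear_dcop_left: "bilinear_on V V (\<lambda>a b. dcop a \<otimes>\<^sub>T b)"
  and bilinear_dcop_right: "bilinear_on V V (\<lambda>a b. a \<otimes>\<^sub>T dcop b)"
  by (rule bilinear_on_intro; simp only: dcop_add dcop_scale tens_linear_simps)+

text \<open>Both sides equal the sum of f(e_k e_l e_j) e^k \<otimes> e^l \<otimes> e^j, where the
  triple product is bracketed in the two ways; associativity of A_p identifies them.\<close>

lemma dcop_coassoc:
  assumes "f \<in> V"
  shows "tensor_assoc (tensor_lift_on V V (\<lambda>a b. dcop a \<otimes>\<^sub>T b) (dcop f))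
    = tensor_lift_on V V (\<lambda>a b. a \<otimes>\<^sub>T dcop b) (dcop f)"
  using assms
proof (induct f rule: V_induct)
  case (component p f)
  note p = component(1) and f = component(2)
  let ?B = "basis p"
  let ?X = "\<lambda>i j k. coord p i \<otimes>\<^sub>T coord p j \<otimes>\<^sub>T coord p k"
  let ?L = "\<lambda>i j k l. (f (i * j) * coord p i (k * l)) *\<^sub>C ?X k l j"
  let ?R = "\<lambda>i j k l. (f (i * j) * coord p j (k * l)) *\<^sub>C ?X i k l"
  note swap = sum.swap[of _ ?B ?B]
  have "tensor_assoc (tensor_lift_on V V (\<lambda>a b. dcop a \<otimes>\<^sub>T b) (dcop f))
    = (\<Sum>i\<in>?B. \<Sum>j\<in>?B. \<Sum>k\<in>?B. \<Sum>l\<in>?B. ?L i j k l)"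
    by (simp add: lift_dcop[OF bilinear_dcop_left p f] dcop_cd[OF p coord_cd[OF p]] tens_sum_left
        tens_linear_simps clinear_sum[OF clinear_tensor_assoc] clinear_scale[OF clinear_tensor_assoc]
        tensor_assoc_tens complex_vector.scale_sum_right scaleC_scaleC)
  also have "\<dots> = (\<Sum>j\<in>?B. \<Sum>k\<in>?B. \<Sum>l\<in>?B. \<Sum>i\<in>?B. ?L i j k l)"
  proof -
    have "(\<Sum>i\<in>?B. \<Sum>j\<in>?B. \<Sum>k\<in>?B. \<Sum>l\<in>?B. ?L i j k l)
      = (\<Sum>j\<in>?B. \<Sum>i\<in>?B. \<Sum>k\<in>?B. \<Sum>l\<in>?B. ?L i j k l)" by (rule swap)
    also have "\<dots> = (\<Sum>j\<in>?B. \<Sum>k\<in>?B. \<Sum>i\<in>?B. \<Sum>l\<in>?B. ?L i j k l)"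
      by (intro sum.cong refl swap)
    also have "\<dots> = (\<Sum>j\<in>?B. \<Sum>k\<in>?B. \<Sum>l\<in>?B. \<Sum>i\<in>?B. ?L i j k l)"
      by (intro sum.cong refl swap)
    finally show ?thesis .
  qed
  also have "\<dots> = (\<Sum>j\<in>?B. \<Sum>k\<in>?B. \<Sum>l\<in>?B. f (k * l * j) *\<^sub>C ?X k l j)"
    using sum_coord_functional(1)[OF p f] basis_in[OF p] component_mult[OF p]
    by (simp add: complex_vector.scale_sum_left[symmetric])
  also have "\<dots> = (\<Sum>k\<in>?B. \<Sum>l\<in>?B. \<Sum>j\<in>?B. f (k * l * j) *\<^sub>C ?X k l j)"
    by (subst swap) (intro sum.cong refl swap)
  also have "\<dots> = (\<Sum>i\<in>?B. \<Sum>k\<in>?B. \<Sum>l\<in>?B. \<Sum>j\<in>?B. ?R i j k l)"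
    using sum_coord_functional(2)[OF p f] basis_in[OF p] component_mult[OF p]
    by (simp add: complex_vector.scale_sum_left[symmetric] mult.assoc)
  also have "\<dots> = (\<Sum>i\<in>?B. \<Sum>j\<in>?B. \<Sum>k\<in>?B. \<Sum>l\<in>?B. ?R i j k l)"
  proof (rule sum.cong[OF refl])
    fix i
    have "(\<Sum>k\<in>?B. \<Sum>l\<in>?B. \<Sum>j\<in>?B. ?R i j k l)
      = (\<Sum>k\<in>?B. \<Sum>j\<in>?B. \<Sum>l\<in>?B. ?R i j k l)"
      by (intro sum.cong refl swap)
    also have "\<dots> = (\<Sum>j\<in>?B. \<Sum>k\<in>?B. \<Sum>l\<in>?B. ?R i j k l)" by (rule swap)
    finally show "(\<Sum>k\<in>?B. \<Sum>l\<in>?B. \<Sum>j\<in>?B. ?R i j k l) = \<dots>" .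
  qed
  also have "\<dots> = tensor_lift_on V V (\<lambda>a b. a \<otimes>\<^sub>T dcop b) (dcop f)"
    by (simp add: lift_dcop[OF bilinear_dcop_right p f] dcop_cd[OF p coord_cd[OF p]] tens_sum_right
        tens_linear_simps complex_vector.scale_sum_right scaleC_scaleC)
  finally show ?case .
next
  case (add f g)
  then show ?case
    by (simp only: dcop_add tensor_lift_on_linear[OF subspace_V subspace_V bilinear_dcop_left]
        tensor_lift_on_linear[OF subspace_V subspace_V bilinear_dcop_right] clinear_add[OF clinear_tensor_assoc])
qed

text \<open>Summing a basis factor against its coordinate at 1_p replaces that factor by
  1_p.\<close>

lemma dcounit_dcop:
  assumes "f \<in> V"
  shows "tensor_lift_on V V (\<lambda>a b. dcounit a *\<^sub>C b) (dcop f) = f"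
    and "tensor_lift_on V V (\<lambda>a b. dcounit b *\<^sub>C a) (dcop f) = f"
proof -
  have b: "bilinear_on V V (\<lambda>a b. dcounit a *\<^sub>C b)" "bilinear_on V V (\<lambda>a b. dcounit b *\<^sub>C a)"
    by (rule bilinear_on_intro; simp only: dcounit_add dcounit_scale scaleC_add_left
        scaleC_add_right scaleC_scaleC mult.commute)+
  show "tensor_lift_on V V (\<lambda>a b. dcounit a *\<^sub>C b) (dcop f) = f"
  proof (rule lift_dcop_eq[OF b(1) assms])
    fix p f assume p: "p \<in> carrier G" and f: "f \<in> cd p"
    have "(\<Sum>i\<in>basis p. \<Sum>j\<in>basis p. f (i * j) *\<^sub>C dcounit (coord p i) *\<^sub>C coord p j)
      = (\<Sum>j\<in>basis p. (\<Sum>i\<in>basis p. f (i * j) * coord p i (un p)) *\<^sub>C coord p j)"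
      by (subst sum.swap) (simp add: dcounit_cd[OF p coord_cd[OF p]] complex_vector.scale_sum_left scaleC_scaleC)
    also have "\<dots> = (\<Sum>j\<in>basis p. f j *\<^sub>C coord p j)"
      by (simp add: sum_coord_functional[OF p f un_in[OF p]] un_left[OF p] basis_in[OF p])
    finally show "(\<Sum>i\<in>basis p. \<Sum>j\<in>basis p. f (i * j) *\<^sub>C dcounit (coord p i) *\<^sub>C coord p j) = f"
      by (simp only: cd_expand[OF p f])
  qed (rule refl)
  show "tensor_lift_on V V (\<lambda>a b. dcounit b *\<^sub>C a) (dcop f) = f"
  proof (rule lift_dcop_eq[OF b(2) assms])
    fix p f assume p: "p \<in> carrier G" and f: "f \<in> cd p"
    have "(\<Sum>i\<in>basis p. \<Sum>j\<in>basis p. f (i * j) *\<^sub>C dcounit (coord p j) *\<^sub>C coord p i)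
      = (\<Sum>i\<in>basis p. (\<Sum>j\<in>basis p. f (i * j) * coord p j (un p)) *\<^sub>C coord p i)"
      by (simp add: dcounit_cd[OF p coord_cd[OF p]] complex_vector.scale_sum_left scaleC_scaleC)
    also have "\<dots> = (\<Sum>i\<in>basis p. f i *\<^sub>C coord p i)"
      by (simp add: sum_coord_functional[OF p f un_in[OF p]] un_right[OF p] basis_in[OF p])
    finally show "(\<Sum>i\<in>basis p. \<Sum>j\<in>basis p. f (i * j) *\<^sub>C dcounit (coord p j) *\<^sub>C coord p i) = f"
      by (simp only: cd_expand[OF p f])
  qed (rule refl)
qed

text \<open>Multiplicativity of \<open>eps\<close> makes the coefficients \<epsilon>(e_i e_j) split
  into a product.\<close>

lemma dcop_eps: "dcop eps = eps \<otimes>\<^sub>T eps"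
proof -
  have "dcop eps = (\<Sum>i\<in>basis \<one>. eps i *\<^sub>C coord \<one> i) \<otimes>\<^sub>T (\<Sum>i\<in>basis \<one>. eps i *\<^sub>C coord \<one> i)"
    by (simp add: dcop_cd[OF one_closed eps_cd] eps_mult tens_sums)
  then show ?thesis by (simp only: cd_expand[OF one_closed eps_cd])
qed

text \<open>Multiplicativity of \<Delta>_{p,q} in coordinates: (fg)(mn) = f(m_1 n_1) g(m_2 n_2),
  with \<open>f\<close> and \<open>g\<close> on products expanded by the dual bases of A_p and
  A_q.\<close>

lemma conv_mult_expand:
  assumes p: "p \<in> carrier G" and q: "q \<in> carrier G" and f: "f \<in> cd p" and g: "g \<in> cd q"
  shows "conv f g (m * n) = (\<Sum>i\<in>basis p. \<Sum>j\<in>basis p. \<Sum>k\<in>basis q. \<Sum>l\<in>basis q.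
    (f (i * j) * g (k * l)) * (conv (coord p i) (coord q k) m * conv (coord p j) (coord q l) n))"
proof -
  note fl = clinear_simps[OF cd_linear[OF f]]
  note gl = clinear_simps[OF cd_linear[OF g]]
  note cpl = clinear_simps[OF cd_linear[OF coord_cd[OF p]]]
  note cql = clinear_simps[OF cd_linear[OF coord_cd[OF q]]]
  have prod: "tsum s h * tsum t k = tsum s (\<lambda>x y. tsum t (\<lambda>u v. h x y * k u v))"
    for s t :: "('a, 'a) tensor" and h k :: "'a \<Rightarrow> 'a \<Rightarrow> complex"
    by (simp add: tsum_times_complex) (simp add: mult.commute tsum_times_complex)
  let ?E = "\<lambda>x y u v. (\<Sum>i\<in>basis p. \<Sum>j\<in>basis p. f (i * j) * (coord p i x * coord p j u)) *
      (\<Sum>k\<in>basis q. \<Sum>l\<in>basis q. g (k * l) * (coord q k y * coord q l v))"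
  have E: "?E x y u v = (\<Sum>i\<in>basis p. \<Sum>j\<in>basis p. \<Sum>k\<in>basis q. \<Sum>l\<in>basis q.
    (f (i * j) * g (k * l)) * ((coord p i x * coord q k y) * (coord p j u * coord q l v)))" for x y u v
  proof -
    have "?E x y u v = (\<Sum>i\<in>basis p. \<Sum>j\<in>basis p. (f (i * j) * (coord p i x * coord p j u)) *
      (\<Sum>k\<in>basis q. \<Sum>l\<in>basis q. g (k * l) * (coord q k y * coord q l v)))"
      by (simp only: sum_distrib_right)
    also have "\<dots> = (\<Sum>i\<in>basis p. \<Sum>j\<in>basis p. \<Sum>k\<in>basis q. \<Sum>l\<in>basis q. (f (i * j) * (coord p i x * coord p j u)) *
      (g (k * l) * (coord q k y * coord q l v)))"
      by (simp only: sum_distrib_left)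
    finally show ?thesis by (simp add: mult.commute mult.left_commute)
  qed
  have "conv f g (m * n) = sw p q m (\<lambda>x y. sw p q n (\<lambda>u v. f (x * u) * g (y * v)))"
    by (simp add: conv_cd[OF p q f g] sw_times[OF p q bilinear_functionals[OF cd_linear[OF f] cd_linear[OF g]]])
  also have "\<dots> = sw p q m (\<lambda>x y. sw p q n (\<lambda>u v. ?E x y u v))"
  proof (rule sw_cong[OF p q])
    show "bilinear (\<lambda>x y. sw p q n (\<lambda>u v. f (x * u) * g (y * v)))"
      unfolding bilinear_iff
      by (simp add: mult_linear_simps fl gl distrib_left distrib_right tsum_times_complex mult.assoc mult.left_commute)
    show "bilinear (\<lambda>x y. sw p q n (\<lambda>u v. ?E x y u v))"
      unfolding bilinear_iff E
      by (simp add: mult_linear_simps cpl cql distrib_left distrib_right tsum_times_complex mult.assoc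
          mult.left_commute sum.distrib sum_distrib_left tsum_sum)
    fix x y assume x: "x \<in> A p" and y: "y \<in> A q"
    show "sw p q n (\<lambda>u v. f (x * u) * g (y * v)) = sw p q n (\<lambda>u v. ?E x y u v)"
    proof (rule sw_cong[OF p q])
      show "bilinear (\<lambda>u v. f (x * u) * g (y * v))"
        unfolding bilinear_iff by (simp add: mult_linear_simps fl gl algebra_simps)
      show "bilinear (\<lambda>u v. ?E x y u v)"
        unfolding bilinear_iff E
        by (simp add: cpl cql distrib_left distrib_right mult.assoc
          mult.left_commute sum.distrib sum_distrib_left)
      fix u v assume u: "u \<in> A p" and v: "v \<in> A q"
      show "f (x * u) * g (y * v) = ?E x y u v"
        by (simp only: sum_coord_functional2[OF p f x u] sum_coord_functional2[OF q g y v])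
    qed
  qed
  finally show ?thesis
    unfolding E by (simp only: conv_cd[OF p q coord_cd[OF p] coord_cd[OF q]] prod tsum_sum tsum_times_complex)
qed

lemma sum_swap_2: "(\<Sum>i\<in>I. \<Sum>m\<in>M. \<Sum>n\<in>N. t i m n) = (\<Sum>m\<in>M. \<Sum>n\<in>N. \<Sum>i\<in>I. t i m n)"
  by (subst sum.swap) (intro sum.cong refl sum.swap)

lemma conv_tens_bilinear:
  "a \<in> V \<Longrightarrow> b \<in> V \<Longrightarrow> bilinear_on V V (\<lambda>c d. conv a c \<otimes>\<^sub>T conv b d)"
  by (rule bilinear_on_intro) (simp_all only: conv_add_right conv_scale tens_linear_simps)

text \<open>\<open>tensor_lift_on\<close> is an arbitrary linear extension off the span of the
  elementary tensors from \<open>V\<close>. Bilinearity in the outer arguments is therefore derived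
  for \<open>t\<close> in that span, by comparison on elementary tensors.\<close>

lemma tensor_mult_inner_bilinear:
  assumes t: "t \<in> V \<otimes>\<^sub>S V"
  shows "bilinear_on V V (\<lambda>a b. tensor_lift_on V V (\<lambda>c d. conv a c \<otimes>\<^sub>T conv b d) t)"
proof -
  let ?L = "\<lambda>a b. tensor_lift_on V V (\<lambda>c d. conv a c \<otimes>\<^sub>T conv b d)"
  have lin: "clinear (?L a b)" if "a \<in> V" "b \<in> V" for a b
    by (rule clinear_tensor_lift_on[OF subspace_V subspace_V conv_tens_bilinear[OF that]])
  have val: "?L a b (c \<otimes>\<^sub>T d) = conv a c \<otimes>\<^sub>T conv b d" if "a \<in> V" "b \<in> V" "c \<in> V" "d \<in> V" for a b c d
    using tensor_lift_on[OF subspace_V subspace_V conv_tens_bilinear[OF that(1,2)] that(3,4)] .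
  have sum: "clinear (\<lambda>t. ?L a b t + ?L a' b' t)" if "a \<in> V" "b \<in> V" "a' \<in> V" "b' \<in> V" for a b a' b'
    using lin[OF that(1,2)] lin[OF that(3,4)] by (simp add: clinear_iff scaleC_add_right)
  have scale: "clinear (\<lambda>t. k *\<^sub>C ?L a b t)" if "a \<in> V" "b \<in> V" for k a b
    using lin[OF that] by (simp add: clinear_iff scaleC_add_right scaleC_scaleC mult.commute)
  show ?thesis
  proof (rule bilinear_on_intro)
    fix a a' b k assume a: "a \<in> V" and b: "b \<in> V"
    show "?L (k *\<^sub>C a) b t = k *\<^sub>C ?L a b t"
      by (rule linear_eq_on_tensor_span[OF lin[OF V_scale[OF a] b] scale[OF a b] _ t])
        (simp only: val a b V_scale conv_scale tens_linear_simps)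
    show "?L a (k *\<^sub>C b) t = k *\<^sub>C ?L a b t"
      by (rule linear_eq_on_tensor_span[OF lin[OF a V_scale[OF b]] scale[OF a b] _ t])
        (simp only: val a b V_scale conv_scale tens_linear_simps)
  next
    fix a a' b assume a: "a \<in> V" "a' \<in> V" and b: "b \<in> V"
    show "?L (a + a') b t = ?L a b t + ?L a' b t"
      by (rule linear_eq_on_tensor_span[OF lin[OF V_add[OF a] b] sum[OF a(1) b a(2) b] _ t])
        (simp only: val a b V_add conv_add_left tens_linear_simps)
  next
    fix a b b' assume a: "a \<in> V" and b: "b \<in> V" "b' \<in> V"
    show "?L a (b + b') t = ?L a b t + ?L a b' t"
      by (rule linear_eq_on_tensor_span[OF lin[OF a V_add[OF b]] sum[OF a b(1) a b(2)] _ t])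
        (simp only: val a b V_add conv_add_left tens_linear_simps)
  qed
qed

lemma tensor_mult_add_left:
  assumes "s \<in> V \<otimes>\<^sub>S V"
  shows "tensor_mult V conv (t + t') s = tensor_mult V conv t s + tensor_mult V conv t' s"
  unfolding tensor_mult_def
  by (rule tensor_lift_on_linear(1)[OF subspace_V subspace_V tensor_mult_inner_bilinear[OF assms]])

lemma tensor_mult_dcop:
  assumes p: "p \<in> carrier G" and f: "f \<in> cd p" and t: "t \<in> V \<otimes>\<^sub>S V"
  shows "tensor_mult V conv (dcop f) t = (\<Sum>i\<in>basis p. \<Sum>j\<in>basis p. f (i * j) *\<^sub>C
    tensor_lift_on V V (\<lambda>c d. conv (coord p i) c \<otimes>\<^sub>T conv (coord p j) d) t)"
  unfolding tensor_mult_def by (rule lift_dcop[OF tensor_mult_inner_bilinear[OF t] p f])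

lemma tensor_mult_add_right:
  assumes p: "p \<in> carrier G" and f: "f \<in> cd p" and t: "t \<in> V \<otimes>\<^sub>S V" "t' \<in> V \<otimes>\<^sub>S V"
  shows "tensor_mult V conv (dcop f) (t + t') = tensor_mult V conv (dcop f) t + tensor_mult V conv (dcop f) t'"
  by (simp add: tensor_mult_dcop[OF p f] t complex_vector.subspace_add[OF csubspace_tensor_span]
      tensor_lift_on_linear[OF subspace_V subspace_V conv_tens_bilinear] coord_V[OF p] scaleC_add_right sum.distrib)

text \<open>Expanding all convolutions in the coordinates of A_{pq} and comparing the coefficients
  of e^m \<otimes> e^n leaves \<open>conv_mult_expand\<close>.\<close>

lemma dcop_conv:
  assumes "f \<in> V" "g \<in> V"
  shows "dcop (conv f g) = tensor_mult V conv (dcop f) (dcop g)"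
  using assms
proof (induct f rule: V_induct)
  case (component p f)
  note p = component(1) and f = component(2)
  from component(3) show ?case
  proof (induct g rule: V_induct)
    case (component q g)
    note q = component(1) and g = component(2)
    let ?B = "basis p" and ?C = "basis q" and ?D = "basis (p \<otimes> q)"
    let ?c = "\<lambda>i j k l m n. (f (i * j) * g (k * l)) * (conv (coord p i) (coord q k) m * conv (coord p j) (coord q l) n)"
    have pq: "p \<otimes> q \<in> carrier G" using p q by simp
    have tens: "conv (coord p i) (coord q k) \<otimes>\<^sub>T conv (coord p j) (coord q l) = (\<Sum>m\<in>?D. \<Sum>n\<in>?D.
      (conv (coord p i) (coord q k) m * conv (coord p j) (coord q l) n) *\<^sub>C (coord (p \<otimes> q) m \<otimes>\<^sub>T coord (p \<otimes> q) n))" for i j k l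
    proof -
      have "conv (coord p i) (coord q k) \<otimes>\<^sub>T conv (coord p j) (coord q l)
        = (\<Sum>m\<in>?D. conv (coord p i) (coord q k) m *\<^sub>C coord (p \<otimes> q) m) \<otimes>\<^sub>T
          (\<Sum>n\<in>?D. conv (coord p j) (coord q l) n *\<^sub>C coord (p \<otimes> q) n)"
        by (simp only: cd_expand[OF pq conv_cd_in[OF p q coord_cd[OF p] coord_cd[OF q]]])
      then show ?thesis by (simp only: tens_sums)
    qed
    have "tensor_mult V conv (dcop f) (dcop g) = (\<Sum>i\<in>?B. \<Sum>j\<in>?B. \<Sum>k\<in>?C. \<Sum>l\<in>?C. \<Sum>m\<in>?D. \<Sum>n\<in>?D.
      ?c i j k l m n *\<^sub>C (coord (p \<otimes> q) m \<otimes>\<^sub>T coord (p \<otimes> q) n))"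
      by (simp add: tensor_mult_dcop[OF p f dcop_in[OF cd_subset[OF q g]]]
          lift_dcop[OF conv_tens_bilinear[OF coord_V[OF p] coord_V[OF p]] q g] tens
          complex_vector.scale_sum_right scaleC_scaleC mult.assoc)
    also have "\<dots> = (\<Sum>m\<in>?D. \<Sum>n\<in>?D. \<Sum>i\<in>?B. \<Sum>j\<in>?B. \<Sum>k\<in>?C. \<Sum>l\<in>?C.
      ?c i j k l m n *\<^sub>C (coord (p \<otimes> q) m \<otimes>\<^sub>T coord (p \<otimes> q) n))"
      by (simp only: sum_swap_2[of _ ?D ?D ?C] sum_swap_2[of _ ?D ?D ?B])
    also have "\<dots> = (\<Sum>m\<in>?D. \<Sum>n\<in>?D. conv f g (m * n) *\<^sub>C (coord (p \<otimes> q) m \<otimes>\<^sub>T coord (p \<otimes> q) n))"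
      by (simp only: conv_mult_expand[OF p q f g] complex_vector.scale_sum_left)
    also have "\<dots> = dcop (conv f g)"
      by (simp only: dcop_cd[OF pq conv_cd_in[OF p q f g]])
    finally show ?case ..
  next
    case (add g h)
    note fV = cd_subset[OF p f]
    show ?case
      by (simp only: conv_add_right[OF add(1,2) fV] dcop_add[OF conv_in[OF fV add(1)] conv_in[OF fV add(2)]]
          dcop_add[OF add(1,2)] tensor_mult_add_right[OF p f dcop_in[OF add(1)] dcop_in[OF add(2)]] add(3,4))
  qed
next
  case (add f h)
  note hyps = add(3)[OF add(5)] add(4)[OF add(5)]
  show ?case
    by (simp only: conv_add_left[OF add(1,2,5)] dcop_add[OF conv_in[OF add(1,5)] conv_in[OF add(2,5)]]
        dcop_add[OF add(1,2)] tensor_mult_add_left[OF dcop_in[OF add(5)]] hyps)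
qed

lemma dcounit_conv:
  assumes "f \<in> V" "g \<in> V"
  shows "dcounit (conv f g) = dcounit f * dcounit g"
  using assms
proof (induct f rule: V_induct)
  case (component p f)
  note p = component(1) and f = component(2)
  from component(3) show ?case
  proof (induct g rule: V_induct)
    case (component q g)
    note q = component(1) and g = component(2)
    have "dcounit (conv f g) = conv f g (un (p \<otimes> q))"
      by (rule dcounit_cd[OF m_closed[OF p q] conv_cd_in[OF p q f g]])
    also have "\<dots> = f (un p) * g (un q)"
      using sw_un[OF p q bilinear_functionals[OF cd_linear[OF f] cd_linear[OF g]]] by (simp only: conv_cd[OF p q f g])
    finally show ?case by (simp only: dcounit_cd[OF p f] dcounit_cd[OF q g])
  next
    case (add g h)
    note fV = cd_subset[OF p f]
    show ?case
      by (simp only: conv_add_right[OF add(1,2) fV] dcounit_add[OF conv_in[OF fV add(1)] conv_in[OF fV add(2)]]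
          dcounit_add[OF add(1,2)] add(3,4) distrib_left)
  qed
next
  case (add f h)
  note hyps = add(3)[OF add(5)] add(4)[OF add(5)]
  show ?case
    by (simp only: conv_add_left[OF add(1,2,5)] dcounit_add[OF conv_in[OF add(1,5)] conv_in[OF add(2,5)]]
        dcounit_add[OF add(1,2)] hyps distrib_right)
qed

text \<open>The common core of the two antipode identities, where one of \<open>h\<close> and
  \<open>k\<close> is S and the other the identity map.\<close>

lemma sum_coord_sw:
  assumes p: "p \<in> carrier G" and f: "f \<in> cd p" and rs: "r \<in> carrier G" "s \<in> carrier G"
    and h: "clinear h" "\<And>u. u \<in> A r \<Longrightarrow> h u \<in> A p" and k: "clinear k" "\<And>v. v \<in> A s \<Longrightarrow> k v \<in> A p"
  shows "(\<Sum>i\<in>basis p. \<Sum>j\<in>basis p. f (i * j) * sw r s x (\<lambda>u v. coord p i (h u) * coord p j (k v)))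
    = sw r s x (\<lambda>u v. f (h u * k v))"
proof -
  note lin = clinear_simps[OF cd_linear[OF f]]
    clinear_simps[OF cd_linear[OF coord_cd[OF p]]]
    clinear_simps[OF h(1)] clinear_simps[OF k(1)]
  have "sw r s x (\<lambda>u v. \<Sum>i\<in>basis p. \<Sum>j\<in>basis p. f (i * j) * (coord p i (h u) * coord p j (k v)))
    = sw r s x (\<lambda>u v. f (h u * k v))"
  proof (rule sw_cong[OF rs])
    show "bilinear (\<lambda>u v. f (h u * k v))"
      unfolding bilinear_iff by (simp add: lin mult_linear_simps)
    show "bilinear (\<lambda>u v. \<Sum>i\<in>basis p. \<Sum>j\<in>basis p. f (i * j) * (coord p i (h u) * coord p j (k v)))"
      unfolding bilinear_iff
      by (simp add: lin distrib_left distrib_right sum.distrib sum_distrib_left mult.assoc mult.left_commute)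
  qed (rule sum_coord_functional2[OF p f h(2) k(2)])
  then show ?thesis by (simp add: tsum_sum tsum_times_complex)
qed

text \<open>At x the left-hand sides become f(S(x_1) x_2) and f(x_1 S(x_2)), and the antipode
  identities of the algebra turn both into \<epsilon>(x) f(1_p).\<close>

lemma dant_dcop:
  assumes "f \<in> V"
  shows "tensor_lift_on V V (\<lambda>a b. conv (dant a) b) (dcop f) = dcounit f *\<^sub>C eps"
    and "tensor_lift_on V V (\<lambda>a b. conv a (dant b)) (dcop f) = dcounit f *\<^sub>C eps"
proof -
  have b: "bilinear_on V V (\<lambda>a b. conv (dant a) b)" "bilinear_on V V (\<lambda>a b. conv a (dant b))"
    by (rule bilinear_on_intro; simp only: dant_add dant_scale dant_in conv_add_left conv_add_right conv_scale)+
  have add: "dcounit (f + g) *\<^sub>C eps = dcounit f *\<^sub>C eps + dcounit g *\<^sub>C eps" if "f \<in> V" "g \<in> V" for f g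
    by (simp only: dcounit_add[OF that] scaleC_add_left)
  have id: "clinear (\<lambda>x::'a. x)" by (simp add: clinear_iff)
  have "(\<Sum>i\<in>basis p. \<Sum>j\<in>basis p. f (i * j) *\<^sub>C conv (dant (coord p i)) (coord p j)) = dcounit f *\<^sub>C eps"
    "(\<Sum>i\<in>basis p. \<Sum>j\<in>basis p. f (i * j) *\<^sub>C conv (coord p i) (dant (coord p j))) = dcounit f *\<^sub>C eps"
    if p: "p \<in> carrier G" and f: "f \<in> cd p" for p f
  proof -
    have p': "inv p \<in> carrier G" and S: "\<And>u. u \<in> A (inv p) \<Longrightarrow> S u \<in> A p"
      using p S_in[of "inv p"] by simp_all
    have conv: "conv (dant (coord p i)) (coord p j) x = sw (inv p) p x (\<lambda>u v. coord p i (S u) * coord p j v)"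
      "conv (coord p i) (dant (coord p j)) x = sw p (inv p) x (\<lambda>u v. coord p i u * coord p j (S v))" for i j x
      by (simp_all only: conv_cd[OF p' p dant_cd[OF p coord_cd[OF p]] coord_cd[OF p]]
          conv_cd[OF p p' coord_cd[OF p] dant_cd[OF p coord_cd[OF p]]])
        (simp_all only: dant_def)
    show "(\<Sum>i\<in>basis p. \<Sum>j\<in>basis p. f (i * j) *\<^sub>C conv (dant (coord p i)) (coord p j)) = dcounit f *\<^sub>C eps"
      using sum_coord_sw[OF p f p' p clinear_S S id] sw_S_left_apply[OF p cd_linear[OF f]]
      by (simp add: fun_eq_iff sum_apply scaleC_fun_def conv dcounit_cd[OF p f] mult.commute)
    show "(\<Sum>i\<in>basis p. \<Sum>j\<in>basis p. f (i * j) *\<^sub>C conv (coord p i) (dant (coord p j))) = dcounit f *\<^sub>C eps"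
      using sum_coord_sw[OF p f p p' id _ clinear_S S] sw_S_right_apply[OF p cd_linear[OF f]]
      by (simp add: fun_eq_iff sum_apply scaleC_fun_def conv dcounit_cd[OF p f] mult.commute)
  qed
  then show "tensor_lift_on V V (\<lambda>a b. conv (dant a) b) (dcop f) = dcounit f *\<^sub>C eps"
    "tensor_lift_on V V (\<lambda>a b. conv a (dant b)) (dcop f) = dcounit f *\<^sub>C eps"
    by (intro lift_dcop_eq b assms add; simp only:)+
qed

lemma dual_hopf_algebra: "hopf_algebra_on V conv eps dcop dcounit dant"
proof
  show "dcounit eps = 1" by (simp add: dcounit_cd[OF one_closed eps_cd] eps_un)
  show "linear_on V dcounit" unfolding linear_on_def by (simp add: dcounit_add dcounit_scale del: plus_fun_apply)
  show "linear_on V dant" unfolding linear_on_def using dant_add dant_scale by blast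
qed (fact subspace_V conv_bilinear conv_in conv_assoc eps_V conv_eps dcop_linear dcop_in dcop_coassoc
    dcounit_dcop dcop_conv dcop_eps dcounit_conv dant_in dant_dcop)+

text \<open>On A_p \<otimes> A_q the multiplier \<Delta>(x) acts as multiplication by
  \<Delta>_{p,q}(x). Splitting \<open>a\<close> and \<open>b\<close> into their finitely many
  components gives the defining sum of \<open>conv\<close>, taken over supports that may be larger
  than those of the two functionals.\<close>

lemma dual_product_conv:
  assumes \<phi>: "left_invariant \<phi>"
  shows "dual_product \<Delta> \<phi> conv"
  unfolding dual_product_def
proof (intro allI)
  fix a b x
  note l = left_invariant_linear[OF \<phi>]
  note fl = clinear_simps[OF l]
  have lin: "clinear (\<lambda>x. \<phi> (x * a))" for a
    unfolding clinear_iff by (simp add: fl mult_linear_simps)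
  note sub = fsupp_mult_right[OF l]
  note bl = bilinear_functionals[OF l l]
  have F: "clinear (\<lambda>t. tsum (lact (\<Delta> x) t) (\<lambda>u v. \<phi> u * \<phi> v))"
    unfolding clinear_iff
    by (simp only: clinear_simps[OF lact_linear] tsum_linear_tensor[OF bl] simp_thms)
  have "tensor_functional \<phi> \<phi> (lact (\<Delta> x) (a \<otimes>\<^sub>T b))
    = tsum (lact (\<Delta> x) ((\<Sum>p\<in>supp a. un p * a) \<otimes>\<^sub>T (\<Sum>q\<in>supp b. un q * b))) (\<lambda>u v. \<phi> u * \<phi> v)"
    by (simp add: tensor_functional_eq[OF l l] decomposition[symmetric])
  also have "\<dots> = (\<Sum>q\<in>supp b. \<Sum>p\<in>supp a. tsum (lact (\<Delta> x) ((un p * a) \<otimes>\<^sub>T (un q * b))) (\<lambda>u v. \<phi> u * \<phi> v))"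
    by (simp only: tens_sum_left tens_sum_right clinear_sum[OF F])
  also have "\<dots> = (\<Sum>q\<in>supp b. \<Sum>p\<in>supp a. sw p q x (\<lambda>u v. \<phi> (u * a) * \<phi> (v * b)))"
  proof (intro sum.cong refl)
    fix p q assume "q \<in> supp b" "p \<in> supp a"
    then have p: "p \<in> carrier G" and q: "q \<in> carrier G" using supp_carrier by auto
    have "lact (\<Delta> x) ((un p * a) \<otimes>\<^sub>T (un q * b)) = cop p q x * ((un p * a) \<otimes>\<^sub>T (un q * b))"
      using p q by (intro lact_comult tensor_span_I un_mult_in)
    then have "tsum (lact (\<Delta> x) ((un p * a) \<otimes>\<^sub>T (un q * b))) (\<lambda>u v. \<phi> u * \<phi> v)
      = sw p q x (\<lambda>u v. \<phi> (u * (un p * a)) * \<phi> (v * (un q * b)))"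
      by (simp only: tsum_times[OF bl], subst tsum_of_tens)
        (simp_all add: bilinear_functionals[OF lin lin] bilinear_iff mult_linear_simps fl algebra_simps)
    also have "\<dots> = sw p q x (\<lambda>u v. \<phi> (u * a) * \<phi> (v * b))"
    proof (rule sw_cong[OF p q bilinear_functionals[OF lin lin] bilinear_functionals[OF lin lin]])
      fix u v assume "u \<in> A p" "v \<in> A q"
      then show "\<phi> (u * (un p * a)) * \<phi> (v * (un q * b)) = \<phi> (u * a) * \<phi> (v * b)"
        using p q by (simp add: mult.assoc[symmetric] un_right)
    qed
    finally show "tsum (lact (\<Delta> x) ((un p * a) \<otimes>\<^sub>T (un q * b))) (\<lambda>u v. \<phi> u * \<phi> v)
      = sw p q x (\<lambda>u v. \<phi> (u * a) * \<phi> (v * b))" .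
  qed
  also have "\<dots> = conv (\<lambda>x. \<phi> (x * a)) (\<lambda>x. \<phi> (x * b)) x"
    using conv_eq[OF lin lin finite_supp finite_supp supp_carrier supp_carrier sub sub, of a b x]
    by (simp only: sum.swap[of _ "supp a" "supp b"])
  finally show "conv (\<lambda>x. \<phi> (x * a)) (\<lambda>x. \<phi> (x * b)) x = tensor_functional \<phi> \<phi> (lact (\<Delta> x) (a \<otimes>\<^sub>T b))" ..
qed

end

theorem corollary3p4:
  fixes G :: "('g, 'm) monoid_scheme"
    and \<Delta> :: "'a::complex_algebra \<Rightarrow> ('a, 'a) tensor multiplier"
    and A :: "'g \<Rightarrow> 'a set"
  assumes "regular_multiplier_hopf_algebra \<Delta>"
    and "group_cograded G \<Delta> A"
    and "\<forall>p\<in>carrier G. finite_dim (A p) \<and> (\<exists>u. is_identity (A p) u)"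
  shows "(\<exists>\<phi>. left_integral \<Delta> \<phi>) \<and> (\<exists>\<psi>. right_integral \<Delta> \<psi>) \<and>
    (\<forall>\<phi>. left_integral \<Delta> \<phi> \<longrightarrow>
      dual_space \<phi> = graded_dual G A \<and>
      (\<exists>mul u D e S.
        hopf_algebra_on (dual_space \<phi>) mul u D e S \<and>
        dual_product \<Delta> \<phi> mul \<and>
        dual_coproduct \<phi> D \<and>
        (\<forall>p\<in>carrier G. \<forall>q\<in>carrier G. \<forall>f\<in>component_dual G A p. \<forall>g\<in>component_dual G A q.
          mul f g \<in> component_dual G A (p \<otimes>\<^bsub>G\<^esub> q) \<and>
          (\<forall>x\<in>A (p \<otimes>\<^bsub>G\<^esub> q). mul f g x = tensor_functional f g (comult_component \<Delta> A p q x))) \<and>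
        u \<in> component_dual G A \<one>\<^bsub>G\<^esub> \<and> (\<forall>x\<in>A \<one>\<^bsub>G\<^esub>. u x = counit \<Delta> x) \<and>
        (\<forall>p\<in>carrier G. \<forall>f\<in>component_dual G A p.
          D f \<in> component_dual G A p \<otimes>\<^sub>S component_dual G A p \<and>
          (\<forall>x\<in>A p. \<forall>y\<in>A p. tensor_eval (D f) x y = f (x * y))) \<and>
        (\<forall>p\<in>carrier G. \<forall>f\<in>component_dual G A p. e f = f (identity_of (A p))) \<and>
        (\<forall>p\<in>carrier G. \<forall>f\<in>component_dual G A p.
          S f \<in> component_dual G A (inv\<^bsub>G\<^esub> p) \<and>
          (\<forall>x\<in>A (inv\<^bsub>G\<^esub> p). S f x = f (alg_of (antipode \<Delta> x))))))"
proof -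
  interpret group_cograded G \<Delta> A by (rule assms(2))
  interpret unital_cograded G \<Delta> A by unfold_locales (use assms(3) in auto)
  obtain \<phi>0 where "left_integral \<Delta> \<phi>0" using left_integral_exists by blast
  obtain \<psi>0 where "right_integral \<Delta> \<psi>0" using right_integral_exists by blast
  show ?thesis
  proof (intro conjI allI impI exI ballI)
    show "left_integral \<Delta> \<phi>0" by fact
    show "right_integral \<Delta> \<psi>0" by fact
    fix \<phi> assume "left_integral \<Delta> \<phi>"
    then have \<phi>: "left_invariant \<phi>" "\<phi> \<noteq> (\<lambda>x. 0)" by (simp_all add: left_integral_iff)
    show V: "dual_space \<phi> = graded_dual G A" by (rule dual_space_eq[OF \<phi>])
    show "hopf_algebra_on (dual_space \<phi>) conv eps dcop dcounit dant"
      unfolding V by (rule dual_hopf_algebra)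
    show "dual_product \<Delta> \<phi> conv" by (rule dual_product_conv[OF \<phi>(1)])
    show "dual_coproduct \<phi> dcop"
      unfolding dual_coproduct_def V using tensor_eval_dcop by blast
    show "eps \<in> component_dual G A \<one>\<^bsub>G\<^esub>" by (rule eps_cd)
    show "eps x = counit \<Delta> x" for x by (simp add: counit_eq)
    fix p f assume p: "p \<in> carrier G" and f: "f \<in> component_dual G A p"
    show "dcop f \<in> component_dual G A p \<otimes>\<^sub>S component_dual G A p" by (rule dcop_cd_in[OF p f])
    show "tensor_eval (dcop f) x y = f (x * y)" for x y by (rule tensor_eval_dcop[OF cd_subset[OF p f]])
    show "dcounit f = f (identity_of (A p))" using dcounit_cd[OF p f] by (simp add: un_def)
    show "dant f \<in> component_dual G A (inv\<^bsub>G\<^esub> p)" by (rule dant_cd[OF p f])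
    show "dant f x = f (alg_of (antipode \<Delta> x))" for x by (simp add: dant_def antipode_eq)
    fix q g assume q: "q \<in> carrier G" and g: "g \<in> component_dual G A q"
    show "conv f g \<in> component_dual G A (p \<otimes>\<^bsub>G\<^esub> q)" by (rule conv_cd_in[OF p q f g])
    show "conv f g x = tensor_functional f g (comult_component \<Delta> A p q x)" for x
      by (simp only: conv_cd[OF p q f g] comult_component_eq[OF p q] tensor_functional_eq[OF cd_linear[OF f] cd_linear[OF g]])
  qed
qed

end
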